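(* Let $S$ be an inverse semigroup with zero. Then the following are equivalent. (1) $\mathsf{G}_{m}(S)$ is closed in $\mathsf{G}_{u}(S)$. (2) Every tight filter is an ultrafilter. (3) Every idempotent tight filter is an idempotent ultrafilter. (4) $\mathsf{G}_{m}(S)_{o}$ is closed in $\mathsf{G}_{u}(S)_{o}$. (5) For arbitrary $x_1,\ldots,x_n\leq x\in S$ the set $V_{x;x_1,\ldots,x_n}$ is compact. (6) The tight completion $\mathsf{D}_{t}(S)$ of $S$ is weakly boolean.
   Context: Inverse semigroups carry their natural partial order; $a^{\downarrow}=\{y:y\le a\}$. Elements $s,t$ are compatible if $s^{-1}t$ and $st^{-1}$ are idempotents. A filter is a non-empty, upward closed subset $F$ such that for $a,b\in F$ there is $c\in F$ with $c\le a,b$; all filters are proper ($0\notin F$). An ultrafilter is a maximal filter. A filter is idempotent if it contains an idempotent. Filters form a groupoid: $\mathbf{d}(A)=(A^{-1}A)^{\uparrow}$, $\mathbf{r}(A)=(AA^{-1})^{\uparrow}$ (upward closures), and $A\cdot B=(AB)^{\uparrow}$ is defined iff $\mathbf{d}(A)=\mathbf{r}(B)$; the identities are the idempotent filters. For a groupoid $G$, $G_o$ is its set of identities. The universal groupoid $\mathsf{G}_u(S)$ is the groupoid of all filters on $S$ with the topology whose basis consists of the sets $U_{x;x_1,\dots,x_n}=U_x\cap U_{x_1}^c\cap\dots\cap U_{x_n}^c$ with $x_1,\dots,x_n\le x$, where $U_x$ is the set of all filters containing $x$ and $^c$ denotes complement. $\mathsf{G}_m(S)\subseteq\mathsf{G}_u(S)$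 is the subgroupoid of ultrafilters with the subspace topology, and $V_{x;x_1,\dots,x_n}=U_{x;x_1,\dots,x_n}\cap\mathsf{G}_m(S)$. For $a\in S$ and $B\subseteq S$ write $a\to B$ if for each $0\ne x\le a$ there is $b\in B$ such that some non-zero element lies below both $x$ and $b$. Let $\mathcal{T}(a)$ be the set of all finite subsets $B\subseteq a^{\downarrow}$ with $a\to B$. A tight filter is a filter $A$ such that $x\in A$ and $X\in\mathcal{T}(x)$ imply $X\cap A\ne\emptyset$. A distributive inverse semigroup is an inverse semigroup in which finite compatible subsets have joins and multiplication distributes over them; it is weakly boolean if its semilattice of idempotents is a boolean algebra (not necessarily with top element). A homomorphism $\theta\colon S\to T$ to a distributive inverse semigroup is tight if $\theta(a)=\bigvee_{b\in B}\theta(b)$ for all $a\in S$, $B\in\mathcal{T}(a)$. The tight completion $\mathsf{D}_t(S)$ is the distributive inverse semigroup with a tight map $\delta\colon S\to\mathsf{D}_t(S)$ through which every tight map from $S$ to a distributive inverse semigroup factors via a unique homomorphism preserving finite compatible joins. It is constructed as follows: $a\equiv b$ iff $\mathcal{T}(a)\cap\mathcal{T}(b)\ne\emptyset$ is a congruence on $S$; put $\mathbf{S}=S/{\equiv}$ with its own tight coverage $\mathcal{T}$; for a compatible order ideal $A$ of $\mathbf{S}$ (downward closed, pairwise compatible, containing $0$) put $\overline{A}=\{x:\exists X\subseteq A,\ X\in\mathcal{T}(x)\}$; then $\mathsf{D}_t(S)$ consists of the sets $\overline{\{a_1,\dots,a_m\}^{\downarrow}}$ with $\{a_1,\dots,a_m\}$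 a finite compatible subset of $\mathbf{S}$, with product $A\cdot B=\overline{AB}$ and order given by inclusion, and $\delta(s)=\overline{\mathbf{s}^{\downarrow}}$, $\mathbf{s}$ being the class of $s$. *)

theory Defs
  imports "HOL-Analysis.Analysis" "HOL-Algebra.Lattice"
begin

section \<open>Inverse semigroups with zero\<close>

record 'a zsemigroup = "'a partial_object" +
  smult :: "'a \<Rightarrow> 'a \<Rightarrow> 'a" (infixl \<open>\<cdot>\<index>\<close> 70)
  szero :: 'a

definition is_inverse :: "('a, 'b) zsemigroup_scheme \<Rightarrow> 'a \<Rightarrow> 'a \<Rightarrow> bool" where
  "is_inverse S a b \<longleftrightarrow>
     b \<in> carrier S \<and> a \<cdot>\<^bsub>S\<^esub> b \<cdot>\<^bsub>S\<^esub> a = a \<and> b \<cdot>\<^bsub>S\<^esub> a \<cdot>\<^bsub>S\<^esub> b = b"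

locale inverse_semigroup_with_zero =
  fixes S :: "('a, 'b) zsemigroup_scheme" (structure)
  assumes mult_closed: "\<lbrakk>a \<in> carrier S; b \<in> carrier S\<rbrakk> \<Longrightarrow> a \<cdot> b \<in> carrier S"
    and mult_assoc: "\<lbrakk>a \<in> carrier S; b \<in> carrier S; c \<in> carrier S\<rbrakk> \<Longrightarrow> a \<cdot> b \<cdot> c = a \<cdot> (b \<cdot> c)"
    and unique_inverse: "a \<in> carrier S \<Longrightarrow> \<exists>!b. is_inverse S a b"
    and zero_closed: "szero S \<in> carrier S"
    and zero_left: "a \<in> carrier S \<Longrightarrow> szero S \<cdot> a = szero S"
    and zero_right: "a \<in> carrier S \<Longrightarrow> a \<cdot> szero S = szero S"

definition sinv :: "('a, 'b) zsemigroup_scheme \<Rightarrow> 'a \<Rightarrow> 'a" where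
  "sinv S a = (THE b. is_inverse S a b)"

definition idempotents :: "('a, 'b) zsemigroup_scheme \<Rightarrow> 'a set" where
  "idempotents S = {e \<in> carrier S. e \<cdot>\<^bsub>S\<^esub> e = e}"

definition nat_le :: "('a, 'b) zsemigroup_scheme \<Rightarrow> 'a \<Rightarrow> 'a \<Rightarrow> bool" where
  "nat_le S a b \<longleftrightarrow> (\<exists>e \<in> idempotents S. a = b \<cdot>\<^bsub>S\<^esub> e)"

definition down :: "('a, 'b) zsemigroup_scheme \<Rightarrow> 'a \<Rightarrow> 'a set" where
  "down S a = {y \<in> carrier S. nat_le S y a}"

definition down_set :: "('a, 'b) zsemigroup_scheme \<Rightarrow> 'a set \<Rightarrow> 'a set" where
  "down_set S A = (\<Union>a\<in>A. down S a)"

definition up_set :: "('a, 'b) zsemigroup_scheme \<Rightarrow> 'a set \<Rightarrow> 'a set" where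
  "up_set S A = {x \<in> carrier S. \<exists>a\<in>A. nat_le S a x}"

definition set_mult :: "('a, 'b) zsemigroup_scheme \<Rightarrow> 'a set \<Rightarrow> 'a set \<Rightarrow> 'a set" where
  "set_mult S A B = {a \<cdot>\<^bsub>S\<^esub> b |a b. a \<in> A \<and> b \<in> B}"

definition compatible :: "('a, 'b) zsemigroup_scheme \<Rightarrow> 'a \<Rightarrow> 'a \<Rightarrow> bool" where
  "compatible S s t \<longleftrightarrow>
     sinv S s \<cdot>\<^bsub>S\<^esub> t \<in> idempotents S \<and> s \<cdot>\<^bsub>S\<^esub> sinv S t \<in> idempotents S"

definition compatible_set :: "('a, 'b) zsemigroup_scheme \<Rightarrow> 'a set \<Rightarrow> bool" where
  "compatible_set S A \<longleftrightarrow> A \<subseteq> carrier S \<and> (\<forall>s\<in>A. \<forall>t\<in>A. compatible S s t)"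


section \<open>Filters and their groupoid\<close>

text \<open>All filters are proper.\<close>

definition sfilter :: "('a, 'b) zsemigroup_scheme \<Rightarrow> 'a set \<Rightarrow> bool" where
  "sfilter S F \<longleftrightarrow>
     F \<subseteq> carrier S \<and> F \<noteq> {} \<and> szero S \<notin> F \<and>
     (\<forall>a\<in>F. \<forall>b\<in>carrier S. nat_le S a b \<longrightarrow> b \<in> F) \<and>
     (\<forall>a\<in>F. \<forall>b\<in>F. \<exists>c\<in>F. nat_le S c a \<and> nat_le S c b)"

definition sultrafilter :: "('a, 'b) zsemigroup_scheme \<Rightarrow> 'a set \<Rightarrow> bool" where
  "sultrafilter S F \<longleftrightarrow> sfilter S F \<and> (\<forall>F'. sfilter S F' \<longrightarrow> F \<subseteq> F' \<longrightarrow> F' = F)"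

definition contains_idempotent :: "('a, 'b) zsemigroup_scheme \<Rightarrow> 'a set \<Rightarrow> bool" where
  "contains_idempotent S F \<longleftrightarrow> F \<inter> idempotents S \<noteq> {}"

text \<open>The product \<open>gcomp G x y\<close> of a groupoid is meaningful only if \<open>gdom G x = gran G y\<close>.\<close>

record 'g groupoid = "'g partial_object" +
  gdom :: "'g \<Rightarrow> 'g"
  gran :: "'g \<Rightarrow> 'g"
  gcomp :: "'g \<Rightarrow> 'g \<Rightarrow> 'g"

definition identities :: "('g, 'h) groupoid_scheme \<Rightarrow> 'g set" where
  "identities G = {e \<in> carrier G.
     (\<forall>x\<in>carrier G. gdom G e = gran G x \<longrightarrow> gcomp G e x = x) \<and>
     (\<forall>x\<in>carrier G. gdom G x = gran G e \<longrightarrow> gcomp G x e = x)}"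

definition universal_groupoid :: "('a, 'b) zsemigroup_scheme \<Rightarrow> 'a set groupoid" where
  "universal_groupoid S =
     \<lparr>carrier = {A. sfilter S A},
      gdom = (\<lambda>A. up_set S (set_mult S (sinv S ` A) A)),
      gran = (\<lambda>A. up_set S (set_mult S A (sinv S ` A))),
      gcomp = (\<lambda>A B. up_set S (set_mult S A B))\<rparr>"

definition ultrafilter_groupoid :: "('a, 'b) zsemigroup_scheme \<Rightarrow> 'a set groupoid" where
  "ultrafilter_groupoid S = (universal_groupoid S)\<lparr>carrier := {A. sultrafilter S A}\<rparr>"

text \<open>
  \<open>U_basic S x X\<close> is \<open>U\<close> with index \<open>x; x\<^sub>1, \<dots>, x\<^sub>n\<close>, where \<open>X = {x\<^sub>1, \<dots>, x\<^sub>n}\<close>; the case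
  \<open>X = {}\<close> is \<open>U\<close> with index \<open>x\<close>.
\<close>

definition U_basic :: "('a, 'b) zsemigroup_scheme \<Rightarrow> 'a \<Rightarrow> 'a set \<Rightarrow> 'a set set" where
  "U_basic S x X = {A \<in> carrier (universal_groupoid S). x \<in> A \<and> X \<inter> A = {}}"

definition universal_topology :: "('a, 'b) zsemigroup_scheme \<Rightarrow> 'a set topology" where
  "universal_topology S =
     topology_generated_by {U_basic S x X |x X. x \<in> carrier S \<and> finite X \<and> X \<subseteq> down S x}"

definition ultrafilter_topology :: "('a, 'b) zsemigroup_scheme \<Rightarrow> 'a set topology" where
  "ultrafilter_topology S =
     subtopology (universal_topology S) (carrier (ultrafilter_groupoid S))"

definition V_basic :: "('a, 'b) zsemigroup_scheme \<Rightarrow> 'a \<Rightarrow> 'a set \<Rightarrow> 'a set set" where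
  "V_basic S x X = U_basic S x X \<inter> carrier (ultrafilter_groupoid S)"


section \<open>Tight coverages and tight filters\<close>

definition arrow :: "('a, 'b) zsemigroup_scheme \<Rightarrow> 'a \<Rightarrow> 'a set \<Rightarrow> bool" where
  "arrow S a B \<longleftrightarrow>
     (\<forall>x\<in>down S a. x \<noteq> szero S \<longrightarrow> (\<exists>b\<in>B. \<exists>z\<in>down S x \<inter> down S b. z \<noteq> szero S))"

definition tight_cov :: "('a, 'b) zsemigroup_scheme \<Rightarrow> 'a \<Rightarrow> 'a set set" where
  "tight_cov S a = {B. finite B \<and> B \<subseteq> down S a \<and> arrow S a B}"

definition tight_filter :: "('a, 'b) zsemigroup_scheme \<Rightarrow> 'a set \<Rightarrow> bool" where
  "tight_filter S A \<longleftrightarrow>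
     sfilter S A \<and> (\<forall>x\<in>A. \<forall>X\<in>tight_cov S x. X \<inter> A \<noteq> {})"


section \<open>Distributive and weakly boolean inverse semigroups\<close>

definition nat_order :: "('a, 'b) zsemigroup_scheme \<Rightarrow> 'a gorder" where
  "nat_order S = \<lparr>carrier = carrier S, eq = (=), le = nat_le S\<rparr>"

definition is_join :: "('a, 'b) zsemigroup_scheme \<Rightarrow> 'a set \<Rightarrow> 'a \<Rightarrow> bool" where
  "is_join S B s \<longleftrightarrow> least (nat_order S) s (Upper (nat_order S) B)"

locale distributive_inverse_semigroup = inverse_semigroup_with_zero +
  assumes join_exists: "\<lbrakk>finite B; compatible_set S B\<rbrakk> \<Longrightarrow> \<exists>s. is_join S B s"
    and mult_join_left: "\<lbrakk>finite B; compatible_set S B; is_join S B s; a \<in> carrier S\<rbrakk>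
           \<Longrightarrow> is_join S ((\<lambda>b. a \<cdot> b) ` B) (a \<cdot> s)"
    and mult_join_right: "\<lbrakk>finite B; compatible_set S B; is_join S B s; a \<in> carrier S\<rbrakk>
           \<Longrightarrow> is_join S ((\<lambda>b. b \<cdot> a) ` B) (s \<cdot> a)"

definition idempotent_order :: "('a, 'b) zsemigroup_scheme \<Rightarrow> 'a gorder" where
  "idempotent_order S = \<lparr>carrier = idempotents S, eq = (=), le = nat_le S\<rparr>"

text \<open>
  Boolean algebras not necessarily with top: distributive lattices with a bottom element in which
  every principal order ideal is complemented.
\<close>

locale generalized_boolean_algebra = lattice L + weak_partial_order_bottom L for L (structure) +
  assumes meet_join_distrib: "\<lbrakk>x \<in> carrier L; y \<in> carrier L; z \<in> carrier L\<rbrakk>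
           \<Longrightarrow> x \<sqinter> (y \<squnion> z) = (x \<sqinter> y) \<squnion> (x \<sqinter> z)"
    and relative_complement: "\<lbrakk>x \<in> carrier L; y \<in> carrier L; x \<sqsubseteq> y\<rbrakk>
           \<Longrightarrow> \<exists>z\<in>carrier L. x \<sqinter> z = \<bottom> \<and> x \<squnion> z = y"

locale weakly_boolean = distributive_inverse_semigroup +
  assumes idempotents_boolean: "generalized_boolean_algebra (idempotent_order S)"


section \<open>The tight completion\<close>

definition tight_rel :: "('a, 'b) zsemigroup_scheme \<Rightarrow> ('a \<times> 'a) set" where
  "tight_rel S = {(a, b). a \<in> carrier S \<and> b \<in> carrier S \<and> tight_cov S a \<inter> tight_cov S b \<noteq> {}}"

text \<open>
  As \<open>tight_rel S\<close> is a congruence, the product below of the classes of \<open>a\<close> and \<open>b\<close> is the class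
  of \<open>a \<cdot> b\<close>.
\<close>

definition tight_quotient :: "('a, 'b) zsemigroup_scheme \<Rightarrow> 'a set zsemigroup" where
  "tight_quotient S =
     \<lparr>carrier = carrier S // tight_rel S,
      smult = (\<lambda>X Y. tight_rel S `` set_mult S X Y),
      szero = tight_rel S `` {szero S}\<rparr>"

definition tight_closure :: "('a, 'b) zsemigroup_scheme \<Rightarrow> 'a set \<Rightarrow> 'a set" where
  "tight_closure S A = {x \<in> carrier S. \<exists>X\<subseteq>A. X \<in> tight_cov S x}"

text \<open>
  The inclusion order on \<open>tight_completion S\<close> is the natural partial order of this semigroup.
\<close>

definition tight_completion :: "('a, 'b) zsemigroup_scheme \<Rightarrow> 'a set set zsemigroup" where
  "tight_completion S = (let Q = tight_quotient S in
     \<lparr>carrier = {tight_closure Q (down_set Q F) |F. finite F \<and> compatible_set Q F},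
      smult = (\<lambda>A B. tight_closure Q (set_mult Q A B)),
      szero = tight_closure Q (down Q (szero Q))\<rparr>)"

end

(* All six conditions are equivalent to the algebraic condition "complemented" below: whenever y \<le> x,
   there is a finite set C of elements below x, each orthogonal to y, such that C together with y
   covers x.

   Ultrafilters are tight, and every basic neighbourhood of a tight filter contains an ultrafilter, so
   the tight filters form the closure of the ultrafilters.  A tight filter F in a filter G contains y
   or a member of C for all y \<le> x with y in G and x in F, hence F = G if the condition holds.
   Conversely, an ultrafilter through x that avoids y contains some c \<le> x orthogonal to y, so that
   compactness of V_{x;y} gives C.  The tight filters in U_{x;X} are always compact, being the image
   of a closed set of characteristic functions of filters of the meet semilattice of elements below x.

   In the tight completion the relative complement of the idempotent ideal generated by y in the one
   generated by x is generated by C.  The tight quotient neither creates nor destroys non-zero common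
   lower bounds, which transfers the condition from S to the quotient. *)

theory Submission
  imports Defs
begin

section \<open>Inverse semigroups\<close>

text \<open>Two elements of \<open>S\<close> need not have a meet, but two elements below a common x
  do: \<open>meet a b\<close>, which is a times the domain idempotent of b. Whenever meets are
  needed, the argument is moved below a single element: covers are restricted to smaller elements,
  basic open sets are shrunk, and a filter through x is encoded by its trace on the elements below
  x.

  The condition on idempotent tight filters yields complements below idempotents only. Left
  multiplication by x carries the elements below x^-1 x to the elements below x, and this recovers
  \<open>complemented\<close> for every x.

  The completion is studied first over an abstract semigroup in which elements with a common tight
  cover are equal, and only afterwards over the quotient. This separation is what keeps closures of
  sets of idempotents inside the idempotents and closures of compatible sets compatible; both facts
  are needed for the product of the completion to be that of an inverse semigroup.\<close>

lemma unique_inverse_if_idempotents_commute: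
  fixes S :: "('a, 'b) zsemigroup_scheme" (structure)
  assumes cl: "\<And>a b. a \<in> carrier S \<Longrightarrow> b \<in> carrier S \<Longrightarrow> a \<cdot> b \<in> carrier S"
    and as: "\<And>a b c. a \<in> carrier S \<Longrightarrow> b \<in> carrier S \<Longrightarrow> c \<in> carrier S \<Longrightarrow> a \<cdot> b \<cdot> c = a \<cdot> (b \<cdot> c)"
    and co: "\<And>e f. e \<in> idempotents S \<Longrightarrow> f \<in> idempotents S \<Longrightarrow> e \<cdot> f = f \<cdot> e"
    and a: "a \<in> carrier S" and ex: "\<exists>b. is_inverse S a b"
  shows "\<exists>!b. is_inverse S a b"
proof -
  have "b = c" if b: "is_inverse S a b" and c: "is_inverse S a c" for b c
  proof -
    have bc: "b \<in> carrier S" "c \<in> carrier S" using b c by (auto simp: is_inverse_def)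
    have B: "a \<cdot> (b \<cdot> a) = a" "b \<cdot> (a \<cdot> b) = b" "a \<cdot> (c \<cdot> a) = a" "c \<cdot> (a \<cdot> c) = c"
      using b c bc a by (auto simp: is_inverse_def as)
    have C: "a \<cdot> (b \<cdot> (a \<cdot> x)) = a \<cdot> x" "a \<cdot> (c \<cdot> (a \<cdot> x)) = a \<cdot> x"
       "b \<cdot> (a \<cdot> (b \<cdot> x)) = b \<cdot> x" "c \<cdot> (a \<cdot> (c \<cdot> x)) = c \<cdot> x" if "x \<in> carrier S" for x
      using B that bc a cl by (metis as)+
    have id: "a \<cdot> b \<in> idempotents S" "a \<cdot> c \<in> idempotents S" "b \<cdot> a \<in> idempotents S" "c \<cdot> a \<in> idempotents S"
      using B C bc a by (auto simp: idempotents_def as cl)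
    \<comment> \<open>Commuting ab with ac gives ac = abac = acab = ab. The next fact gives ba = ca
      in the same way, and then b = bac = c.\<close>
    have 1: "a \<cdot> (b \<cdot> (a \<cdot> c)) = a \<cdot> (c \<cdot> (a \<cdot> b))"
      using co[OF id(1) id(2)] bc a by (simp add: as cl)
    have 2: "b \<cdot> (a \<cdot> (c \<cdot> a)) = c \<cdot> (a \<cdot> (b \<cdot> a))"
      using co[OF id(3) id(4)] bc a by (simp add: as cl)
    have "b = b \<cdot> (a \<cdot> c)" using 1 B C bc a by (metis cl)
    moreover have "c = b \<cdot> (a \<cdot> c)" using 2 B C bc a by (metis cl as)
    ultimately show ?thesis by simp
  qed
  with ex show ?thesis by auto
qed

section \<open>Inverses and commuting idempotents\<close>

context inverse_semigroup_with_zero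
begin

abbreviation inv' ("\<iota>") where "\<iota> a \<equiv> sinv S a"
abbreviation idems ("E") where "E \<equiv> idempotents S"
abbreviation nle (infix "\<preceq>" 50) where "a \<preceq> b \<equiv> nat_le S a b"

lemma sinv_is_inverse: "a \<in> carrier S \<Longrightarrow> is_inverse S a (\<iota> a)"
  unfolding sinv_def by (rule theI') (rule unique_inverse)

lemma sinv_closed [simp, intro]: "a \<in> carrier S \<Longrightarrow> \<iota> a \<in> carrier S"
  using sinv_is_inverse by (auto simp: is_inverse_def)

lemmas closed [simp, intro] = mult_closed zero_closed
lemmas zero_simps [simp] = zero_left zero_right

lemma sinvI: "a \<in> carrier S \<Longrightarrow> is_inverse S a b \<Longrightarrow> \<iota> a = b"
  using sinv_is_inverse unique_inverse by blast

lemma mult_sinv_mult [simp]: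
  "a \<in> carrier S \<Longrightarrow> a \<cdot> (\<iota> a \<cdot> a) = a"
  "a \<in> carrier S \<Longrightarrow> \<iota> a \<cdot> (a \<cdot> \<iota> a) = \<iota> a"
  using sinv_is_inverse[of a] by (auto simp: is_inverse_def mult_assoc)

lemma mult_sinv_mult_left [simp]:
  assumes "a \<in> carrier S" "x \<in> carrier S"
  shows "a \<cdot> (\<iota> a \<cdot> (a \<cdot> x)) = a \<cdot> x" "\<iota> a \<cdot> (a \<cdot> (\<iota> a \<cdot> x)) = \<iota> a \<cdot> x"
proof -
  have "a \<cdot> (\<iota> a \<cdot> a) \<cdot> x = a \<cdot> x" "\<iota> a \<cdot> (a \<cdot> \<iota> a) \<cdot> x = \<iota> a \<cdot> x" using assms by (simp_all del: mult_assoc)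
  then show "a \<cdot> (\<iota> a \<cdot> (a \<cdot> x)) = a \<cdot> x" "\<iota> a \<cdot> (a \<cdot> (\<iota> a \<cdot> x)) = \<iota> a \<cdot> x"
    using assms by (simp_all add: mult_assoc del: mult_sinv_mult)
qed

lemma sinv_sinv [simp]: "a \<in> carrier S \<Longrightarrow> \<iota> (\<iota> a) = a"
  by (rule sinvI) (auto simp: is_inverse_def mult_assoc)

lemma idemI: "e \<in> carrier S \<Longrightarrow> e \<cdot> e = e \<Longrightarrow> e \<in> E"
  and idem_idem [simp]: "e \<in> E \<Longrightarrow> e \<cdot> e = e"
  and idem_closed: "e \<in> E \<Longrightarrow> e \<in> carrier S"
  by (auto simp: idempotents_def)

declare idem_closed [simp, dest]

lemma idem_idem_left [simp]: "e \<in> E \<Longrightarrow> x \<in> carrier S \<Longrightarrow> e \<cdot> (e \<cdot> x) = e \<cdot> x"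
  by (metis idem_closed idem_idem mult_assoc)

lemma sinv_idem [simp]: "e \<in> E \<Longrightarrow> \<iota> e = e"
  by (rule sinvI) (auto simp: is_inverse_def mult_assoc)

text \<open>With x the inverse of ef, the element fxe is another inverse of ef, so x = fxe. Then xx
  = f(xefx)e = x, and since an idempotent is its own inverse, ef = x.\<close>

lemma idem_mult [simp]: assumes "e \<in> E" "f \<in> E" shows "e \<cdot> f \<in> E"
proof -
  have c: "e \<in> carrier S" "f \<in> carrier S" using assms by auto
  define x where "x = \<iota> (e \<cdot> f)"
  have x: "x \<in> carrier S" using c by (simp add: x_def)
  have 1: "e \<cdot> (f \<cdot> (x \<cdot> (e \<cdot> f))) = e \<cdot> f" "x \<cdot> (e \<cdot> (f \<cdot> x)) = x"
    using sinv_is_inverse[of "e \<cdot> f"] c x by (auto simp: is_inverse_def mult_assoc x_def)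
  have "x = f \<cdot> (x \<cdot> e)"
    unfolding x_def
  proof (rule sinvI)
    show "is_inverse S (e \<cdot> f) (f \<cdot> (\<iota> (e \<cdot> f) \<cdot> e))"
      unfolding x_def[symmetric] is_inverse_def
    proof (intro conjI)
      have "f \<cdot> (x \<cdot> (e \<cdot> (f \<cdot> (x \<cdot> e)))) = f \<cdot> (x \<cdot> (e \<cdot> (f \<cdot> x)) \<cdot> e)" using c x by (simp add: mult_assoc)
      then show "f \<cdot> (x \<cdot> e) \<cdot> (e \<cdot> f) \<cdot> (f \<cdot> (x \<cdot> e)) = f \<cdot> (x \<cdot> e)"
        using assms c x 1 by (simp add: mult_assoc)
    qed (use assms c x 1 in \<open>auto simp: mult_assoc\<close>)
  qed (use c in auto)
  then have "x \<cdot> x = f \<cdot> (x \<cdot> e) \<cdot> (f \<cdot> (x \<cdot> e))" by simp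
  also have "\<dots> = f \<cdot> ((x \<cdot> (e \<cdot> (f \<cdot> x))) \<cdot> e)" using c x by (simp add: mult_assoc)
  also have "\<dots> = x" using 1 \<open>x = f \<cdot> (x \<cdot> e)\<close> by simp
  finally have "x \<in> E" using x by (auto intro: idemI)
  then have "\<iota> x = x" by simp
  then show ?thesis using \<open>x \<in> E\<close> c by (auto simp: x_def)
qed

text \<open>Both ef and fe are idempotent by now, which makes fe an inverse of ef; but ef is its own
  inverse.\<close>

lemma idem_comm: assumes "e \<in> E" "f \<in> E" shows "e \<cdot> f = f \<cdot> e"
proof -
  have "\<iota> (e \<cdot> f) = f \<cdot> e"
  proof (rule sinvI)
    have "e \<cdot> (f \<cdot> (e \<cdot> f)) = e \<cdot> f" "f \<cdot> (e \<cdot> (f \<cdot> e)) = f \<cdot> e"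
      using idem_idem[OF idem_mult[OF assms]] idem_idem[OF idem_mult[OF assms(2,1)]] assms
      by (simp_all add: mult_assoc del: idem_idem)
    then show "is_inverse S (e \<cdot> f) (f \<cdot> e)"
      using assms by (auto simp: is_inverse_def mult_assoc)
  qed (use assms in auto)
  then show ?thesis using assms by simp
qed

lemma idem_left_comm: "e \<in> E \<Longrightarrow> f \<in> E \<Longrightarrow> x \<in> carrier S \<Longrightarrow> e \<cdot> (f \<cdot> x) = f \<cdot> (e \<cdot> x)"
  by (metis idem_closed idem_comm mult_assoc)

lemma dom_idem [simp]: "a \<in> carrier S \<Longrightarrow> \<iota> a \<cdot> a \<in> E"
  and ran_idem [simp]: "a \<in> carrier S \<Longrightarrow> a \<cdot> \<iota> a \<in> E"
  by (auto intro!: idemI simp: mult_assoc)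

lemma zero_idem [simp]: "szero S \<in> E"
  by (auto intro!: idemI)

lemma sinv_mult: assumes "a \<in> carrier S" "b \<in> carrier S" shows "\<iota> (a \<cdot> b) = \<iota> b \<cdot> \<iota> a"
proof (rule sinvI)
  have 1: "b \<cdot> (\<iota> b \<cdot> (\<iota> a \<cdot> (a \<cdot> b))) = \<iota> a \<cdot> (a \<cdot> b)"
    using idem_left_comm[of "b \<cdot> \<iota> b" "\<iota> a \<cdot> a" b] assms by (simp add: mult_assoc)
  have 2: "\<iota> a \<cdot> (a \<cdot> (b \<cdot> (\<iota> b \<cdot> \<iota> a))) = b \<cdot> (\<iota> b \<cdot> \<iota> a)"
    using idem_left_comm[of "\<iota> a \<cdot> a" "b \<cdot> \<iota> b" "\<iota> a"] assms by (simp add: mult_assoc)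
  show "is_inverse S (a \<cdot> b) (\<iota> b \<cdot> \<iota> a)"
    using assms 1 2 by (simp add: is_inverse_def mult_assoc)
qed (use assms in auto)

lemma conj_idem [simp]:
  assumes "a \<in> carrier S" "e \<in> E" shows "a \<cdot> (e \<cdot> \<iota> a) \<in> E" "\<iota> a \<cdot> (e \<cdot> a) \<in> E"
proof -
  have *: "a \<cdot> (e \<cdot> \<iota> a) \<in> E" if "a \<in> carrier S" for a
  proof -
    have "\<iota> a \<cdot> (a \<cdot> (e \<cdot> \<iota> a)) = e \<cdot> \<iota> a"
      using idem_left_comm[of "\<iota> a \<cdot> a" e "\<iota> a"] assms that by (simp add: mult_assoc)
    then show ?thesis using assms that by (auto intro!: idemI simp: mult_assoc)
  qed
  show "a \<cdot> (e \<cdot> \<iota> a) \<in> E" by (rule *) fact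
  show "\<iota> a \<cdot> (e \<cdot> a) \<in> E" using *[of "\<iota> a"] assms by simp
qed

text \<open>Conjugation moves an idempotent across a. Hence \<open>nat_le\<close>, defined with
  right factors, can equally be witnessed by left factors.\<close>

lemma idem_mult_swap:
  assumes "a \<in> carrier S" "e \<in> E" shows "a \<cdot> e = a \<cdot> (e \<cdot> \<iota> a) \<cdot> a" "e \<cdot> a = a \<cdot> (\<iota> a \<cdot> (e \<cdot> a))"
proof -
  show "a \<cdot> e = a \<cdot> (e \<cdot> \<iota> a) \<cdot> a"
    using idem_comm[of e "\<iota> a \<cdot> a"] assms by (simp add: mult_assoc)
  show "e \<cdot> a = a \<cdot> (\<iota> a \<cdot> (e \<cdot> a))"
    using idem_left_comm[of "a \<cdot> \<iota> a" e a] assms by (simp add: mult_assoc)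
qed

lemma leI_right: "e \<in> E \<Longrightarrow> b \<cdot> e \<preceq> b"
  by (auto simp: nat_le_def)

lemma leI_left: "e \<in> E \<Longrightarrow> b \<in> carrier S \<Longrightarrow> e \<cdot> b \<preceq> b"
  unfolding nat_le_def using idem_mult_swap(2) conj_idem(2) by blast

lemma le_closed: "a \<preceq> b \<Longrightarrow> b \<in> carrier S \<Longrightarrow> a \<in> carrier S"
  by (auto simp: nat_le_def)

lemma le_left: assumes "a \<preceq> b" "b \<in> carrier S" obtains f where "f \<in> E" "a = f \<cdot> b"
  using assms unfolding nat_le_def using idem_mult_swap(1) conj_idem(1) by blast

text \<open>The domain idempotent of a is the canonical witness for the order: a = be implies ae =
  a, so e acts as a unit on a^-1 a.\<close>

lemma le_dom: assumes "a \<preceq> b" "b \<in> carrier S" shows "b \<cdot> (\<iota> a \<cdot> a) = a"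
proof -
  obtain e where e: "e \<in> E" "a = b \<cdot> e" using assms by (auto simp: nat_le_def)
  have "a \<cdot> e = a" using e assms by (simp add: mult_assoc)
  then have "a = b \<cdot> (e \<cdot> (\<iota> a \<cdot> a))" using e assms by (metis idem_closed mult_assoc mult_closed mult_sinv_mult(1) sinv_closed)
  also have "e \<cdot> (\<iota> a \<cdot> a) = \<iota> a \<cdot> a"
    using idem_comm[of e "\<iota> a \<cdot> a"] assms e \<open>a \<cdot> e = a\<close> by (metis dom_idem idem_closed mult_assoc mult_closed sinv_closed)
  finally show ?thesis by simp
qed

lemma le_sinv: assumes "a \<preceq> b" "b \<in> carrier S" shows "\<iota> a \<preceq> \<iota> b"
proof -
  obtain e where e: "e \<in> E" "a = b \<cdot> e" using assms by (auto simp: nat_le_def)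
  then have "\<iota> a = e \<cdot> \<iota> b" using assms by (simp add: sinv_mult)
  then show ?thesis using leI_left[of e "\<iota> b"] e assms by simp
qed

lemma le_sinv_iff: assumes "a \<in> carrier S" "b \<in> carrier S" shows "\<iota> a \<preceq> \<iota> b \<longleftrightarrow> a \<preceq> b"
  using le_sinv[of a b] le_sinv[of "\<iota> a" "\<iota> b"] assms by auto

lemma le_ran: assumes "a \<preceq> b" "b \<in> carrier S" shows "a \<cdot> (\<iota> a \<cdot> b) = a"
proof -
  have a: "a \<in> carrier S" using assms le_closed by blast
  have "\<iota> b \<cdot> (a \<cdot> \<iota> a) = \<iota> a" using le_dom[OF le_sinv[OF assms]] assms a by simp
  then have "\<iota> (\<iota> b \<cdot> (a \<cdot> \<iota> a)) = a" using a by simp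
  then show ?thesis using a assms by (simp add: sinv_mult mult_assoc)
qed

lemma le_refl [simp, intro]: "a \<in> carrier S \<Longrightarrow> a \<preceq> a"
  using leI_right[of "\<iota> a \<cdot> a" a] by simp

lemma le_trans: assumes "a \<preceq> b" "b \<preceq> c" "c \<in> carrier S" shows "a \<preceq> c"
proof -
  obtain e f where e: "e \<in> E" "f \<in> E" "a = b \<cdot> e" "b = c \<cdot> f" using assms by (auto simp: nat_le_def)
  then have "a = c \<cdot> (f \<cdot> e)" using assms by (simp add: mult_assoc)
  then show ?thesis using e by (simp add: leI_right)
qed

lemma le_antisym: assumes "a \<preceq> b" "b \<preceq> a" "a \<in> carrier S" shows "a = b"
proof -
  have b: "b \<in> carrier S" using assms le_closed by blast
  have "a = b \<cdot> (\<iota> a \<cdot> a)" "b = a \<cdot> (\<iota> b \<cdot> b)" using le_dom assms b by auto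
  then have "a = a \<cdot> (\<iota> b \<cdot> b) \<cdot> (\<iota> a \<cdot> a)" by simp
  also have "\<dots> = a \<cdot> ((\<iota> a \<cdot> a) \<cdot> (\<iota> b \<cdot> b))" using idem_comm[of "\<iota> b \<cdot> b" "\<iota> a \<cdot> a"] assms b by (simp add: mult_assoc)
  also have "\<dots> = a \<cdot> (\<iota> b \<cdot> b)"  using assms b by (simp add: mult_assoc)
  finally show ?thesis using \<open>b = a \<cdot> (\<iota> b \<cdot> b)\<close> by simp
qed

lemma le_mult: assumes "a \<preceq> b" "c \<preceq> d" "b \<in> carrier S" "d \<in> carrier S" shows "a \<cdot> c \<preceq> b \<cdot> d"
proof -
  obtain f e where e: "e \<in> E" "f \<in> E" "c = d \<cdot> e" "a = f \<cdot> b" using assms le_left by (metis nat_le_def)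
  then have "a \<cdot> c = f \<cdot> (b \<cdot> d) \<cdot> e" using assms by (simp add: mult_assoc)
  then show ?thesis using e assms leI_left[of f "b \<cdot> d"] leI_right[of e "f \<cdot> (b \<cdot> d)"] le_trans by auto
qed

lemma zero_le [simp]: "a \<in> carrier S \<Longrightarrow> szero S \<preceq> a"
  using leI_right[of "szero S" a] by simp

lemma le_zero: "a \<preceq> szero S \<Longrightarrow> a = szero S"
  by (metis le_antisym le_closed zero_closed zero_le)

lemma sinv_zero [simp]: "\<iota> (szero S) = szero S" by simp

lemma sinv_eq_zero: "a \<in> carrier S \<Longrightarrow> \<iota> a = szero S \<Longrightarrow> a = szero S"
  by (metis sinv_sinv sinv_zero)

lemma dom_eq_zero: "a \<in> carrier S \<Longrightarrow> \<iota> a \<cdot> a = szero S \<Longrightarrow> a = szero S"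
  by (metis mult_sinv_mult(1) zero_right)

lemma le_idem: "a \<preceq> e \<Longrightarrow> e \<in> E \<Longrightarrow> a \<in> E"
  by (auto simp: nat_le_def)

lemma le_dom_mono: assumes "a \<preceq> b" "b \<in> carrier S" shows "\<iota> a \<cdot> a \<preceq> \<iota> b \<cdot> b"
  using assms le_mult le_sinv by auto

lemma idem_le_iff: assumes "e \<in> E" "f \<in> E" shows "e \<preceq> f \<longleftrightarrow> e \<cdot> f = e"
proof
  assume "e \<preceq> f" then show "e \<cdot> f = e" using le_ran[of e f] assms by auto
next
  assume "e \<cdot> f = e" then show "e \<preceq> f" using leI_left[of e f] assms by auto
qed

lemma down_iff: "b \<in> carrier S \<Longrightarrow> a \<in> down S b \<longleftrightarrow> a \<preceq> b"
  using le_closed by (auto simp: down_def)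

text \<open>For a and b with a common upper bound this is their greatest lower bound. Without one it
  is only the restriction of a to the domain of b.\<close>

definition meet :: "'a \<Rightarrow> 'a \<Rightarrow> 'a" where "meet a b = a \<cdot> (\<iota> b \<cdot> b)"

lemma meet_closed [simp]: "a \<in> carrier S \<Longrightarrow> b \<in> carrier S \<Longrightarrow> meet a b \<in> carrier S"
  by (simp add: meet_def)

lemma meet_le1: "b \<in> carrier S \<Longrightarrow> meet a b \<preceq> a"
  by (simp add: meet_def leI_right)

text \<open>Below x both sides are x restricted to the two domains, and domain idempotents
  commute.\<close>

lemma meet_commute: assumes "a \<preceq> x" "b \<preceq> x" "x \<in> carrier S" shows "meet a b = meet b a"
proof -
  have c: "a \<in> carrier S" "b \<in> carrier S" using assms le_closed by auto
  have "meet a b = x \<cdot> (\<iota> a \<cdot> a) \<cdot> (\<iota> b \<cdot> b)" "meet b a = x \<cdot> (\<iota> b \<cdot> b) \<cdot> (\<iota> a \<cdot> a)"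
    using le_dom[OF assms(1)] le_dom[OF assms(2)] assms c by (auto simp: meet_def)
  then show ?thesis using c assms idem_comm[of "\<iota> b \<cdot> b" "\<iota> a \<cdot> a"] by (simp add: mult_assoc)
qed

lemma meet_le2: "a \<preceq> x \<Longrightarrow> b \<preceq> x \<Longrightarrow> x \<in> carrier S \<Longrightarrow> meet a b \<preceq> b"
  using meet_commute[of a x b] meet_le1[of a b] le_closed[of a x] by simp

lemma le_meet: assumes "c \<preceq> a" "c \<preceq> b" "a \<in> carrier S" "b \<in> carrier S" shows "c \<preceq> meet a b"
proof -
  have c: "c \<in> carrier S" using assms le_closed by auto
  have "\<iota> c \<cdot> c \<preceq> \<iota> b \<cdot> b" using assms le_dom_mono by auto
  then have "c \<cdot> (\<iota> c \<cdot> c) \<preceq> a \<cdot> (\<iota> b \<cdot> b)" using assms le_mult by auto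
  then show ?thesis using c by (simp add: meet_def)
qed

section \<open>Compatible elements\<close>

lemma compatible_dom_eq: assumes "compatible S a b" "\<iota> a \<cdot> a \<preceq> \<iota> b \<cdot> b" "a \<in> carrier S" "b \<in> carrier S" shows "a \<preceq> b"
proof -
  have e: "b \<cdot> \<iota> a \<in> E"
  proof -
    have "a \<cdot> \<iota> b \<in> E" using assms by (simp add: compatible_def)
    then have "\<iota> (a \<cdot> \<iota> b) \<in> E" by simp
    then show ?thesis using assms by (simp add: sinv_mult)
  qed
  have "a \<cdot> \<iota> b \<in> E" using assms by (simp add: compatible_def)
  have "\<iota> a \<cdot> a \<cdot> (\<iota> b \<cdot> b) = \<iota> a \<cdot> a" using assms idem_le_iff by auto
  then have "a \<cdot> (\<iota> a \<cdot> a \<cdot> (\<iota> b \<cdot> b)) = a" using assms by simp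
  \<comment> \<open>Inclusion of domains gives a = a(b^-1 b); regrouped, this is b with the
    idempotent ab^-1 in front.\<close>
  then have "a = (a \<cdot> \<iota> b) \<cdot> b" using assms by (simp add: mult_assoc)
  then show ?thesis using leI_left \<open>a \<cdot> \<iota> b \<in> E\<close> assms by metis
qed

lemma compatible_sinv: assumes "compatible S a b" "a \<in> carrier S" "b \<in> carrier S"
  shows "compatible S (\<iota> a) (\<iota> b)"
  using assms by (auto simp: compatible_def)

lemma compatible_ran_eq: assumes "compatible S a b" "a \<cdot> \<iota> a \<preceq> b \<cdot> \<iota> b" "a \<in> carrier S" "b \<in> carrier S" shows "a \<preceq> b"
  using compatible_dom_eq[of "\<iota> a" "\<iota> b"] compatible_sinv[of a b] assms le_sinv_iff by auto

lemma compatible_mono: assumes "compatible S a b" "x \<preceq> a" "y \<preceq> b" "a \<in> carrier S" "b \<in> carrier S"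
  shows "compatible S x y"
  using assms le_mult le_sinv le_idem unfolding compatible_def by (meson sinv_closed)

text \<open>The inner factor a^-1 b is idempotent, so c^-1(a^-1 b)d lies below the idempotent c^-1
  d. In the other product the inner factor is cd^-1.\<close>

lemma compatible_mult:
  assumes "compatible S a b" "compatible S c d" "a \<in> carrier S" "b \<in> carrier S" "c \<in> carrier S" "d \<in> carrier S"
  shows "compatible S (a \<cdot> c) (b \<cdot> d)"
proof -
  have 1: "\<iota> (a \<cdot> c) \<cdot> (b \<cdot> d) \<preceq> \<iota> c \<cdot> d"
  proof -
    have "(\<iota> a \<cdot> b) \<cdot> d \<preceq> d" using assms leI_left by (simp add: compatible_def)
    then have "\<iota> c \<cdot> ((\<iota> a \<cdot> b) \<cdot> d) \<preceq> \<iota> c \<cdot> d" using assms le_mult by simp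
    then show ?thesis using assms by (simp add: sinv_mult mult_assoc)
  qed
  have 2: "(a \<cdot> c) \<cdot> \<iota> (b \<cdot> d) \<preceq> a \<cdot> \<iota> b"
  proof -
    have "(c \<cdot> \<iota> d) \<cdot> \<iota> b \<preceq> \<iota> b" using assms leI_left by (simp add: compatible_def)
    then have "a \<cdot> ((c \<cdot> \<iota> d) \<cdot> \<iota> b) \<preceq> a \<cdot> \<iota> b" using assms le_mult by simp
    then show ?thesis using assms by (simp add: sinv_mult mult_assoc)
  qed
  show ?thesis using 1 2 assms le_idem by (auto simp: compatible_def)
qed

lemma compatible_refl [simp]: "a \<in> carrier S \<Longrightarrow> compatible S a a"
  by (simp add: compatible_def)

lemma idem_compatible: "e \<in> E \<Longrightarrow> f \<in> E \<Longrightarrow> compatible S e f"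
  by (simp add: compatible_def)

end

section \<open>Filters, tight filters and their topology\<close>

text \<open>The function type carries the product topology over discrete \<open>bool\<close>, so
  every coordinate cuts out a clopen set.\<close>

lemma closed_eval: "closed {f :: 'a \<Rightarrow> bool. f a}" and open_eval: "open {f :: 'a \<Rightarrow> bool. f a}"
proof -
  have c: "continuous_on UNIV (\<lambda>f :: 'a \<Rightarrow> bool. f a)" by (rule continuous_on_product_coordinates)
  have eq: "{f :: 'a \<Rightarrow> bool. f a} = (\<lambda>f. f a) -` {True}" by auto
  show "open {f :: 'a \<Rightarrow> bool. f a}" unfolding eq by (rule open_vimage[OF _ c]) (rule open_discrete)
  show "closed {f :: 'a \<Rightarrow> bool. f a}" unfolding eq by (rule closed_vimage[OF _ c]) (auto simp: closed_def open_discrete)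
qed

text \<open>Tychonoff's theorem for a power of the two-point discrete space.\<close>

lemma compact_bool_functions: "compact (UNIV :: ('a \<Rightarrow> bool) set)"
proof -
  have "compact_space (euclidean :: bool topology)"
    by (metis compact_space_def compactin_euclidean_iff finite_imp_compact finite topspace_euclidean)
  then have "compact_space (product_topology (\<lambda>_::'a. euclidean :: bool topology) UNIV)"
    unfolding compact_space_product_topology by blast
  then show ?thesis
    unfolding euclidean_product_topology compact_space_def by simp
qed

section \<open>Disjointness, complements and tight covers\<close>

context inverse_semigroup_with_zero
begin

text \<open>Disjointness is taken in the order rather than as vanishing of products: in this form
  two disjoint elements can never lie in the same filter.\<close>

definition orth :: "'a \<Rightarrow> 'a \<Rightarrow> bool" where
  "orth a b \<longleftrightarrow> (\<forall>z. z \<preceq> a \<longrightarrow> z \<preceq> b \<longrightarrow> z = szero S)"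

text \<open>The difference of x and y need not exist in \<open>S\<close>; the finite set
  \<open>C\<close> stands for the join that represents it in the completion.\<close>

definition has_complement :: "'a \<Rightarrow> 'a \<Rightarrow> bool" where
  "has_complement x y \<longleftrightarrow> (\<exists>C. finite C \<and> C \<subseteq> down S x \<and> (\<forall>c\<in>C. orth c y) \<and> arrow S x (insert y C))"

lemma arrow_iff:
  assumes "a \<in> carrier S" "B \<subseteq> carrier S"
  shows "arrow S a B \<longleftrightarrow> (\<forall>z. z \<preceq> a \<longrightarrow> z \<noteq> szero S \<longrightarrow> (\<exists>b\<in>B. \<exists>w. w \<preceq> z \<and> w \<preceq> b \<and> w \<noteq> szero S))"
proof
  assume A: "arrow S a B"
  show "\<forall>z. z \<preceq> a \<longrightarrow> z \<noteq> szero S \<longrightarrow> (\<exists>b\<in>B. \<exists>w. w \<preceq> z \<and> w \<preceq> b \<and> w \<noteq> szero S)"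
  proof (intro allI impI)
    fix z assume z: "z \<preceq> a" "z \<noteq> szero S"
    then have "z \<in> down S a" using assms by (simp add: down_iff)
    then show "\<exists>b\<in>B. \<exists>w. w \<preceq> z \<and> w \<preceq> b \<and> w \<noteq> szero S"
      using A z by (fastforce simp: arrow_def down_def)
  qed
next
  assume H: "\<forall>z. z \<preceq> a \<longrightarrow> z \<noteq> szero S \<longrightarrow> (\<exists>b\<in>B. \<exists>w. w \<preceq> z \<and> w \<preceq> b \<and> w \<noteq> szero S)"
  show "arrow S a B" unfolding arrow_def
  proof (intro ballI impI)
    fix z assume z: "z \<in> down S a" "z \<noteq> szero S"
    then obtain b w where "b \<in> B" "w \<preceq> z" "w \<preceq> b" "w \<noteq> szero S" using H by (auto simp: down_def)
    moreover have "w \<in> carrier S" using calculation assms le_closed by blast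
    ultimately show "\<exists>b\<in>B. \<exists>z'\<in>down S z \<inter> down S b. z' \<noteq> szero S" by (auto simp: down_def)
  qed
qed

lemma down_subset: "x \<in> carrier S \<Longrightarrow> X \<subseteq> down S x \<longleftrightarrow> (\<forall>y\<in>X. y \<preceq> x)"
  using down_iff by blast

lemma tight_cov_iff:
  assumes "x \<in> carrier S"
  shows "X \<in> tight_cov S x \<longleftrightarrow> finite X \<and> (\<forall>y\<in>X. y \<preceq> x) \<and>
     (\<forall>z. z \<preceq> x \<longrightarrow> z \<noteq> szero S \<longrightarrow> (\<exists>b\<in>X. \<exists>w. w \<preceq> z \<and> w \<preceq> b \<and> w \<noteq> szero S))"
proof (cases "\<forall>y\<in>X. y \<preceq> x")
  case True
  then have "X \<subseteq> carrier S" using assms le_closed by blast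
  then show ?thesis using True arrow_iff[OF assms] by (simp add: tight_cov_def down_subset[OF assms])
qed (auto simp: tight_cov_def down_subset[OF assms])

lemma tight_cov_le: "X \<in> tight_cov S x \<Longrightarrow> y \<in> X \<Longrightarrow> x \<in> carrier S \<Longrightarrow> y \<preceq> x"
  and tight_cov_finite: "X \<in> tight_cov S x \<Longrightarrow> finite X"
  by (auto simp: tight_cov_def down_def)

lemma tight_cov_meets:
  assumes "X \<in> tight_cov S x" "z \<preceq> x" "z \<noteq> szero S" "x \<in> carrier S"
  obtains b w where "b \<in> X" "w \<preceq> z" "w \<preceq> b" "w \<noteq> szero S"
proof -
  have "\<exists>b\<in>X. \<exists>w. w \<preceq> z \<and> w \<preceq> b \<and> w \<noteq> szero S"
    using assms(1-3) unfolding tight_cov_iff[OF assms(4)] by simp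
  then show ?thesis using that by auto
qed

text \<open>Pullback stability of the coverage: a common lower bound of b and an element below z
  lies below z and b, hence below \<open>meet z b\<close>.\<close>

lemma tight_cov_restrict:
  assumes X: "X \<in> tight_cov S x" and z: "z \<preceq> x" and x: "x \<in> carrier S"
  shows "(\<lambda>y. meet z y) ` X \<in> tight_cov S z"
proof -
  have c: "z \<in> carrier S" using z x le_closed by blast
  have Xc: "y \<in> carrier S" "y \<preceq> x" if "y \<in> X" for y using tight_cov_le[OF X that x] le_closed x by auto
  show ?thesis
    unfolding tight_cov_iff[OF c]
  proof (intro conjI allI impI)
    fix w assume w: "w \<preceq> z" "w \<noteq> szero S"
    then obtain b v where bv: "b \<in> X" "v \<preceq> w" "v \<preceq> b" "v \<noteq> szero S"
      using tight_cov_meets[OF X _ _ x] le_trans z x by metis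
    then have "v \<preceq> meet z b" using le_meet[of v z b] le_trans[of v w z] w c Xc by auto
    then show "\<exists>b\<in>(\<lambda>y. meet z y) ` X. \<exists>v. v \<preceq> w \<and> v \<preceq> b \<and> v \<noteq> szero S" using bv by auto
  qed (use tight_cov_finite[OF X] meet_le1 Xc in auto)
qed

section \<open>Filters, ultrafilters and tight filters\<close>

lemma filter_closed: "sfilter S F \<Longrightarrow> a \<in> F \<Longrightarrow> a \<in> carrier S"
  and filter_up: "sfilter S F \<Longrightarrow> a \<in> F \<Longrightarrow> a \<preceq> b \<Longrightarrow> b \<in> carrier S \<Longrightarrow> b \<in> F"
  and filter_nonzero: "sfilter S F \<Longrightarrow> szero S \<notin> F"
  and filter_nonempty: "sfilter S F \<Longrightarrow> F \<noteq> {}"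
  and filter_lb: "sfilter S F \<Longrightarrow> a \<in> F \<Longrightarrow> b \<in> F \<Longrightarrow> \<exists>c\<in>F. c \<preceq> a \<and> c \<preceq> b"
  by (auto simp: sfilter_def)

lemma filterI:
  assumes "\<And>a. a \<in> F \<Longrightarrow> a \<in> carrier S" "x \<in> F" "szero S \<notin> F"
    "\<And>a b. a \<in> F \<Longrightarrow> a \<preceq> b \<Longrightarrow> b \<in> carrier S \<Longrightarrow> b \<in> F"
    "\<And>a b. a \<in> F \<Longrightarrow> b \<in> F \<Longrightarrow> \<exists>c\<in>F. c \<preceq> a \<and> c \<preceq> b"
  shows "sfilter S F"
  using assms unfolding sfilter_def by blast

lemma ultrafilter_filter: "sultrafilter S F \<Longrightarrow> sfilter S F"
  by (simp add: sultrafilter_def)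

text \<open>The extra member x serves as the bound when A is empty, and it keeps the bound below x,
  where meets are available.\<close>

lemma filter_finite_lb:
  assumes F: "sfilter S F" and "finite A" "A \<subseteq> F" "x \<in> F"
  shows "\<exists>c\<in>F. c \<preceq> x \<and> (\<forall>a\<in>A. c \<preceq> a)"
  using assms(2,3)
proof (induction rule: finite_induct)
  case empty
  then show ?case using assms(4) le_refl filter_closed[OF F] by auto
next
  case (insert a A)
  then obtain c where c: "c \<in> F" "c \<preceq> x" "\<forall>a\<in>A. c \<preceq> a" by auto
  obtain d where "d \<in> F" "d \<preceq> c" "d \<preceq> a" using filter_lb[OF F c(1), of a] insert by auto
  then show ?case using c le_trans filter_closed[OF F] insert \<open>x \<in> F\<close> by (metis insert_iff subset_iff)
qed

lemma up_set_iff: "x \<in> up_set S A \<longleftrightarrow> x \<in> carrier S \<and> (\<exists>a\<in>A. a \<preceq> x)"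
  by (auto simp: up_set_def)

lemma up_set_filter:
  assumes "A \<subseteq> carrier S" "A \<noteq> {}" "szero S \<notin> A" and lb: "\<And>a b. a \<in> A \<Longrightarrow> b \<in> A \<Longrightarrow> \<exists>c\<in>A. c \<preceq> a \<and> c \<preceq> b"
  shows "sfilter S (up_set S A)"
proof -
  obtain x where x: "x \<in> A" "x \<in> carrier S" using assms by auto
  show ?thesis
  proof (rule filterI)
    show "x \<in> up_set S A" using x by (auto simp: up_set_iff)
    show "szero S \<notin> up_set S A" using assms le_zero by (auto simp: up_set_iff)
    show "\<exists>c\<in>up_set S A. c \<preceq> a \<and> c \<preceq> b" if ab: "a \<in> up_set S A" "b \<in> up_set S A" for a b
    proof -
      obtain a' b' where *: "a' \<in> A" "b' \<in> A" "a' \<preceq> a" "b' \<preceq> b" "a \<in> carrier S" "b \<in> carrier S" using ab by (auto simp: up_set_iff)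
      obtain c where "c \<in> A" "c \<preceq> a'" "c \<preceq> b'" using lb[OF *(1,2)] by auto
      moreover have "c \<in> up_set S A" using calculation assms by (auto simp: up_set_iff)
      ultimately show ?thesis using * le_trans by blast
    qed
  qed (use le_trans in \<open>auto simp: up_set_iff\<close>)
qed

text \<open>Zorn's lemma is applied to the filters through z. A maximal one among them is maximal
  among all filters, because every larger filter still contains z.\<close>

lemma ultrafilter_exists:
  assumes "z \<in> carrier S" "z \<noteq> szero S"
  obtains G where "sultrafilter S G" "z \<in> G"
proof -
  let ?A = "{F. sfilter S F \<and> z \<in> F}"
  have "up_set S {z} \<in> ?A" using up_set_filter[of "{z}"] assms by (auto simp: up_set_iff)
  moreover have "\<Union>\<C> \<in> ?A" if ne: "\<C> \<noteq> {}" and ch: "subset.chain ?A \<C>" for \<C>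
  proof -
    have C: "\<And>F. F \<in> \<C> \<Longrightarrow> sfilter S F \<and> z \<in> F" using ch by (auto simp: subset.chain_def)
    have "sfilter S (\<Union>\<C>)"
    proof (rule filterI)
      show "z \<in> \<Union>\<C>" using ne C by auto
      fix a b assume "a \<in> \<Union>\<C>" "b \<in> \<Union>\<C>"
      then obtain F1 F2 where F12: "F1 \<in> \<C>" "F2 \<in> \<C>" "a \<in> F1" "b \<in> F2" by auto
      then have "F1 \<subseteq> F2 \<or> F2 \<subseteq> F1" using ch unfolding subset.chain_def by blast
      then obtain F where "F \<in> \<C>" "a \<in> F" "b \<in> F" using F12 by blast
      then show "\<exists>c\<in>\<Union>\<C>. c \<preceq> a \<and> c \<preceq> b" using C filter_lb by blast
    qed (use C filter_closed filter_nonzero filter_up in blast)+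
    then show ?thesis using ne C by auto
  qed
  ultimately obtain G where "G \<in> ?A" "\<forall>X\<in>?A. G \<subseteq> X \<longrightarrow> X = G"
    using subset_Zorn_nonempty[of ?A] by blast
  then have "sultrafilter S G" "z \<in> G" by (auto simp: sultrafilter_def)
  then show ?thesis by (rule that)
qed

text \<open>Otherwise the meets with y of the members of G below x are all non-zero. They are
  directed downwards, so they generate a filter that contains G and also y, against
  maximality.\<close>

lemma ultrafilter_orth:
  assumes G: "sultrafilter S G" and x: "x \<in> G" and y: "y \<preceq> x" "y \<notin> G"
  shows "\<exists>c\<in>G. c \<preceq> x \<and> orth c y"
proof (rule ccontr)
  assume no: "\<not> ?thesis"
  have F: "sfilter S G" using G by (rule ultrafilter_filter)
  have c: "x \<in> carrier S" "y \<in> carrier S" using x y F filter_closed le_closed by blast+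
  let ?A = "{meet c y |c. c \<in> G \<and> c \<preceq> x}"
  have "sfilter S (up_set S ?A)"
  proof (rule up_set_filter)
    show "?A \<subseteq> carrier S" using filter_closed[OF F] c by auto
    show "?A \<noteq> {}" using x c by auto
    show "szero S \<notin> ?A"
    proof
      assume "szero S \<in> ?A"
      then obtain d where d: "d \<in> G" "d \<preceq> x" "meet d y = szero S" by auto
      then have "orth d y" using le_meet filter_closed[OF F] c le_zero unfolding orth_def by metis
      then show False using no d by blast
    qed
    show "\<exists>e\<in>?A. e \<preceq> a \<and> e \<preceq> b" if ab: "a \<in> ?A" "b \<in> ?A" for a b
    proof -
      obtain a' b' where *: "a = meet a' y" "b = meet b' y" "a' \<in> G" "b' \<in> G" "a' \<preceq> x" "b' \<preceq> x" using ab by auto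
      obtain d where d: "d \<in> G" "d \<preceq> a'" "d \<preceq> b'" using filter_lb[OF F] * by blast
      have dx: "d \<preceq> x" using d * c le_trans by blast
      have "meet d y \<preceq> a" "meet d y \<preceq> b"
        using * d c dx y filter_closed[OF F] by (auto intro!: le_meet intro: meet_le2 le_trans[OF meet_le1])
      then show ?thesis using d dx by blast
    qed
  qed
  moreover have "G \<subseteq> up_set S ?A"
  proof
    fix g assume g: "g \<in> G"
    obtain d where d: "d \<in> G" "d \<preceq> g" "d \<preceq> x" using filter_lb[OF F g x] by blast
    then have "meet d y \<preceq> g" using meet_le1 le_trans c filter_closed[OF F g] by blast
    then show "g \<in> up_set S ?A" using d filter_closed[OF F g] by (auto simp: up_set_iff)
  qed
  moreover have "y \<in> up_set S ?A" using x c meet_le2[of x x y] y by (auto simp: up_set_iff)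
  ultimately show False using G y by (auto simp: sultrafilter_def)
qed

lemma orthD: "orth a b \<Longrightarrow> z \<preceq> a \<Longrightarrow> z \<preceq> b \<Longrightarrow> z = szero S"
  by (simp add: orth_def)

text \<open>If G misses a cover X of x, then G contains, for each y in X, an element disjoint from
  y. A common lower bound of these finitely many elements and x is non-zero and disjoint from all of
  X, so X does not cover x.\<close>

lemma ultrafilter_tight:
  assumes G: "sultrafilter S G"
  shows "tight_filter S G"
proof -
  have F: "sfilter S G" using G by (rule ultrafilter_filter)
  have "X \<inter> G \<noteq> {}" if x: "x \<in> G" and X: "X \<in> tight_cov S x" for x X
  proof
    assume no: "X \<inter> G = {}"
    have xc: "x \<in> carrier S" using x F filter_closed by blast
    have "\<forall>y\<in>X. \<exists>c\<in>G. c \<preceq> x \<and> orth c y"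
      using ultrafilter_orth[OF G x] tight_cov_le[OF X] xc no by blast
    then obtain c where c: "\<And>y. y \<in> X \<Longrightarrow> c y \<in> G \<and> orth (c y) y" by metis
    then obtain d where d: "d \<in> G" "d \<preceq> x" "\<forall>y\<in>X. d \<preceq> c y"
      using filter_finite_lb[OF F, of "c ` X" x] tight_cov_finite[OF X] x by auto
    then have "d \<noteq> szero S" using F filter_nonzero by metis
    then obtain b w where w: "b \<in> X" "w \<preceq> d" "w \<preceq> b" "w \<noteq> szero S" using tight_cov_meets[OF X d(2) _ xc] by metis
    then have "w \<preceq> c b" using d c le_trans filter_closed[OF F] by metis
    then show False using w c orthD by blast
  qed
  then show ?thesis using F by (auto simp: tight_filter_def)
qed

lemma tight_filter_filter: "tight_filter S F \<Longrightarrow> sfilter S F"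
  by (simp add: tight_filter_def)

lemma tight_filter_meets: "tight_filter S F \<Longrightarrow> x \<in> F \<Longrightarrow> X \<in> tight_cov S x \<Longrightarrow> \<exists>y\<in>X. y \<in> F"
  unfolding tight_filter_def by blast

lemma complements_imp_tight_ultra:
  assumes K: "\<And>x y. x \<in> carrier S \<Longrightarrow> y \<preceq> x \<Longrightarrow> has_complement x y" and T: "tight_filter S F"
  shows "sultrafilter S F"
proof -
  have F: "sfilter S F" using T by (rule tight_filter_filter)
  have "G \<subseteq> F" if G: "sfilter S G" and sub: "F \<subseteq> G" for G
  proof
    fix z assume z: "z \<in> G"
    obtain x where x: "x \<in> F" using filter_nonempty[OF F] by auto
    obtain y where y: "y \<in> G" "y \<preceq> z" "y \<preceq> x" using filter_lb[OF G z, of x] x sub by auto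
    have xc: "x \<in> carrier S" using x F filter_closed by blast
    obtain C where C: "finite C" "C \<subseteq> down S x" "\<forall>c\<in>C. orth c y" "arrow S x (insert y C)"
      using K[OF xc y(3)] by (auto simp: has_complement_def)
    have "insert y C \<in> tight_cov S x" using C y xc by (simp add: tight_cov_def down_iff)
    then have "insert y C \<inter> F \<noteq> {}" using T x unfolding tight_filter_def by blast
    \<comment> \<open>A member c of F lies in G together with y, and a filter has no disjoint
      members.\<close>
    moreover have "c \<notin> F" if "c \<in> C" for c
    proof
      assume "c \<in> F"
      then obtain w where "w \<in> G" "w \<preceq> c" "w \<preceq> y" using filter_lb[OF G, of c y] y sub by auto
      then show False using C that orthD filter_nonzero[OF G] by metis
    qed
    ultimately have "y \<in> F" by auto
    then show "z \<in> F" using filter_up[OF F _ y(2)] filter_closed[OF G z] by blast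
  qed
  then show ?thesis using F by (auto simp: sultrafilter_def)
qed

section \<open>The universal topology: basis, closure and compactness\<close>

lemma U_basic_iff: "A \<in> U_basic S x X \<longleftrightarrow> sfilter S A \<and> x \<in> A \<and> X \<inter> A = {}"
  by (auto simp: U_basic_def universal_groupoid_def)

lemma carrier_ultrafilter_groupoid: "carrier (ultrafilter_groupoid S) = {A. sultrafilter S A}"
  by (simp add: ultrafilter_groupoid_def)

lemma topspace_universal: "topspace (universal_topology S) = {A. sfilter S A}"
proof -
  have "\<exists>x. x \<in> carrier S \<and> A \<in> U_basic S x {}" if "sfilter S A" for A
    using that filter_nonempty[OF that] filter_closed[OF that] by (auto simp: U_basic_iff)
  then have "{A. sfilter S A} \<subseteq> \<Union>{U_basic S x X |x X. x \<in> carrier S \<and> finite X \<and> X \<subseteq> down S x}"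
    by (auto; metis empty_subsetI finite.emptyI)
  moreover have "\<Union>{U_basic S x X |x X. x \<in> carrier S \<and> finite X \<and> X \<subseteq> down S x} \<subseteq> {A. sfilter S A}"
    by (auto simp: U_basic_iff)
  ultimately show ?thesis unfolding universal_topology_def topology_generated_by_topspace by blast
qed

lemma openin_U_basic:
  "x \<in> carrier S \<Longrightarrow> finite X \<Longrightarrow> X \<subseteq> down S x \<Longrightarrow> openin (universal_topology S) (U_basic S x X)"
  unfolding universal_topology_def by (rule topology_generated_by_Basis) auto

text \<open>For filters through c, containing y is the same as containing \<open>meet c y\<close>. A
  basic neighbourhood of F based at x can therefore be rebased at any member c of F below x.\<close>

lemma U_basic_shrink:
  assumes F: "F \<in> U_basic S x X" and x: "x \<in> carrier S" and X: "X \<subseteq> down S x" and c: "c \<in> F" "c \<preceq> x"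
  shows "F \<in> U_basic S c (meet c ` X)" "U_basic S c (meet c ` X) \<subseteq> U_basic S x X" "meet c ` X \<subseteq> down S c"
proof -
  have cc: "c \<in> carrier S" using c x le_closed by blast
  have y: "y \<preceq> x" "y \<in> carrier S" if "y \<in> X" for y using X that x by (auto simp: down_def)
  have m: "meet c y \<preceq> y" "meet c y \<preceq> c" if "y \<in> X" for y using y[OF that] c x meet_le2 meet_le1 by auto
  have "meet c y \<notin> F" if "y \<in> X" for y
    using F y[OF that] m(1)[OF that] filter_up that unfolding U_basic_iff by blast
  then show "F \<in> U_basic S c (meet c ` X)" using F c by (auto simp: U_basic_iff)
  show "meet c ` X \<subseteq> down S c" using m cc by (auto simp: down_iff)
  show "U_basic S c (meet c ` X) \<subseteq> U_basic S x X"
  proof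
    fix G assume G: "G \<in> U_basic S c (meet c ` X)"
    have GF: "sfilter S G" using G by (auto simp: U_basic_iff)
    have "y \<notin> G" if "y \<in> X" for y
    proof
      assume "y \<in> G"
      then obtain d where "d \<in> G" "d \<preceq> c" "d \<preceq> y" using filter_lb[OF GF] G unfolding U_basic_iff by blast
      then have "meet c y \<in> G" using filter_up[OF GF] le_meet y[OF that] cc by simp
      then show False using G that by (auto simp: U_basic_iff)
    qed
    then show "G \<in> U_basic S x X" using G filter_up[OF GF _ c(2) x] by (auto simp: U_basic_iff)
  qed
qed

text \<open>The topology is defined from these sets as a subbase; this shows that they form a basis.
  Two basic neighbourhoods of F are rebased at a common lower bound in F, and there the two finite
  sets of excluded elements are united.\<close>

lemma openin_universal_basis:
  assumes "openin (universal_topology S) W" "F \<in> W"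
  shows "\<exists>x X. x \<in> carrier S \<and> finite X \<and> X \<subseteq> down S x \<and> F \<in> U_basic S x X \<and> U_basic S x X \<subseteq> W"
proof -
  have "generate_topology_on {U_basic S x X |x X. x \<in> carrier S \<and> finite X \<and> X \<subseteq> down S x} W"
    using assms(1) unfolding universal_topology_def by (rule openin_topology_generated_by)
  then show ?thesis using assms(2)
  proof (induction)
    case (Int A B)
    then obtain x X y Y where *: "x \<in> carrier S" "finite X" "X \<subseteq> down S x" "F \<in> U_basic S x X" "U_basic S x X \<subseteq> A"
      "y \<in> carrier S" "finite Y" "Y \<subseteq> down S y" "F \<in> U_basic S y Y" "U_basic S y Y \<subseteq> B" by auto
    obtain c where c: "c \<in> F" "c \<preceq> x" "c \<preceq> y" using * filter_lb unfolding U_basic_iff by blast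
    note X = U_basic_shrink[OF *(4,1,3) c(1,2)] and Y = U_basic_shrink[OF *(9,6,8) c(1,3)]
    have "U_basic S c (meet c ` X \<union> meet c ` Y) \<subseteq> U_basic S c (meet c ` X) \<inter> U_basic S c (meet c ` Y)"
      unfolding U_basic_iff subset_iff Int_iff by blast
    then have "U_basic S c (meet c ` X \<union> meet c ` Y) \<subseteq> A \<inter> B"
      using X(2) Y(2) *(5,10) by blast
    moreover have "F \<in> U_basic S c (meet c ` X \<union> meet c ` Y)" using X Y by (auto simp: U_basic_iff)
    moreover have "c \<in> carrier S" using c * le_closed by blast
    ultimately show ?case using X(3) Y(3) * by (intro exI[of _ c] exI[of _ "meet c ` X \<union> meet c ` Y"]) auto
  next
    case (UN K)
    then obtain k where k: "k \<in> K" "F \<in> k" by blast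
    from UN(2)[OF this] show ?case using k(1) by (meson Union_upper subset_trans)
  qed auto
qed

text \<open>A failure of tightness is witnessed by some x and a cover X missed by the filter, and
  every filter in \<open>U_basic S x X\<close> fails for the same reason.\<close>

lemma closedin_tight_filters: "closedin (universal_topology S) {A. tight_filter S A}"
  unfolding closedin_def
proof (intro conjI)
  show "{A. tight_filter S A} \<subseteq> topspace (universal_topology S)"
    by (auto simp: topspace_universal tight_filter_filter)
  show "openin (universal_topology S) (topspace (universal_topology S) - {A. tight_filter S A})"
    unfolding topspace_universal
  proof (subst openin_subopen, intro ballI)
    fix F assume "F \<in> {A. sfilter S A} - {A. tight_filter S A}"
    then have F: "sfilter S F" "\<not> tight_filter S F" by auto
    then obtain x X where x: "x \<in> F" "X \<in> tight_cov S x" "X \<inter> F = {}" by (auto simp: tight_filter_def)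
    have "openin (universal_topology S) (U_basic S x X)"
      using x filter_closed[OF F(1)] by (intro openin_U_basic) (auto simp: tight_cov_def)
    moreover have "U_basic S x X \<subseteq> {A. sfilter S A} - {A. tight_filter S A}"
      using x by (auto simp: U_basic_iff tight_filter_def)
    moreover have "F \<in> U_basic S x X" using F x by (auto simp: U_basic_iff)
    ultimately show "\<exists>T. openin (universal_topology S) T \<and> F \<in> T \<and> T \<subseteq> {A. sfilter S A} - {A. tight_filter S A}" by blast
  qed
qed

text \<open>Since F is tight and misses X, the set X does not cover x. So some non-zero z below x is
  disjoint from all of X, and any ultrafilter through z will do.\<close>

lemma ultrafilter_near_tight:
  assumes T: "tight_filter S F" and U: "F \<in> U_basic S x X" and X: "finite X" "X \<subseteq> down S x"
  obtains G where "sultrafilter S G" "G \<in> U_basic S x X"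
proof -
  have x: "x \<in> F" "x \<in> carrier S" using U filter_closed by (auto simp: U_basic_iff)
  have "X \<notin> tight_cov S x" using T U by (auto simp: tight_filter_def U_basic_iff)
  then obtain z where z: "z \<preceq> x" "z \<noteq> szero S" "\<And>b w. b \<in> X \<Longrightarrow> w \<preceq> z \<Longrightarrow> w \<preceq> b \<Longrightarrow> w = szero S"
    using X x by (auto simp: tight_cov_iff down_subset)
  obtain G where G: "sultrafilter S G" "z \<in> G" using ultrafilter_exists z le_closed x by metis
  have GF: "sfilter S G" using G ultrafilter_filter by blast
  have "b \<notin> G" if "b \<in> X" for b
    using filter_lb[OF GF G(2)] z(3)[OF that] filter_nonzero[OF GF] by metis
  then have "G \<in> U_basic S x X" using GF filter_up[OF GF G(2) z(1) x(2)] by (auto simp: U_basic_iff)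
  then show ?thesis using G that by blast
qed

text \<open>Directedness asks for the existence of a lower bound, which need not be a closed
  condition on characteristic functions. Below x it becomes closure under \<open>meet\<close>, an
  implication between coordinates. Tightness is a finite disjunction because covers are finite. So
  the traces of these filters on the elements below x form a closed set \<open>K\<close> in a
  compact power.\<close>

lemma compactin_tight_filters:
  assumes x: "x \<in> carrier S" and X: "X \<subseteq> down S x"
  shows "compactin (universal_topology S) ({A. tight_filter S A} \<inter> U_basic S x X)"
proof -
  define K where "K = {f. f x \<and> \<not> f (szero S) \<and> (\<forall>a. f a \<longrightarrow> a \<in> down S x) \<and>
     (\<forall>a b. f a \<longrightarrow> a \<preceq> b \<and> b \<in> down S x \<longrightarrow> f b) \<and> (\<forall>a b. f a \<longrightarrow> f b \<longrightarrow> f (meet a b)) \<and>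
     (\<forall>a Y. f a \<longrightarrow> Y \<in> tight_cov S a \<longrightarrow> (\<exists>y\<in>Y. f y)) \<and> (\<forall>y. y \<in> X \<longrightarrow> \<not> f y)}"
  \<comment> \<open>\<open>\<Phi>\<close> recovers a filter from its trace below x by taking the
    upward closure.\<close>
  define \<Phi> where "\<Phi> f = {b \<in> carrier S. \<exists>a. f a \<and> a \<preceq> b}" for f
  have Kd: "a \<preceq> x" "a \<in> carrier S" if "f \<in> K" "f a" for f a
    using that x unfolding K_def down_def by auto
  have Kup: "f b" if "f \<in> K" "f a" "a \<preceq> b" "b \<preceq> x" for f a b
  proof -
    have "b \<in> down S x" using that x by (simp add: down_iff)
    then show ?thesis using that(1-3) unfolding K_def by blast
  qed
  have Km: "f (meet a b)" if "f \<in> K" "f a" "f b" for f a b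
    using that unfolding K_def by blast
  have Kt: "\<exists>y\<in>Y. f y" if "f \<in> K" "f a" "Y \<in> tight_cov S a" for f a Y
    using that unfolding K_def by blast
  have Kx: "f x" "\<not> f (szero S)" if "f \<in> K" for f using that unfolding K_def by auto
  have KX: "\<not> f y" if "f \<in> K" "y \<in> X" for f y using that unfolding K_def by blast
  have bex: "closed {f. \<exists>y\<in>Y. f y}" if "finite Y" for Y :: "'a set"
  proof -
    have "{f. \<exists>y\<in>Y. f y} = (\<Union>y\<in>Y. {f. f y})" by auto
    then show ?thesis using that by (auto intro!: closed_UN closed_eval)
  qed
  have tc: "closed {f. Y \<in> tight_cov S a \<longrightarrow> (\<exists>y\<in>Y. f y)}" for Y a
    using bex[OF tight_cov_finite[of Y a]] by (cases "Y \<in> tight_cov S a") auto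
  have "closed K" unfolding K_def
    by (intro closed_Collect_conj closed_Collect_all;
        (rule tc closed_Collect_const closed_eval closed_Collect_neg[OF open_eval] closed_Collect_imp[OF open_eval] closed_Collect_imp[OF open_Collect_const])+)
  then have "compact K" using compact_bool_functions by (metis closed_Int_compact inf_top.right_neutral)
  then have cK: "compactin (top_of_set K) K" by (simp add: compactin_subtopology)
  have filt: "tight_filter S (\<Phi> f)" "\<Phi> f \<in> U_basic S x X" if f: "f \<in> K" for f
  proof -
    have F: "sfilter S (\<Phi> f)"
    proof (rule filterI)
      show "x \<in> \<Phi> f" using x Kx f by (auto simp: \<Phi>_def)
      show "szero S \<notin> \<Phi> f" using Kx(2)[OF f] le_zero by (auto simp: \<Phi>_def)
      fix a b
      show "a \<in> \<Phi> f \<Longrightarrow> a \<in> carrier S" by (auto simp: \<Phi>_def)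
      show "b \<in> \<Phi> f" if "a \<in> \<Phi> f" "a \<preceq> b" "b \<in> carrier S" using that le_trans by (auto simp: \<Phi>_def)
      assume "a \<in> \<Phi> f" "b \<in> \<Phi> f"
      then obtain a' b' where *: "f a'" "f b'" "a' \<preceq> a" "b' \<preceq> b" "a \<in> carrier S" "b \<in> carrier S" by (auto simp: \<Phi>_def)
      have m: "meet a' b' \<preceq> a'" "meet a' b' \<preceq> b'" using meet_le1 meet_le2[of a' x b'] Kd[OF f] * x by auto
      then have "meet a' b' \<in> \<Phi> f" using Km[OF f] * Kd[OF f] by (auto simp: \<Phi>_def intro!: exI[of _ "meet a' b'"])
      then show "\<exists>c\<in>\<Phi> f. c \<preceq> a \<and> c \<preceq> b" using m * le_trans by blast
    qed
    have "y \<notin> \<Phi> f" if "y \<in> X" for y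
      using KX[OF f that] Kup[OF f] X that x by (auto simp: \<Phi>_def down_iff subset_iff)
    then show "\<Phi> f \<in> U_basic S x X" using F x Kx f by (auto simp: U_basic_iff) (auto simp: \<Phi>_def)
    \<comment> \<open>A cover of y is restricted to an element e of the trace that lies below y;
      there the tightness clause of \<open>K\<close> applies.\<close>
    have "Y \<inter> \<Phi> f \<noteq> {}" if y: "y \<in> \<Phi> f" and Y: "Y \<in> tight_cov S y" for y Y
    proof -
      obtain e where e: "f e" "e \<preceq> y" "y \<in> carrier S" using y by (auto simp: \<Phi>_def)
      then obtain v where v: "v \<in> Y" "f (meet e v)" using Kt[OF f e(1) tight_cov_restrict[OF Y]] by auto
      have "v \<preceq> y" using tight_cov_le[OF Y v(1) e(3)] .
      then have "v \<in> carrier S" "meet e v \<preceq> v" using e le_closed meet_le2 by auto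
      then show ?thesis using v by (auto simp: \<Phi>_def)
    qed
    then show "tight_filter S (\<Phi> f)" using F by (auto simp: tight_filter_def)
  qed
  have img: "\<Phi> ` K = {A. tight_filter S A} \<inter> U_basic S x X"
  proof (intro subset_antisym subsetI)
    fix F assume "F \<in> {A. tight_filter S A} \<inter> U_basic S x X"
    then have T: "tight_filter S F" and F: "sfilter S F" and xF: "x \<in> F" and XF: "X \<inter> F = {}" by (auto simp: U_basic_iff)
    \<comment> \<open>The trace of F. Every member of F has a lower bound in F that is also below x,
      so the trace determines F.\<close>
    define f where "f a \<longleftrightarrow> a \<in> F \<and> a \<preceq> x" for a
    have "F = \<Phi> f"
    proof (intro subset_antisym subsetI)
      fix b assume "b \<in> F"
      then show "b \<in> \<Phi> f" using filter_lb[OF F _ xF] filter_closed[OF F] by (auto simp: \<Phi>_def f_def)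
    qed (use filter_up[OF F] in \<open>auto simp: \<Phi>_def f_def\<close>)
    moreover have "f \<in> K" unfolding K_def mem_Collect_eq
    proof (intro conjI allI impI)
      show "f x" using xF x by (simp add: f_def)
      show "\<not> f (szero S)" using filter_nonzero[OF F] by (simp add: f_def)
      fix a
      show "f a \<Longrightarrow> a \<in> down S x" using x by (simp add: f_def down_iff)
      show "f b" if "f a" "a \<preceq> b \<and> b \<in> down S x" for b
        using that x filter_up[OF F] by (auto simp: f_def down_def)
      show "f (meet a b)" if "f a" "f b" for b
      proof -
        have ab: "a \<in> F" "b \<in> F" "a \<preceq> x" "b \<preceq> x" "a \<in> carrier S" "b \<in> carrier S"
          using that filter_closed[OF F] by (auto simp: f_def)
        obtain d where "d \<in> F" "d \<preceq> a" "d \<preceq> b" using filter_lb[OF F ab(1,2)] by blast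
        then have "meet a b \<in> F" using ab filter_up[OF F] le_meet by simp
        moreover have "meet a b \<preceq> x" using ab x le_trans meet_le1 by blast
        ultimately show ?thesis by (simp add: f_def)
      qed
      show "\<exists>y\<in>Y. f y" if "f a" and Y: "Y \<in> tight_cov S a" for Y
      proof -
        have a: "a \<in> F" "a \<preceq> x" "a \<in> carrier S" using that filter_closed[OF F] by (auto simp: f_def)
        obtain y where "y \<in> Y" "y \<in> F" using tight_filter_meets[OF T a(1) Y] by auto
        moreover have "y \<preceq> x" using a x tight_cov_le[OF that(2)] calculation le_trans by blast
        ultimately show ?thesis by (auto simp: f_def)
      qed
      show "a \<in> X \<Longrightarrow> \<not> f a" using XF by (auto simp: f_def)
    qed
    ultimately show "F \<in> \<Phi> ` K" by blast
  qed (use filt in auto)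
  have "continuous_map (top_of_set K) (universal_topology S) \<Phi>"
    unfolding universal_topology_def continuous_on_generated_topo_iff
  proof (intro conjI allI impI)
    fix U assume "U \<in> {U_basic S x X |x X. x \<in> carrier S \<and> finite X \<and> X \<subseteq> down S x}"
    then obtain c A where U: "U = U_basic S c A" and c: "c \<in> carrier S" "finite A" "A \<subseteq> down S c" by auto
    have Ac: "a \<preceq> c" "a \<in> carrier S" if "a \<in> A" for a using that c by (auto simp: down_def)
    \<comment> \<open>That \<open>\<Phi> f\<close> avoids A is a condition on all coordinates below
      members of A. Once a trace element d below c is fixed, it reduces to the finitely many
      coordinates \<open>meet d a\<close>, so the preimage of U is a union of open sets indexed by
      d.\<close>
    have "\<Phi> f \<in> U \<longleftrightarrow> (\<exists>d. f d \<and> d \<preceq> c \<and> (\<forall>a\<in>A. \<not> f (meet d a)))" if f: "f \<in> K" for f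
    proof
      assume "\<Phi> f \<in> U"
      then have *: "c \<in> \<Phi> f" "A \<inter> \<Phi> f = {}" by (auto simp: U U_basic_iff)
      then obtain d where d: "f d" "d \<preceq> c" by (auto simp: \<Phi>_def)
      have "\<not> f (meet d a)" if a: "a \<in> A" for a
      proof
        assume "f (meet d a)"
        moreover have "meet d a \<preceq> a" using meet_le2 d Ac[OF a] c by blast
        ultimately have "a \<in> \<Phi> f" using Ac[OF a] by (auto simp: \<Phi>_def)
        then show False using * a by auto
      qed
      then show "\<exists>d. f d \<and> d \<preceq> c \<and> (\<forall>a\<in>A. \<not> f (meet d a))" using d by auto
    next
      assume "\<exists>d. f d \<and> d \<preceq> c \<and> (\<forall>a\<in>A. \<not> f (meet d a))"
      then obtain d where d: "f d" "d \<preceq> c" "\<And>a. a \<in> A \<Longrightarrow> \<not> f (meet d a)" by auto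
      have "a \<notin> \<Phi> f" if a: "a \<in> A" for a
      proof
        assume "a \<in> \<Phi> f"
        then obtain e where e: "f e" "e \<preceq> a" by (auto simp: \<Phi>_def)
        have k: "d \<in> carrier S" "e \<in> carrier S" "d \<preceq> x" "e \<preceq> x" using Kd[OF f] d e by auto
        have m: "meet d e \<preceq> meet d a"
          using k Ac[OF a] x e by (intro le_meet meet_le1 le_trans[OF meet_le2[of d x e]])
        have "meet d a \<preceq> x" using k x Ac[OF a] le_trans meet_le1 by blast
        then have "f (meet d a)" using Kup[OF f Km[OF f d(1) e(1)] m] by blast
        then show False using d a by blast
      qed
      moreover have "c \<in> \<Phi> f" using d c by (auto simp: \<Phi>_def)
      ultimately show "\<Phi> f \<in> U" using filt[OF f] tight_filter_filter by (auto simp: U U_basic_iff)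
    qed
    then have eq: "\<Phi> -` U \<inter> topspace (top_of_set K) = K \<inter> {f. \<exists>d. f d \<and> d \<preceq> c \<and> (\<forall>a\<in>A. \<not> f (meet d a))}" by auto
    have "open {f. \<forall>a\<in>A. \<not> f (meet d a)}" for d
    proof -
      have "{f. \<forall>a\<in>A. \<not> f (meet d a)} = (\<Inter>a\<in>A. {f. \<not> f (meet d a)})" by auto
      then show ?thesis using c(2) by (auto intro!: open_INT open_Collect_neg closed_eval)
    qed
    then have "open {f. \<exists>d. f d \<and> d \<preceq> c \<and> (\<forall>a\<in>A. \<not> f (meet d a))}"
      by (intro open_Collect_ex open_Collect_conj open_eval open_Collect_const)
    then show "openin (top_of_set K) (\<Phi> -` U \<inter> topspace (top_of_set K))"
      unfolding eq by (auto simp: openin_open)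
  next
    have "U_basic S x {} \<in> {U_basic S x X |x X. x \<in> carrier S \<and> finite X \<and> X \<subseteq> down S x}" using x by blast
    moreover have "\<Phi> ` K \<subseteq> U_basic S x {}" using filt by (auto simp: U_basic_iff)
    ultimately show "\<Phi> ` topspace (top_of_set K) \<subseteq> \<Union>{U_basic S x X |x X. x \<in> carrier S \<and> finite X \<and> X \<subseteq> down S x}"
      by auto
  qed
  from image_compactin[OF cK this] show ?thesis by (simp add: img)
qed

end

section \<open>The groupoid of filters and the first five conditions\<close>

context inverse_semigroup_with_zero
begin

section \<open>Compactness of the sets \<open>V_basic\<close> and complements\<close>

lemma V_basic_eq: "V_basic S x X = {A. sultrafilter S A} \<inter> U_basic S x X"
  by (auto simp: V_basic_def carrier_ultrafilter_groupoid)

lemma compactin_V_basic_iff: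
  "compactin (ultrafilter_topology S) (V_basic S x X) \<longleftrightarrow> compactin (universal_topology S) (V_basic S x X)"
  by (auto simp: ultrafilter_topology_def compactin_subtopology V_basic_def)

lemma tight_ultra_imp_compact:
  assumes "x \<in> carrier S" "X \<subseteq> down S x" and "\<And>A. tight_filter S A \<Longrightarrow> x \<in> A \<Longrightarrow> sultrafilter S A"
  shows "compactin (universal_topology S) (V_basic S x X)"
proof -
  have "V_basic S x X = {A. tight_filter S A} \<inter> U_basic S x X"
    using assms(3) ultrafilter_tight by (auto simp: V_basic_eq U_basic_iff)
  then show ?thesis using compactin_tight_filters[OF assms(1,2)] by simp
qed

lemma compact_imp_complement:
  assumes x: "x \<in> carrier S" and y: "y \<preceq> x" and V: "compactin (universal_topology S) (V_basic S x {y})"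
  shows "has_complement x y"
proof -
  define \<U> where "\<U> = (\<lambda>c. U_basic S c {}) ` {c. c \<preceq> x \<and> orth c y}"
  have "V_basic S x {y} \<subseteq> \<Union>\<U>"
  proof
    fix A assume "A \<in> V_basic S x {y}"
    then have A: "sultrafilter S A" "x \<in> A" "y \<notin> A" by (auto simp: V_basic_eq U_basic_iff)
    then obtain c where "c \<in> A" "c \<preceq> x" "orth c y" using ultrafilter_orth[OF A(1,2) y] by blast
    then show "A \<in> \<Union>\<U>" using A ultrafilter_filter by (auto simp: \<U>_def U_basic_iff)
  qed
  moreover have "openin (universal_topology S) U" if "U \<in> \<U>" for U
    using that x le_closed openin_U_basic by (auto simp: \<U>_def)
  ultimately obtain \<F> where \<F>: "finite \<F>" "\<F> \<subseteq> \<U>" "V_basic S x {y} \<subseteq> \<Union>\<F>"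
    using V unfolding compactin_def by meson
  then obtain C where C: "C \<subseteq> {c. c \<preceq> x \<and> orth c y}" "finite C" "\<F> = (\<lambda>c. U_basic S c {}) ` C"
    unfolding \<U>_def by (meson finite_subset_image)
  have yc: "y \<in> carrier S" using x y le_closed by blast
  have Cc: "insert y C \<subseteq> carrier S" using C x yc le_closed by blast
  have "arrow S x (insert y C)"
    unfolding arrow_iff[OF x Cc]
  proof (intro allI impI)
    fix z assume z: "z \<preceq> x" "z \<noteq> szero S"
    obtain G where G: "sultrafilter S G" "z \<in> G" using ultrafilter_exists z le_closed x by metis
    have GF: "sfilter S G" using G ultrafilter_filter by blast
    have xG: "x \<in> G" using filter_up[OF GF G(2) z(1) x] .
    \<comment> \<open>G either contains y or belongs to the compact set and hence contains some
      member of the finite C. A common lower bound with z taken inside G is automatically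
      non-zero.\<close>
    have "\<exists>b\<in>insert y C. b \<in> G"
    proof (cases "y \<in> G")
      case False
      then have "G \<in> V_basic S x {y}" using G xG GF by (auto simp: V_basic_eq U_basic_iff)
      then show ?thesis using \<F>(3) C by (auto simp: U_basic_iff)
    qed auto
    then obtain b where b: "b \<in> insert y C" "b \<in> G" by auto
    then obtain w where "w \<in> G" "w \<preceq> z" "w \<preceq> b" using filter_lb[OF GF G(2)] by blast
    then show "\<exists>b\<in>insert y C. \<exists>w. w \<preceq> z \<and> w \<preceq> b \<and> w \<noteq> szero S" using b filter_nonzero[OF GF] by metis
  qed
  moreover have "C \<subseteq> down S x" "\<forall>c\<in>C. orth c y" using C(1) x by (auto simp: down_iff)
  ultimately show ?thesis using C(2) unfolding has_complement_def by blast
qed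

text \<open>Left multiplication by x maps the elements below x^-1 x order-isomorphically onto the
  elements below x; the inverse map takes an element to its domain. A complement of y^-1 y in x^-1 x
  is translated back along it.\<close>

lemma idem_complement_imp_complement:
  assumes K: "\<And>e f. e \<in> E \<Longrightarrow> f \<preceq> e \<Longrightarrow> has_complement e f" and x: "x \<in> carrier S" and y: "y \<preceq> x"
  shows "has_complement x y"
proof -
  have yc: "y \<in> carrier S" using x y le_closed by blast
  obtain C where C: "finite C" "C \<subseteq> down S (\<iota> x \<cdot> x)" "\<And>c. c \<in> C \<Longrightarrow> orth c (\<iota> y \<cdot> y)"
     "arrow S (\<iota> x \<cdot> x) (insert (\<iota> y \<cdot> y) C)"
    using K[OF dom_idem[OF x] le_dom_mono[OF y x]] by (auto simp: has_complement_def)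
  have Cx: "c \<preceq> \<iota> x \<cdot> x" "c \<in> E" "c \<in> carrier S" if "c \<in> C" for c
  proof -
    show "c \<preceq> \<iota> x \<cdot> x" using C(2) that by (auto simp: down_def)
    then show "c \<in> E" using le_idem x by auto
    then show "c \<in> carrier S" by auto
  qed
  have 1: "x \<cdot> c \<preceq> x" if "c \<in> C" for c using Cx[OF that] leI_right by auto
  have 2: "orth (x \<cdot> c) y" if c: "c \<in> C" for c
    unfolding orth_def
  proof (intro allI impI)
    fix z assume z: "z \<preceq> x \<cdot> c" "z \<preceq> y"
    have zc: "z \<in> carrier S" using z yc le_closed by blast
    \<comment> \<open>The domain of xc is c, so a common lower bound of xc and y has its domain
      below both c and y^-1 y, which are disjoint.\<close>
    have "\<iota> z \<cdot> z \<preceq> \<iota> (x \<cdot> c) \<cdot> (x \<cdot> c)" using le_dom_mono[OF z(1)] x Cx[OF c] by auto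
    also have "\<iota> (x \<cdot> c) \<cdot> (x \<cdot> c) = c \<cdot> (\<iota> x \<cdot> x) \<cdot> c" using x Cx[OF c] by (simp add: sinv_mult mult_assoc)
    also have "\<dots> = c" using Cx[OF c] idem_le_iff[of c "\<iota> x \<cdot> x"] x by simp
    finally have "\<iota> z \<cdot> z \<preceq> c" .
    moreover have "\<iota> z \<cdot> z \<preceq> \<iota> y \<cdot> y" using le_dom_mono[OF z(2) yc] .
    ultimately have "\<iota> z \<cdot> z = szero S" using C(3)[OF c] orthD by blast
    then show "z = szero S" by (rule dom_eq_zero[OF zc])
  qed
  have c1: "insert y ((\<lambda>c. x \<cdot> c) ` C) \<subseteq> carrier S" using yc x Cx by auto
  have c2: "insert (\<iota> y \<cdot> y) C \<subseteq> carrier S" using yc Cx by auto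
  have "arrow S x (insert y ((\<lambda>c. x \<cdot> c) ` C))"
    unfolding arrow_iff[OF x c1]
  proof (intro allI impI)
    fix z assume z: "z \<preceq> x" "z \<noteq> szero S"
    have zc: "z \<in> carrier S" using z x le_closed by blast
    have "\<iota> z \<cdot> z \<noteq> szero S" using z dom_eq_zero zc by auto
    moreover have zx: "\<iota> z \<cdot> z \<preceq> \<iota> x \<cdot> x" using le_dom_mono[OF z(1) x] .
    moreover have xx: "\<iota> x \<cdot> x \<in> carrier S" using x by simp
    ultimately obtain b w where w: "b \<in> insert (\<iota> y \<cdot> y) C" "w \<preceq> \<iota> z \<cdot> z" "w \<preceq> b" "w \<noteq> szero S"
      using C(4)[unfolded arrow_iff[OF xx c2]] by blast
    have wE: "w \<in> E" using le_idem[OF w(2)] zc by simp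
    have bc: "b \<in> carrier S" using w c2 by auto
    have a: "x \<cdot> w \<preceq> z" using le_mult[OF le_refl[OF x] w(2)] le_dom[OF z(1) x] x zc by simp
    have b: "x \<cdot> w \<preceq> x \<cdot> b" using le_mult[OF le_refl[OF x] w(3)] x bc by simp
    have "w \<preceq> \<iota> x \<cdot> x" using le_trans[OF w(2) zx] x by simp
    then have "\<iota> x \<cdot> (x \<cdot> w) = w" using idem_le_iff[of w "\<iota> x \<cdot> x"] wE x idem_comm[of w "\<iota> x \<cdot> x"] by (simp add: mult_assoc)
    then have nz: "x \<cdot> w \<noteq> szero S" using w x by auto
    \<comment> \<open>For b in C this is one of the translated elements; for b = y^-1 y the product
      xb is y itself.\<close>
    have "x \<cdot> b \<in> insert y ((\<lambda>c. x \<cdot> c) ` C)" using w(1) le_dom[OF y x] by auto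
    then show "\<exists>b\<in>insert y ((\<lambda>c. x \<cdot> c) ` C). \<exists>w. w \<preceq> z \<and> w \<preceq> b \<and> w \<noteq> szero S" using a b nz by blast
  qed
  then show ?thesis using C(1) 1 2 x unfolding has_complement_def
    by (intro exI[of _ "(\<lambda>c. x \<cdot> c) ` C"]) (auto simp: down_iff)
qed

section \<open>Inversion of filters and the identities of the two groupoids\<close>

lemma sinv_image_filter: assumes F: "sfilter S F" shows "sfilter S (\<iota> ` F)"
proof -
  obtain x where x: "x \<in> F" using filter_nonempty[OF F] by auto
  show ?thesis
  proof (rule filterI)
    show "\<iota> x \<in> \<iota> ` F" using x by auto
    show "szero S \<notin> \<iota> ` F" using filter_nonzero[OF F] filter_closed[OF F] sinv_eq_zero by (metis imageE)
    show "b \<in> \<iota> ` F" if a: "a \<in> \<iota> ` F" "a \<preceq> b" "b \<in> carrier S" for a b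
    proof -
      obtain a' where a': "a' \<in> F" "a = \<iota> a'" using a by auto
      then have "a' \<preceq> \<iota> b" using le_sinv[OF a(2,3)] filter_closed[OF F] by simp
      then have "\<iota> b \<in> F" using filter_up[OF F a'(1)] a by simp
      then show ?thesis using a by (metis image_eqI sinv_sinv)
    qed
    show "\<exists>c\<in>\<iota> ` F. c \<preceq> a \<and> c \<preceq> b" if ab: "a \<in> \<iota> ` F" "b \<in> \<iota> ` F" for a b
    proof -
      obtain a' b' where *: "a' \<in> F" "b' \<in> F" "a = \<iota> a'" "b = \<iota> b'" using ab by auto
      obtain c where "c \<in> F" "c \<preceq> a'" "c \<preceq> b'" using filter_lb[OF F *(1,2)] by blast
      then show ?thesis using * le_sinv filter_closed[OF F] by auto
    qed
  qed (use filter_closed[OF F] in auto)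
qed

lemma sinv_image_image: "F \<subseteq> carrier S \<Longrightarrow> \<iota> ` \<iota> ` F = F"
  by (force simp: image_iff)

lemma sinv_image_ultrafilter: assumes F: "sultrafilter S F" shows "sultrafilter S (\<iota> ` F)"
  unfolding sultrafilter_def
proof (intro conjI allI impI)
  have FF: "sfilter S F" using F by (rule ultrafilter_filter)
  then have s: "\<iota> ` \<iota> ` F = F" using sinv_image_image filter_closed by (metis subsetI)
  show "sfilter S (\<iota> ` F)" using FF by (rule sinv_image_filter)
  fix G assume G: "sfilter S G" "\<iota> ` F \<subseteq> G"
  then have "F \<subseteq> \<iota> ` G" using s by blast
  then have "\<iota> ` G = F" using F sinv_image_filter[OF G(1)] by (auto simp: sultrafilter_def)
  then show "G = \<iota> ` F" using sinv_image_image filter_closed[OF G(1)] by (metis subsetI)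
qed

lemma set_mult_iff: "x \<in> set_mult S A B \<longleftrightarrow> (\<exists>a\<in>A. \<exists>b\<in>B. x = a \<cdot> b)"
  by (auto simp: set_mult_def)

lemma set_multI: "a \<in> A \<Longrightarrow> b \<in> B \<Longrightarrow> a \<cdot> b \<in> set_mult S A B"
  by (auto simp: set_mult_def)

lemma up_setI: "a \<in> A \<Longrightarrow> a \<in> carrier S \<Longrightarrow> a \<in> up_set S A"
  by (auto simp: up_set_iff)

text \<open>A common lower bound with e is idempotent, so F contains idempotents below any two of
  its members. On these, inversion and squaring change nothing.\<close>

lemma idempotent_filter_dom:
  assumes F: "sfilter S F" and e: "e \<in> F" "e \<in> E"
  shows "up_set S (set_mult S (\<iota> ` F) F) = F" "up_set S (set_mult S F (\<iota> ` F)) = F"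
proof -
  have lb: "\<exists>c\<in>F. c \<in> E \<and> c \<preceq> a \<and> c \<preceq> b" if ab: "a \<in> F" "b \<in> F" for a b
  proof -
    obtain c where c: "c \<in> F" "c \<preceq> a" "c \<preceq> b" using filter_lb[OF F ab] by blast
    obtain d where d: "d \<in> F" "d \<preceq> c" "d \<preceq> e" using filter_lb[OF F c(1) e(1)] by blast
    then show ?thesis using c ab e le_idem le_trans filter_closed[OF F] by metis
  qed
  have "a \<in> up_set S (set_mult S (\<iota> ` F) F) \<and> a \<in> up_set S (set_mult S F (\<iota> ` F))" if a: "a \<in> F" for a
  proof -
    obtain c where c: "c \<in> F" "c \<in> E" "c \<preceq> a" using lb[OF a a] by blast
    then have "c = \<iota> c \<cdot> c" "c = c \<cdot> \<iota> c" by (metis sinv_idem idem_idem)+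
    then have "c \<in> set_mult S (\<iota> ` F) F" "c \<in> set_mult S F (\<iota> ` F)"
      using c unfolding set_mult_iff by (meson imageI)+
    then show ?thesis using c filter_closed[OF F a] unfolding up_set_iff by blast
  qed
  moreover have "a \<in> F" if a: "a \<in> up_set S (set_mult S (\<iota> ` F) F)" for a
  proof -
    obtain p q where pq: "p \<in> F" "q \<in> F" "\<iota> p \<cdot> q \<preceq> a" "a \<in> carrier S" using a by (auto simp: up_set_iff set_mult_def)
    obtain c where c: "c \<in> F" "c \<in> E" "c \<preceq> p" "c \<preceq> q" using lb[OF pq(1,2)] by blast
    then have "\<iota> c \<cdot> c \<preceq> \<iota> p \<cdot> q" using pq filter_closed[OF F] le_sinv le_mult by (metis sinv_closed)
    then show ?thesis using c pq le_trans filter_up[OF F] by (metis idem_idem sinv_idem)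
  qed
  moreover have "a \<in> F" if a: "a \<in> up_set S (set_mult S F (\<iota> ` F))" for a
  proof -
    obtain p q where pq: "p \<in> F" "q \<in> F" "p \<cdot> \<iota> q \<preceq> a" "a \<in> carrier S" using a by (auto simp: up_set_iff set_mult_def)
    obtain c where c: "c \<in> F" "c \<in> E" "c \<preceq> p" "c \<preceq> q" using lb[OF pq(1,2)] by blast
    then have "c \<cdot> \<iota> c \<preceq> p \<cdot> \<iota> q" using pq filter_closed[OF F] le_sinv le_mult by (metis sinv_closed)
    then show ?thesis using c pq le_trans filter_up[OF F] by (metis idem_idem sinv_idem)
  qed
  ultimately show "up_set S (set_mult S (\<iota> ` F) F) = F" "up_set S (set_mult S F (\<iota> ` F)) = F" by blast+
qed

text \<open>The unit laws of the groupoid. If f is above pq^-1 and x is in X, choose d in X below p,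
  q and x; then d = dd^-1 d lies below fx, so everything above fx is in X. The other side is the
  mirror image.\<close>

lemma dom_ran_act:
  assumes X: "sfilter S X"
  shows "up_set S (set_mult S (up_set S (set_mult S X (\<iota> ` X))) X) = X"
    "up_set S (set_mult S X (up_set S (set_mult S (\<iota> ` X) X))) = X"
proof -
  have "x \<in> up_set S (set_mult S (up_set S (set_mult S X (\<iota> ` X))) X) \<and>
     x \<in> up_set S (set_mult S X (up_set S (set_mult S (\<iota> ` X) X)))" if x: "x \<in> X" for x
  proof -
    have c: "x \<in> carrier S" using x filter_closed[OF X] by blast
    have "x \<cdot> \<iota> x \<in> up_set S (set_mult S X (\<iota> ` X))" "\<iota> x \<cdot> x \<in> up_set S (set_mult S (\<iota> ` X) X)"
      using x c by (auto intro!: up_setI set_multI)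
    moreover have "x = (x \<cdot> \<iota> x) \<cdot> x" "x = x \<cdot> (\<iota> x \<cdot> x)" using c by (auto simp: mult_assoc)
    ultimately show ?thesis using x c by (metis set_multI up_setI)
  qed
  moreover have "a \<in> X" if a: "a \<in> up_set S (set_mult S (up_set S (set_mult S X (\<iota> ` X))) X)" for a
  proof -
    obtain p q f x where *: "p \<in> X" "q \<in> X" "p \<cdot> \<iota> q \<preceq> f" "f \<in> carrier S" "x \<in> X" "f \<cdot> x \<preceq> a" "a \<in> carrier S"
      using a by (auto simp: up_set_iff set_mult_def)
    obtain d where d: "d \<in> X" "\<forall>b\<in>{p,q}. d \<preceq> b" "d \<preceq> x" using filter_finite_lb[OF X, of "{p,q}" x] * by auto
    have c: "d \<in> carrier S" "p \<in> carrier S" "q \<in> carrier S" "x \<in> carrier S" using d * filter_closed[OF X] by auto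
    have "d \<cdot> \<iota> d \<preceq> f" using le_trans[of "d \<cdot> \<iota> d" "p \<cdot> \<iota> q" f] le_mult[of d p "\<iota> d" "\<iota> q"] le_sinv d c * by auto
    then have "(d \<cdot> \<iota> d) \<cdot> d \<preceq> f \<cdot> x" using le_mult d c * by blast
    then have "d \<preceq> a" using c * le_trans by (auto simp: mult_assoc)
    then show ?thesis using d * filter_up[OF X] by blast
  qed
  moreover have "a \<in> X" if a: "a \<in> up_set S (set_mult S X (up_set S (set_mult S (\<iota> ` X) X)))" for a
  proof -
    obtain p q f x where *: "p \<in> X" "q \<in> X" "\<iota> p \<cdot> q \<preceq> f" "f \<in> carrier S" "x \<in> X" "x \<cdot> f \<preceq> a" "a \<in> carrier S"
      using a by (auto simp: up_set_iff set_mult_def)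
    obtain d where d: "d \<in> X" "\<forall>b\<in>{p,q}. d \<preceq> b" "d \<preceq> x" using filter_finite_lb[OF X, of "{p,q}" x] * by auto
    have c: "d \<in> carrier S" "p \<in> carrier S" "q \<in> carrier S" "x \<in> carrier S" using d * filter_closed[OF X] by auto
    have "\<iota> d \<cdot> d \<preceq> f" using le_trans[of "\<iota> d \<cdot> d" "\<iota> p \<cdot> q" f] le_mult[of "\<iota> d" "\<iota> p" d q] le_sinv d c * by auto
    then have "d \<cdot> (\<iota> d \<cdot> d) \<preceq> x \<cdot> f" using le_mult d c * by blast
    then have "d \<preceq> a" using c * le_trans by (auto simp: mult_assoc)
    then show ?thesis using d * filter_up[OF X] by blast
  qed
  ultimately show "up_set S (set_mult S (up_set S (set_mult S X (\<iota> ` X))) X) = X"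
    "up_set S (set_mult S X (up_set S (set_mult S (\<iota> ` X) X))) = X" by blast+
qed

text \<open>An identity F composed with F^-1 gives F^-1. Hence F^-1 contains aa^-1 for a in F, and
  as this element is its own inverse it lies in F. The class \<open>C\<close> is a parameter so that
  filters and ultrafilters are treated together.\<close>

lemma identities_filter_groupoid:
  assumes C: "\<And>F. F \<in> C \<Longrightarrow> sfilter S F" and inv: "\<And>F. F \<in> C \<Longrightarrow> \<iota> ` F \<in> C"
  shows "identities ((universal_groupoid S)\<lparr>carrier := C\<rparr>) = {F \<in> C. contains_idempotent S F}"
proof (intro subset_antisym subsetI)
  let ?G = "(universal_groupoid S)\<lparr>carrier := C\<rparr>"
  fix F assume "F \<in> identities ?G"
  then have F: "F \<in> C" and id: "\<And>X. X \<in> C \<Longrightarrow> gdom ?G F = gran ?G X \<Longrightarrow> gcomp ?G F X = X"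
    by (auto simp: identities_def)
  have FF: "sfilter S F" using C F by blast
  have "\<iota> ` \<iota> ` F = F" using sinv_image_image filter_closed[OF FF] by blast
  then have "gcomp ?G F (\<iota> ` F) = \<iota> ` F" using inv F by (intro id) (auto simp: universal_groupoid_def)
  then have eq: "up_set S (set_mult S F (\<iota> ` F)) = \<iota> ` F" by (simp add: universal_groupoid_def)
  obtain a where a: "a \<in> F" "a \<in> carrier S" using filter_nonempty[OF FF] filter_closed[OF FF] by auto
  then have "a \<cdot> \<iota> a \<in> up_set S (set_mult S F (\<iota> ` F))"
    by (auto intro!: up_setI set_multI)
  then obtain b where b: "b \<in> F" "a \<cdot> \<iota> a = \<iota> b" unfolding eq by auto
  then have "b = \<iota> (a \<cdot> \<iota> a)" using filter_closed[OF FF b(1)] by simp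
  also have "\<dots> = a \<cdot> \<iota> a" using a by (intro sinv_idem) auto
  finally have "b \<in> E" using a by auto
  then show "F \<in> {F \<in> C. contains_idempotent S F}" using F b by (auto simp: contains_idempotent_def)
next
  let ?G = "(universal_groupoid S)\<lparr>carrier := C\<rparr>"
  fix F assume "F \<in> {F \<in> C. contains_idempotent S F}"
  then obtain e where F: "F \<in> C" "e \<in> F" "e \<in> E" by (auto simp: contains_idempotent_def)
  note d = idempotent_filter_dom[OF C[OF F(1)] F(2,3)]
  have "gcomp ?G F X = X" if "X \<in> C" "gdom ?G F = gran ?G X" for X
    using that dom_ran_act(1)[OF C[OF that(1)]] by (simp add: universal_groupoid_def d)
  moreover have "gcomp ?G X F = X" if "X \<in> C" "gdom ?G X = gran ?G F" for X
    using that dom_ran_act(2)[OF C[OF that(1)]] by (simp add: universal_groupoid_def d)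
  ultimately show "F \<in> identities ?G"
    unfolding identities_def using F(1) by simp
qed

lemma identities_universal: "identities (universal_groupoid S) = {F. sfilter S F \<and> contains_idempotent S F}"
proof -
  have "universal_groupoid S = (universal_groupoid S)\<lparr>carrier := {A. sfilter S A}\<rparr>"
    by (simp add: universal_groupoid_def)
  then show ?thesis using identities_filter_groupoid[of "{A. sfilter S A}"] sinv_image_filter by simp
qed

lemma identities_ultrafilter: "identities (ultrafilter_groupoid S) = {F. sultrafilter S F \<and> contains_idempotent S F}"
  unfolding ultrafilter_groupoid_def
  using identities_filter_groupoid[of "{A. sultrafilter S A}"] sinv_image_ultrafilter ultrafilter_filter by simp

section \<open>Closedness of the ultrafilters expressed by tight filters\<close>

lemma closed_ultrafilters_iff:
  "closedin (universal_topology S) (carrier (ultrafilter_groupoid S)) \<longleftrightarrow> (\<forall>A. tight_filter S A \<longrightarrow> sultrafilter S A)"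
proof
  assume cl: "closedin (universal_topology S) (carrier (ultrafilter_groupoid S))"
  show "\<forall>A. tight_filter S A \<longrightarrow> sultrafilter S A"
  proof (intro allI impI, rule ccontr)
    fix F assume T: "tight_filter S F" and no: "\<not> sultrafilter S F"
    have o: "openin (universal_topology S) ({A. sfilter S A} - {A. sultrafilter S A})"
      using cl by (auto simp: closedin_def topspace_universal carrier_ultrafilter_groupoid)
    have m: "F \<in> {A. sfilter S A} - {A. sultrafilter S A}" using T no tight_filter_filter by auto
    obtain x X where xX: "finite X" "X \<subseteq> down S x" "F \<in> U_basic S x X"
      "U_basic S x X \<subseteq> {A. sfilter S A} - {A. sultrafilter S A}" using openin_universal_basis[OF o m] by blast
    obtain G where "sultrafilter S G" "G \<in> U_basic S x X" using ultrafilter_near_tight[OF T xX(3,1,2)] .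
    then show False using xX(4) by blast
  qed
next
  assume "\<forall>A. tight_filter S A \<longrightarrow> sultrafilter S A"
  then have "carrier (ultrafilter_groupoid S) = {A. tight_filter S A}"
    using ultrafilter_tight by (auto simp: carrier_ultrafilter_groupoid)
  then show "closedin (universal_topology S) (carrier (ultrafilter_groupoid S))"
    using closedin_tight_filters by simp
qed

lemma closed_idempotent_ultrafilters_iff:
  "closedin (subtopology (universal_topology S) (identities (universal_groupoid S))) (identities (ultrafilter_groupoid S))
   \<longleftrightarrow> (\<forall>A. tight_filter S A \<and> contains_idempotent S A \<longrightarrow> sultrafilter S A \<and> contains_idempotent S A)"
proof
  assume cl: "closedin (subtopology (universal_topology S) (identities (universal_groupoid S))) (identities (ultrafilter_groupoid S))"
  show "\<forall>A. tight_filter S A \<and> contains_idempotent S A \<longrightarrow> sultrafilter S A \<and> contains_idempotent S A"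
  proof (intro allI impI, rule ccontr)
    fix F assume "tight_filter S F \<and> contains_idempotent S F" and "\<not> (sultrafilter S F \<and> contains_idempotent S F)"
    then have T: "tight_filter S F" and no: "\<not> sultrafilter S F" and c: "contains_idempotent S F" by auto
    obtain e where e: "e \<in> F" "e \<in> E" using c by (auto simp: contains_idempotent_def)
    have F: "sfilter S F" using T tight_filter_filter by blast
    obtain D where D: "closedin (universal_topology S) D"
      "identities (ultrafilter_groupoid S) = D \<inter> identities (universal_groupoid S)"
      using cl unfolding closedin_subtopology by blast
    have "F \<notin> D" using D(2) no F c by (auto simp: identities_universal identities_ultrafilter)
    then have m: "F \<in> topspace (universal_topology S) - D" using F by (simp add: topspace_universal)
    have o: "openin (universal_topology S) (topspace (universal_topology S) - D)" using D(1) by (simp add: closedin_def)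
    obtain x X where xX: "x \<in> carrier S" "finite X" "X \<subseteq> down S x" "F \<in> U_basic S x X"
      "U_basic S x X \<subseteq> topspace (universal_topology S) - D"
      using openin_universal_basis[OF o m] by blast
    \<comment> \<open>The neighbourhood is rebased below the idempotent e. Every filter through d is
      then idempotent, in particular the ultrafilter found near F.\<close>
    obtain d where d: "d \<in> F" "d \<preceq> x" "d \<preceq> e" using filter_lb[OF F _ e(1)] xX(4) unfolding U_basic_iff by blast
    note s = U_basic_shrink[OF xX(4,1,3) d(1,2)]
    obtain G where G: "sultrafilter S G" "G \<in> U_basic S d (meet d ` X)"
      using ultrafilter_near_tight[OF T s(1) _ s(3)] xX(2) by blast
    then have "contains_idempotent S G" using le_idem[OF d(3) e(2)] by (auto simp: U_basic_iff contains_idempotent_def)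
    then have "G \<in> D" using D(2) G by (auto simp: identities_ultrafilter)
    then show False using s(2) xX(5) G by blast
  qed
next
  assume "\<forall>A. tight_filter S A \<and> contains_idempotent S A \<longrightarrow> sultrafilter S A \<and> contains_idempotent S A"
  then have "identities (ultrafilter_groupoid S) = {A. tight_filter S A} \<inter> identities (universal_groupoid S)"
    using ultrafilter_tight ultrafilter_filter by (auto simp: identities_universal identities_ultrafilter tight_filter_filter)
  then show "closedin (subtopology (universal_topology S) (identities (universal_groupoid S))) (identities (ultrafilter_groupoid S))"
    using closedin_tight_filters closedin_subtopology by blast
qed

definition complemented :: bool where
  "complemented \<longleftrightarrow> (\<forall>x\<in>carrier S. \<forall>y. y \<preceq> x \<longrightarrow> has_complement x y)"

text \<open>The implications close up in cycles: \<open>complemented\<close> gives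
  \<open>?T\<close>, which gives \<open>?I\<close> and \<open>?V\<close>, and each of these two
  gives \<open>complemented\<close> back.\<close>

lemma tight_ultra_iff: "(\<forall>A. tight_filter S A \<longrightarrow> sultrafilter S A) \<longleftrightarrow> complemented"
  and idem_tight_ultra_iff: "(\<forall>A. tight_filter S A \<and> contains_idempotent S A \<longrightarrow> sultrafilter S A \<and> contains_idempotent S A) \<longleftrightarrow> complemented"
  and compact_V_iff: "(\<forall>x\<in>carrier S. \<forall>X. finite X \<and> X \<subseteq> down S x
                    \<longrightarrow> compactin (ultrafilter_topology S) (V_basic S x X)) \<longleftrightarrow> complemented"
proof -
  let ?T = "\<forall>A. tight_filter S A \<longrightarrow> sultrafilter S A"
  let ?I = "\<forall>A. tight_filter S A \<and> contains_idempotent S A \<longrightarrow> sultrafilter S A \<and> contains_idempotent S A"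
  let ?V = "\<forall>x\<in>carrier S. \<forall>X. finite X \<and> X \<subseteq> down S x \<longrightarrow> compactin (ultrafilter_topology S) (V_basic S x X)"
  have 1: ?T if complemented using that complements_imp_tight_ultra unfolding complemented_def by blast
  have 2: complemented if ?I
  proof -
    have "has_complement e f" if e: "e \<in> E" "f \<preceq> e" for e f
    proof (rule compact_imp_complement)
      show "compactin (universal_topology S) (V_basic S e {f})"
      proof (rule tight_ultra_imp_compact)
        \<comment> \<open>A filter through the idempotent e is an idempotent filter, so
          \<open>?I\<close> applies to every tight filter through e.\<close>
        show "sultrafilter S A" if "tight_filter S A" "e \<in> A" for A
          using \<open>?I\<close> e that by (auto simp: contains_idempotent_def)
      qed (use e in \<open>auto simp: down_iff\<close>)
    qed (use e in auto)
    then show ?thesis using idem_complement_imp_complement unfolding complemented_def by blast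
  qed
  have 3: ?V if ?T using that tight_ultra_imp_compact by (simp add: compactin_V_basic_iff)
  have 4: complemented if ?V
  proof -
    have "has_complement x y" if "x \<in> carrier S" "y \<preceq> x" for x y
    proof -
      have "compactin (ultrafilter_topology S) (V_basic S x {y})"
        using \<open>?V\<close> that by (simp add: down_iff)
      then show ?thesis using compact_imp_complement that by (simp add: compactin_V_basic_iff)
    qed
    then show ?thesis unfolding complemented_def by blast
  qed
  have 5: ?I if ?T using that by simp
  show "?T \<longleftrightarrow> complemented" "?I \<longleftrightarrow> complemented" "?V \<longleftrightarrow> complemented" using 1 2 3 4 5 by blast+
qed

end

section \<open>The completion of a separated inverse semigroup\<close>

text \<open>The tight completion without its initial passage to the quotient, so that it can be
  studied over an arbitrary separated semigroup.\<close>

definition completion :: "('a, 'b) zsemigroup_scheme \<Rightarrow> 'a set zsemigroup" where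
  "completion S =
     \<lparr>carrier = {tight_closure S (down_set S F) |F. finite F \<and> compatible_set S F},
      smult = (\<lambda>A B. tight_closure S (set_mult S A B)),
      szero = tight_closure S (down S (szero S))\<rparr>"

lemma tight_completion_eq: "tight_completion S = completion (tight_quotient S)"
  by (simp add: tight_completion_def completion_def Let_def)

context inverse_semigroup_with_zero
begin

section \<open>Algebra of tight covers\<close>

lemma tight_covI:
  assumes "x \<in> carrier S" "finite X" "\<And>y. y \<in> X \<Longrightarrow> y \<preceq> x"
    "\<And>z. z \<preceq> x \<Longrightarrow> z \<noteq> szero S \<Longrightarrow> \<exists>b\<in>X. \<exists>w. w \<preceq> z \<and> w \<preceq> b \<and> w \<noteq> szero S"
  shows "X \<in> tight_cov S x"
  unfolding tight_cov_iff[OF assms(1)] using assms(2-4) by blast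

lemma tight_cov_refl: "x \<in> carrier S \<Longrightarrow> {x} \<in> tight_cov S x"
  by (rule tight_covI) (auto intro: le_closed)

lemma tight_cov_zero: "{} \<in> tight_cov S (szero S)"
  by (rule tight_covI) (auto dest: le_zero)

text \<open>Meeting X gives a non-zero w below z and some b in X; meeting the cover of b then goes
  one step further down. This makes \<open>tight_closure\<close> idempotent.\<close>

lemma tight_cov_trans:
  assumes X: "X \<in> tight_cov S x" and x: "x \<in> carrier S" and Y: "\<And>y. y \<in> X \<Longrightarrow> Y y \<in> tight_cov S y"
  shows "(\<Union>y\<in>X. Y y) \<in> tight_cov S x"
proof (rule tight_covI[OF x])
  have Xc: "y \<preceq> x" "y \<in> carrier S" if "y \<in> X" for y using tight_cov_le[OF X that x] le_closed x by auto
  show "finite (\<Union>y\<in>X. Y y)" using X Y tight_cov_finite by auto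
  show "v \<preceq> x" if "v \<in> (\<Union>y\<in>X. Y y)" for v using that Y tight_cov_le Xc le_trans x by blast
  fix z assume z: "z \<preceq> x" "z \<noteq> szero S"
  obtain b w where w: "b \<in> X" "w \<preceq> z" "w \<preceq> b" "w \<noteq> szero S" using tight_cov_meets[OF X z x] .
  obtain c v where v: "c \<in> Y b" "v \<preceq> w" "v \<preceq> c" "v \<noteq> szero S"
    using tight_cov_meets[OF Y[OF w(1)] w(3,4) Xc(2)[OF w(1)]] .
  have "v \<preceq> z" using le_trans[OF v(2) w(2)] z x le_closed by blast
  then show "\<exists>b\<in>(\<Union>y\<in>X. Y y). \<exists>w. w \<preceq> z \<and> w \<preceq> b \<and> w \<noteq> szero S" using w v by blast
qed

lemma tight_cov_sinv:
  assumes X: "X \<in> tight_cov S x" and x: "x \<in> carrier S"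
  shows "\<iota> ` X \<in> tight_cov S (\<iota> x)"
proof (rule tight_covI)
  have Xc: "y \<preceq> x" "y \<in> carrier S" if "y \<in> X" for y using tight_cov_le[OF X that x] le_closed x by auto
  show "y \<preceq> \<iota> x" if "y \<in> \<iota> ` X" for y using that Xc le_sinv x by auto
  fix z assume z: "z \<preceq> \<iota> x" "z \<noteq> szero S"
  have zc: "z \<in> carrier S" using z x le_closed by blast
  then have "\<iota> z \<preceq> x" "\<iota> z \<noteq> szero S" using le_sinv[OF z(1)] z x sinv_eq_zero by auto
  then obtain b w where w: "b \<in> X" "w \<preceq> \<iota> z" "w \<preceq> b" "w \<noteq> szero S" using tight_cov_meets[OF X _ _ x] by metis
  have bc: "b \<in> carrier S" using Xc w by blast
  then have wc: "w \<in> carrier S" using w(3) le_closed by blast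
  have "\<iota> w \<preceq> z" "\<iota> w \<preceq> \<iota> b" "\<iota> w \<noteq> szero S"
    using le_sinv[OF w(2)] le_sinv[OF w(3) bc] zc sinv_eq_zero[OF wc] w(4) by auto
  then show "\<exists>b\<in>\<iota> ` X. \<exists>w. w \<preceq> z \<and> w \<preceq> b \<and> w \<noteq> szero S" using w by blast
qed (use x tight_cov_finite[OF X] in auto)

text \<open>Given z below xu, go back to zu^-1 below x, meet the cover there in some w, and return
  with wu. Nothing non-zero is lost, because zu^-1 u = z and wuu^-1 = w.\<close>

lemma tight_cov_mult_right:
  assumes X: "X \<in> tight_cov S x" and x: "x \<in> carrier S" and u: "u \<in> carrier S"
  shows "(\<lambda>y. y \<cdot> u) ` X \<in> tight_cov S (x \<cdot> u)"
proof (rule tight_covI)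
  have Xc: "y \<preceq> x" "y \<in> carrier S" if "y \<in> X" for y using tight_cov_le[OF X that x] le_closed x by auto
  show "y \<preceq> x \<cdot> u" if "y \<in> (\<lambda>y. y \<cdot> u) ` X" for y using that Xc le_mult x u by auto
  fix z assume z: "z \<preceq> x \<cdot> u" "z \<noteq> szero S"
  have zc: "z \<in> carrier S" using z x u le_closed by blast
  obtain f where f: "f \<in> E" "z = f \<cdot> (x \<cdot> u)" using le_left[OF z(1)] x u by auto
  have zu: "z \<cdot> \<iota> u \<cdot> u = z" using f x u by (simp add: mult_assoc)
  have "z \<cdot> \<iota> u \<preceq> x"
  proof (rule le_trans[OF _ _ x])
    show "z \<cdot> \<iota> u \<preceq> x \<cdot> (u \<cdot> \<iota> u)" using le_mult[OF z(1) le_refl[of "\<iota> u"]] x u by (simp add: mult_assoc)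
    show "x \<cdot> (u \<cdot> \<iota> u) \<preceq> x" using u by (intro leI_right) auto
  qed
  moreover have "z \<cdot> \<iota> u \<noteq> szero S" using zu z u by auto
  ultimately obtain b w where w: "b \<in> X" "w \<preceq> z \<cdot> \<iota> u" "w \<preceq> b" "w \<noteq> szero S" using tight_cov_meets[OF X _ _ x] by metis
  have wc: "w \<in> carrier S" using w Xc le_closed by blast
  obtain g where g: "g \<in> E" "w = g \<cdot> (z \<cdot> \<iota> u)" using le_left[OF w(2)] zc u by auto
  have wu: "w \<cdot> u \<cdot> \<iota> u = w" using g zc u by (simp add: mult_assoc)
  have "w \<cdot> u \<preceq> z" using le_mult[OF w(2) le_refl[OF u]] zu zc u by simp
  moreover have "w \<cdot> u \<preceq> b \<cdot> u" using le_mult[OF w(3) le_refl[OF u]] Xc w u by simp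
  moreover have "w \<cdot> u \<noteq> szero S" using wu w u by auto
  ultimately show "\<exists>b\<in>(\<lambda>y. y \<cdot> u) ` X. \<exists>w. w \<preceq> z \<and> w \<preceq> b \<and> w \<noteq> szero S" using w by blast
qed (use x u tight_cov_finite[OF X] in auto)

lemma tight_cov_mult_left:
  assumes X: "X \<in> tight_cov S x" and x: "x \<in> carrier S" and u: "u \<in> carrier S"
  shows "(\<lambda>y. u \<cdot> y) ` X \<in> tight_cov S (u \<cdot> x)"
proof -
  have Xc: "y \<in> carrier S" if "y \<in> X" for y using tight_cov_le[OF X that x] le_closed x by auto
  have "\<iota> ` ((\<lambda>y. y \<cdot> \<iota> u) ` (\<iota> ` X)) \<in> tight_cov S (\<iota> (\<iota> x \<cdot> \<iota> u))"
    using X x u by (intro tight_cov_sinv tight_cov_mult_right) auto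
  moreover have "\<iota> ` ((\<lambda>y. y \<cdot> \<iota> u) ` (\<iota> ` X)) = (\<lambda>y. u \<cdot> y) ` X"
    using Xc u by (simp add: image_image sinv_mult)
  ultimately show ?thesis using x u by (simp add: sinv_mult)
qed

text \<open>Covers compose: the products xb with b in Y cover xy, and each xb is covered in turn by
  the products ab with a in X.\<close>

lemma tight_cov_mult:
  assumes X: "X \<in> tight_cov S x" and Y: "Y \<in> tight_cov S y" and x: "x \<in> carrier S" and y: "y \<in> carrier S"
  shows "set_mult S X Y \<in> tight_cov S (x \<cdot> y)"
proof -
  have Xc: "a \<in> carrier S" if "a \<in> X" for a using tight_cov_le[OF X that x] le_closed x by auto
  have Yc: "a \<in> carrier S" if "a \<in> Y" for a using tight_cov_le[OF Y that y] le_closed y by auto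
  \<comment> \<open>Different b may give the same v = xb, while \<open>tight_cov_trans\<close> takes
    one cover for each v. The union over all such b is chosen so that the total is exactly
    \<open>set_mult S X Y\<close>.\<close>
  have "(\<Union>v\<in>(\<lambda>b. x \<cdot> b) ` Y. \<Union>b\<in>{b \<in> Y. x \<cdot> b = v}. (\<lambda>a. a \<cdot> b) ` X) \<in> tight_cov S (x \<cdot> y)"
  proof (rule tight_cov_trans)
    show "(\<lambda>b. x \<cdot> b) ` Y \<in> tight_cov S (x \<cdot> y)" using tight_cov_mult_left[OF Y y x] .
    fix v assume "v \<in> (\<lambda>b. x \<cdot> b) ` Y"
    then obtain b0 where b0: "b0 \<in> Y" "v = x \<cdot> b0" by auto
    have 1: "(\<lambda>a. a \<cdot> b) ` X \<in> tight_cov S v" if "b \<in> Y" "x \<cdot> b = v" for b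
      using tight_cov_mult_right[OF X x Yc[OF that(1)]] that by simp
    show "(\<Union>b\<in>{b \<in> Y. x \<cdot> b = v}. (\<lambda>a. a \<cdot> b) ` X) \<in> tight_cov S v"
    proof (rule tight_covI)
      show "v \<in> carrier S" using b0 x Yc by auto
      then show "a \<preceq> v" if "a \<in> (\<Union>b\<in>{b \<in> Y. x \<cdot> b = v}. (\<lambda>a. a \<cdot> b) ` X)" for a
        using that 1 tight_cov_le by blast
      show "finite (\<Union>b\<in>{b \<in> Y. x \<cdot> b = v}. (\<lambda>a. a \<cdot> b) ` X)"
        using tight_cov_finite[OF X] tight_cov_finite[OF Y] by auto
      show "\<exists>c\<in>\<Union>b\<in>{b \<in> Y. x \<cdot> b = v}. (\<lambda>a. a \<cdot> b) ` X. \<exists>w. w \<preceq> z \<and> w \<preceq> c \<and> w \<noteq> szero S" if z: "z \<preceq> v" "z \<noteq> szero S" for z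
      proof -
        obtain c w where "c \<in> (\<lambda>a. a \<cdot> b0) ` X" "w \<preceq> z" "w \<preceq> c" "w \<noteq> szero S"
          using tight_cov_meets[OF 1[OF b0(1) b0(2)[symmetric]] z \<open>v \<in> carrier S\<close>] .
        then show ?thesis using b0 by blast
      qed
    qed
  qed (use x y in auto)
  moreover have "(\<Union>v\<in>(\<lambda>b. x \<cdot> b) ` Y. \<Union>b\<in>{b \<in> Y. x \<cdot> b = v}. (\<lambda>a. a \<cdot> b) ` X) = set_mult S X Y"
    by (auto simp: set_mult_def)
  ultimately show ?thesis by simp
qed

section \<open>The closure operator and order ideals\<close>

abbreviation cl where "cl \<equiv> tight_closure S"

lemma cl_iff: "x \<in> cl A \<longleftrightarrow> x \<in> carrier S \<and> (\<exists>X\<subseteq>A. X \<in> tight_cov S x)"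
  by (auto simp: tight_closure_def)

lemma cl_subset: "cl A \<subseteq> carrier S" by (auto simp: cl_iff)

lemma cl_mono: "A \<subseteq> B \<Longrightarrow> cl A \<subseteq> cl B" unfolding subset_iff cl_iff by blast

lemma cl_incl: "A \<subseteq> carrier S \<Longrightarrow> A \<subseteq> cl A"
  using tight_cov_refl unfolding cl_iff subset_iff by blast

lemma cl_cl: "cl (cl A) = cl A"
proof
  show "cl (cl A) \<subseteq> cl A"
  proof
    fix x assume "x \<in> cl (cl A)"
    then obtain X where x: "x \<in> carrier S" and X: "X \<in> tight_cov S x" "X \<subseteq> cl A" by (auto simp: cl_iff)
    then obtain Y where Y: "\<And>y. y \<in> X \<Longrightarrow> Y y \<subseteq> A \<and> Y y \<in> tight_cov S y" unfolding cl_iff subset_iff by metis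
    then have "(\<Union>y\<in>X. Y y) \<in> tight_cov S x" using tight_cov_trans[OF X(1) x] by blast
    moreover have "(\<Union>y\<in>X. Y y) \<subseteq> A" using Y by blast
    ultimately show "x \<in> cl A" using x by (auto simp: cl_iff)
  qed
qed (rule cl_incl[OF cl_subset])

lemma cl_least: "A \<subseteq> cl B \<Longrightarrow> cl A \<subseteq> cl B"
  using cl_mono cl_cl by metis

lemma zero_in_cl: "szero S \<in> cl A"
  using tight_cov_zero by (auto simp: cl_iff)

lemma cl_meets: assumes "x \<in> cl A" "x \<noteq> szero S" obtains a w where "a \<in> A" "w \<preceq> x" "w \<preceq> a" "w \<noteq> szero S"
proof -
  obtain X where X: "X \<subseteq> A" "X \<in> tight_cov S x" "x \<in> carrier S" using assms by (auto simp: cl_iff)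
  obtain b w where "b \<in> X" "w \<preceq> x" "w \<preceq> b" "w \<noteq> szero S"
    using tight_cov_meets[OF X(2) le_refl[OF X(3)] assms(2) X(3)] .
  then show ?thesis using X that by blast
qed

definition order_ideal where "order_ideal A \<longleftrightarrow> A \<subseteq> carrier S \<and> (\<forall>a\<in>A. \<forall>y. y \<preceq> a \<longrightarrow> y \<in> A)"

lemma order_idealD: "order_ideal A \<Longrightarrow> a \<in> A \<Longrightarrow> y \<preceq> a \<Longrightarrow> y \<in> A"
  by (auto simp: order_ideal_def)

lemma down_set_iff: "F \<subseteq> carrier S \<Longrightarrow> y \<in> down_set S F \<longleftrightarrow> (\<exists>f\<in>F. y \<preceq> f)"
  by (auto simp: down_set_def subset_iff down_iff)

lemma order_ideal_down_set: "F \<subseteq> carrier S \<Longrightarrow> order_ideal (down_set S F)"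
  unfolding order_ideal_def using down_set_iff le_trans le_closed by (metis subset_iff)

lemma down_set_incl: "F \<subseteq> carrier S \<Longrightarrow> F \<subseteq> down_set S F"
  using down_set_iff le_refl by blast

lemma down_set_in_cl: "F \<subseteq> carrier S \<Longrightarrow> down_set S F \<subseteq> cl (down_set S F)"
  using cl_incl order_ideal_down_set order_ideal_def by blast

lemma generators_in_cl: "F \<subseteq> carrier S \<Longrightarrow> F \<subseteq> cl (down_set S F)"
  using down_set_incl down_set_in_cl by blast

lemma down_set_least: "order_ideal A \<Longrightarrow> F \<subseteq> A \<Longrightarrow> down_set S F \<subseteq> A"
  unfolding down_set_def down_def using order_idealD by blast

lemma order_ideal_cl: assumes A: "order_ideal A" shows "order_ideal (cl A)"
proof -
  have "y \<in> cl A" if x: "x \<in> cl A" and y: "y \<preceq> x" for x y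
  proof -
    obtain X where X: "X \<subseteq> A" "X \<in> tight_cov S x" "x \<in> carrier S" using x by (auto simp: cl_iff)
    \<comment> \<open>The cover of x restricted to y stays inside A, since its members lie below
      members of X.\<close>
    have "meet y v \<in> A" if "v \<in> X" for v
    proof -
      have "v \<preceq> x" using tight_cov_le X that by blast
      then show ?thesis using order_idealD[OF A, of v] meet_le2 y X that by blast
    qed
    then have "meet y ` X \<subseteq> A" by auto
    then show ?thesis using tight_cov_restrict[OF X(2) y X(3)] le_closed[OF y X(3)] unfolding cl_iff by blast
  qed
  then show ?thesis using cl_subset by (auto simp: order_ideal_def)
qed

lemma set_mult_mono: "A \<subseteq> A' \<Longrightarrow> B \<subseteq> B' \<Longrightarrow> set_mult S A B \<subseteq> set_mult S A' B'"
  by (auto simp: set_mult_def)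

lemma set_mult_closed: "A \<subseteq> carrier S \<Longrightarrow> B \<subseteq> carrier S \<Longrightarrow> set_mult S A B \<subseteq> carrier S"
  by (auto simp: set_mult_def)

lemma set_mult_assoc:
  assumes "A \<subseteq> carrier S" "B \<subseteq> carrier S" "C \<subseteq> carrier S"
  shows "set_mult S (set_mult S A B) C = set_mult S A (set_mult S B C)"
proof (intro equalityI subsetI)
  fix x assume "x \<in> set_mult S (set_mult S A B) C"
  then obtain a b c where *: "a \<in> A" "b \<in> B" "c \<in> C" "x = a \<cdot> b \<cdot> c" by (auto simp: set_mult_def)
  then have "x = a \<cdot> (b \<cdot> c)" using assms by (simp add: mult_assoc subset_iff)
  then show "x \<in> set_mult S A (set_mult S B C)" using *(1-3) by (simp add: set_multI)
next
  fix x assume "x \<in> set_mult S A (set_mult S B C)"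
  then obtain a b c where *: "a \<in> A" "b \<in> B" "c \<in> C" "x = a \<cdot> (b \<cdot> c)" by (auto simp: set_mult_def)
  then have "x = a \<cdot> b \<cdot> c" using assms by (simp add: mult_assoc subset_iff)
  then show "x \<in> set_mult S (set_mult S A B) C" using *(1-3) by (simp add: set_multI)
qed

lemma set_mult_cl_subset: "set_mult S (cl A) (cl B) \<subseteq> cl (set_mult S A B)"
proof
  fix z assume "z \<in> set_mult S (cl A) (cl B)"
  then obtain x y X Y where z: "z = x \<cdot> y" and x: "x \<in> carrier S" "X \<subseteq> A" "X \<in> tight_cov S x"
    and y: "y \<in> carrier S" "Y \<subseteq> B" "Y \<in> tight_cov S y" by (auto simp: set_mult_def cl_iff)
  then show "z \<in> cl (set_mult S A B)"
    using tight_cov_mult[OF x(3) y(3)] set_mult_mono[OF x(2) y(2)] unfolding cl_iff by auto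
qed

text \<open>Closing the factors first changes nothing after the product is closed. Associativity and
  distributivity of the completion thereby reduce to plain set products.\<close>

lemma cl_set_mult_cl:
  assumes "A \<subseteq> carrier S" "B \<subseteq> carrier S"
  shows "cl (set_mult S (cl A) (cl B)) = cl (set_mult S A B)"
    "cl (set_mult S (cl A) B) = cl (set_mult S A B)" "cl (set_mult S A (cl B)) = cl (set_mult S A B)"
proof -
  have 1: "cl (set_mult S (cl A) (cl B)) \<subseteq> cl (set_mult S A B)" by (rule cl_least[OF set_mult_cl_subset])
  have 2: "cl (set_mult S A B) \<subseteq> cl (set_mult S (cl A) B)" "cl (set_mult S A B) \<subseteq> cl (set_mult S A (cl B))"
    "cl (set_mult S (cl A) B) \<subseteq> cl (set_mult S (cl A) (cl B))" "cl (set_mult S A (cl B)) \<subseteq> cl (set_mult S (cl A) (cl B))"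
    using cl_incl[OF assms(1)] cl_incl[OF assms(2)] by (intro cl_mono set_mult_mono; simp)+
  show "cl (set_mult S (cl A) (cl B)) = cl (set_mult S A B)"
    "cl (set_mult S (cl A) B) = cl (set_mult S A B)" "cl (set_mult S A (cl B)) = cl (set_mult S A B)"
    using 1 2 by blast+
qed

lemma cl_Union_cl:
  assumes "\<And>i. i \<in> I \<Longrightarrow> A i \<subseteq> carrier S" shows "cl (\<Union>i\<in>I. cl (A i)) = cl (\<Union>i\<in>I. A i)"
proof
  show "cl (\<Union>i\<in>I. A i) \<subseteq> cl (\<Union>i\<in>I. cl (A i))" using cl_incl assms by (intro cl_mono) blast
  show "cl (\<Union>i\<in>I. cl (A i)) \<subseteq> cl (\<Union>i\<in>I. A i)" by (intro cl_least UN_least cl_mono) auto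
qed

lemma order_ideal_set_mult:
  assumes A: "order_ideal A" and B: "order_ideal B" shows "order_ideal (set_mult S A B)"
proof -
  have c: "A \<subseteq> carrier S" "B \<subseteq> carrier S" using A B by (auto simp: order_ideal_def)
  have "y \<in> set_mult S A B" if ab: "a \<in> A" "b \<in> B" and y: "y \<preceq> a \<cdot> b" for a b y
  proof -
    have abc: "a \<in> carrier S" "b \<in> carrier S" using ab c by auto
    obtain f where f: "f \<in> E" "y = f \<cdot> (a \<cdot> b)" using le_left[OF y] abc by auto
    then have "y = (f \<cdot> a) \<cdot> b" "f \<cdot> a \<preceq> a" using abc leI_left by (auto simp: mult_assoc)
    then show ?thesis using order_idealD[OF A ab(1)] set_multI ab(2) by metis
  qed
  then have "\<forall>x\<in>set_mult S A B. \<forall>y. y \<preceq> x \<longrightarrow> y \<in> set_mult S A B"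
    by (metis set_mult_iff)
  then show ?thesis using set_mult_closed[OF c] unfolding order_ideal_def by blast
qed

lemma down_set_set_mult:
  assumes "F \<subseteq> carrier S" "G \<subseteq> carrier S"
  shows "set_mult S (down_set S F) (down_set S G) = down_set S (set_mult S F G)"
proof
  show "set_mult S (down_set S F) (down_set S G) \<subseteq> down_set S (set_mult S F G)"
  proof
    fix z assume "z \<in> set_mult S (down_set S F) (down_set S G)"
    then obtain x y where z: "z = x \<cdot> y" "x \<in> down_set S F" "y \<in> down_set S G" by (auto simp: set_mult_def)
    then obtain f g where fg: "f \<in> F" "g \<in> G" "x \<preceq> f" "y \<preceq> g" using assms down_set_iff by metis
    then have "z \<preceq> f \<cdot> g" using z le_mult assms by blast
    then show "z \<in> down_set S (set_mult S F G)" using fg set_multI down_set_iff[OF set_mult_closed[OF assms]] by blast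
  qed
  show "down_set S (set_mult S F G) \<subseteq> set_mult S (down_set S F) (down_set S G)"
    using assms by (intro down_set_least order_ideal_set_mult order_ideal_down_set set_mult_mono down_set_incl)
qed

section \<open>Compatible sets and inversion\<close>

lemma compatible_setD: "compatible_set S A \<Longrightarrow> a \<in> A \<Longrightarrow> b \<in> A \<Longrightarrow> compatible S a b"
  and compatible_set_closed: "compatible_set S A \<Longrightarrow> A \<subseteq> carrier S"
  by (auto simp: compatible_set_def)

lemma compatible_set_mult:
  assumes "compatible_set S A" "compatible_set S B" shows "compatible_set S (set_mult S A B)"
  using assms compatible_mult unfolding compatible_set_def
  by (auto simp: set_mult_def subset_iff)

lemma compatible_set_sinv:
  assumes "compatible_set S A" shows "compatible_set S (\<iota> ` A)"
  using assms compatible_sinv unfolding compatible_set_def by blast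

lemma compatible_set_down_set:
  assumes "compatible_set S A" shows "compatible_set S (down_set S A)"
proof -
  have A: "A \<subseteq> carrier S" using assms by (rule compatible_set_closed)
  have "compatible S x y" if xy: "x \<in> down_set S A" "y \<in> down_set S A" for x y
  proof -
    obtain a b where "a \<in> A" "x \<preceq> a" "b \<in> A" "y \<preceq> b" using xy unfolding down_set_iff[OF A] by blast
    then show ?thesis using compatible_mono compatible_setD[OF assms] A by blast
  qed
  then show ?thesis using order_ideal_down_set[OF A] by (simp add: compatible_set_def order_ideal_def)
qed

text \<open>In ba^-1 c the factor ba^-1 is idempotent by compatibility, so the product lies below c.
  With A = B this yields the law of inverses in the completion; for A inside B it exhibits A as B
  times an idempotent.\<close>

lemma compatible_set_triple:
  assumes B: "compatible_set S B" "order_ideal A" "A \<subseteq> B"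
  shows "set_mult S B (set_mult S (\<iota> ` A) A) = A"
proof
  have Ac: "A \<subseteq> carrier S" "B \<subseteq> carrier S" using B compatible_set_closed by auto
  show "set_mult S B (set_mult S (\<iota> ` A) A) \<subseteq> A"
  proof
    fix x assume "x \<in> set_mult S B (set_mult S (\<iota> ` A) A)"
    then obtain b a c where *: "b \<in> B" "a \<in> A" "c \<in> A" "x = b \<cdot> (\<iota> a \<cdot> c)" by (auto simp: set_mult_def)
    then have "b \<cdot> \<iota> a \<in> E" using compatible_setD[OF B(1)] B(3) unfolding compatible_def by blast
    moreover have "x = (b \<cdot> \<iota> a) \<cdot> c" "c \<in> carrier S" using * Ac mult_assoc by (auto simp: subset_iff)
    ultimately show "x \<in> A" using order_idealD[OF B(2) *(3)] leI_left by metis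
  qed
  show "A \<subseteq> set_mult S B (set_mult S (\<iota> ` A) A)"
  proof
    fix a assume a: "a \<in> A"
    then have "a \<cdot> (\<iota> a \<cdot> a) \<in> set_mult S B (set_mult S (\<iota> ` A) A)" using B(3) by (intro set_multI) auto
    then show "a \<in> set_mult S B (set_mult S (\<iota> ` A) A)" using a Ac by (simp add: subset_iff)
  qed
qed

lemma cl_sinv: assumes "A \<subseteq> carrier S" shows "cl (\<iota> ` A) = \<iota> ` cl A"
proof -
  have *: "\<iota> ` cl A \<subseteq> cl (\<iota> ` A)" for A
  proof
    fix x assume "x \<in> \<iota> ` cl A"
    then obtain y X where y: "x = \<iota> y" "y \<in> carrier S" "X \<subseteq> A" "X \<in> tight_cov S y" by (auto simp: cl_iff)
    then show "x \<in> cl (\<iota> ` A)" unfolding cl_iff using tight_cov_sinv by blast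
  qed
  have "cl (\<iota> ` A) = \<iota> ` \<iota> ` cl (\<iota> ` A)" using sinv_image_image[OF cl_subset] by simp
  also have "\<dots> \<subseteq> \<iota> ` cl (\<iota> ` \<iota> ` A)" using * by blast
  also have "\<dots> = \<iota> ` cl A" using sinv_image_image[OF assms] by simp
  finally show ?thesis using * by blast
qed

lemma down_set_sinv: assumes "F \<subseteq> carrier S" shows "down_set S (\<iota> ` F) = \<iota> ` down_set S F"
proof -
  have *: "\<iota> ` down_set S F \<subseteq> down_set S (\<iota> ` F)" if F: "F \<subseteq> carrier S" for F
  proof
    fix x assume "x \<in> \<iota> ` down_set S F"
    then obtain y f where "x = \<iota> y" "f \<in> F" "y \<preceq> f" using down_set_iff[OF F] by blast
    then show "x \<in> down_set S (\<iota> ` F)" using le_sinv[of y f] F down_set_iff[of "\<iota> ` F"] by blast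
  qed
  have "down_set S (\<iota> ` F) = \<iota> ` \<iota> ` down_set S (\<iota> ` F)"
  proof -
    have "\<iota> ` F \<subseteq> carrier S" using assms by auto
    then have "down_set S (\<iota> ` F) \<subseteq> carrier S" using order_ideal_down_set order_ideal_def by blast
    then show ?thesis using sinv_image_image by simp
  qed
  also have "\<dots> \<subseteq> \<iota> ` down_set S (\<iota> ` \<iota> ` F)" using assms by (intro image_mono *) auto
  also have "\<dots> = \<iota> ` down_set S F" using sinv_image_image[OF assms] by simp
  finally show ?thesis using *[OF assms] by blast
qed

end

text \<open>Under a tight map two elements with a common tight cover have the same image. Here they
  already coincide, as they do in the tight quotient.\<close>

locale separated_inverse_semigroup = inverse_semigroup_with_zero +
  assumes separated: "a \<in> carrier S \<Longrightarrow> b \<in> carrier S \<Longrightarrow> tight_cov S a \<inter> tight_cov S b \<noteq> {} \<Longrightarrow> a = b"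
begin

text \<open>A cover of x by idempotents also covers the domain of x: a non-zero z below x^-1 x is
  translated to xz, and an idempotent below xz lies below its domain z. Separation then gives x =
  x^-1 x.\<close>

lemma idem_if_tight_cov:
  assumes X: "X \<in> tight_cov S x" "X \<subseteq> E" and x: "x \<in> carrier S"
  shows "x \<in> E"
proof -
  have "X \<in> tight_cov S (\<iota> x \<cdot> x)"
  proof (rule tight_covI)
    show "y \<preceq> \<iota> x \<cdot> x" if "y \<in> X" for y
      using le_dom_mono[OF tight_cov_le[OF X(1) that x] x] X(2) that by auto
    fix z assume z: "z \<preceq> \<iota> x \<cdot> x" "z \<noteq> szero S"
    have zE: "z \<in> E" using le_idem[OF z(1)] x by simp
    have xz: "\<iota> x \<cdot> (x \<cdot> z) = z" using idem_le_iff[of z "\<iota> x \<cdot> x"] z zE x idem_comm[of z "\<iota> x \<cdot> x"] by (simp add: mult_assoc)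
    have "x \<cdot> z \<preceq> x" "x \<cdot> z \<noteq> szero S" using xz z x zE leI_right by auto
    then obtain b w where w: "b \<in> X" "w \<preceq> x \<cdot> z" "w \<preceq> b" "w \<noteq> szero S" using tight_cov_meets[OF X(1) _ _ x] by metis
    have wE: "w \<in> E" using le_idem[OF w(3)] w X by auto
    have "\<iota> w \<cdot> w \<preceq> \<iota> (x \<cdot> z) \<cdot> (x \<cdot> z)" using le_dom_mono[OF w(2)] x zE by auto
    then have "w \<preceq> z" using wE zE x xz by (simp add: sinv_mult mult_assoc)
    then show "\<exists>b\<in>X. \<exists>w. w \<preceq> z \<and> w \<preceq> b \<and> w \<noteq> szero S" using w by blast
  qed (use x tight_cov_finite[OF X(1)] in auto)
  then have "x = \<iota> x \<cdot> x" using separated[OF x] X x by blast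
  then show ?thesis using dom_idem[OF x] by metis
qed

lemma cl_idem: "A \<subseteq> E \<Longrightarrow> cl A \<subseteq> E"
  using idem_if_tight_cov unfolding cl_iff subset_iff by blast

text \<open>If X covers x and Y covers y inside A, then X^-1 Y covers x^-1 y and consists of
  idempotents, so x^-1 y is idempotent; likewise for xy^-1.\<close>

lemma compatible_set_cl:
  assumes A: "compatible_set S A" shows "compatible_set S (cl A)"
proof -
  have Ac: "A \<subseteq> carrier S" using A compatible_set_closed by auto
  have "compatible S x y" if x: "x \<in> cl A" and y: "y \<in> cl A" for x y
  proof -
    obtain X Y where *: "X \<subseteq> A" "X \<in> tight_cov S x" "x \<in> carrier S" "Y \<subseteq> A" "Y \<in> tight_cov S y" "y \<in> carrier S"
      using x y by (auto simp: cl_iff)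
    have c: "compatible S a b" if "a \<in> X" "b \<in> Y" for a b using compatible_setD[OF A] * that by blast
    have "set_mult S (\<iota> ` X) Y \<in> tight_cov S (\<iota> x \<cdot> y)" "set_mult S X (\<iota> ` Y) \<in> tight_cov S (x \<cdot> \<iota> y)"
      using * tight_cov_mult tight_cov_sinv by auto
    moreover have "set_mult S (\<iota> ` X) Y \<subseteq> E" "set_mult S X (\<iota> ` Y) \<subseteq> E"
      using c by (auto simp: set_mult_def compatible_def)
    ultimately show ?thesis unfolding compatible_def using * idem_if_tight_cov by auto
  qed
  then show ?thesis using cl_subset by (auto simp: compatible_set_def)
qed

section \<open>The completion as an inverse semigroup: idempotents, inverses and order\<close>

abbreviation D where "D \<equiv> carrier (completion S)"

lemma D_iff: "A \<in> D \<longleftrightarrow> (\<exists>F. finite F \<and> compatible_set S F \<and> A = cl (down_set S F))"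
  by (auto simp: completion_def)

lemma completion_simps [simp]:
  "A \<cdot>\<^bsub>completion S\<^esub> B = cl (set_mult S A B)" "szero (completion S) = {szero S}"
proof -
  show "A \<cdot>\<^bsub>completion S\<^esub> B = cl (set_mult S A B)" by (simp add: completion_def)
  have "cl (down S (szero S)) \<subseteq> {szero S}"
  proof
    fix x assume "x \<in> cl (down S (szero S))"
    then show "x \<in> {szero S}" using cl_meets[of x] by (metis down_iff le_zero zero_closed insertI1)
  qed
  then show "szero (completion S) = {szero S}" using zero_in_cl by (auto simp: completion_def)
qed

lemma D_props:
  assumes "A \<in> D"
  shows "order_ideal A" "compatible_set S A" "cl A = A" "A \<subseteq> carrier S"
proof -
  obtain F where F: "finite F" "compatible_set S F" "A = cl (down_set S F)" using assms D_iff by auto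
  show "order_ideal A" "compatible_set S A" "cl A = A" "A \<subseteq> carrier S"
    using F order_ideal_cl order_ideal_down_set compatible_set_closed compatible_set_cl compatible_set_down_set cl_cl cl_subset
    by auto
qed

lemma D_generators:
  assumes "A \<in> D" obtains F where "finite F" "compatible_set S F" "A = cl (down_set S F)" "F \<subseteq> A"
proof -
  obtain F where F: "finite F" "compatible_set S F" "A = cl (down_set S F)" using assms D_iff by auto
  have "F \<subseteq> A" using generators_in_cl[OF compatible_set_closed[OF F(2)]] F(3) by simp
  then show ?thesis using F that by blast
qed

lemma D_mult: assumes "A \<in> D" "B \<in> D" shows "cl (set_mult S A B) \<in> D"
proof -
  obtain F where F: "finite F" "compatible_set S F" "A = cl (down_set S F)" using assms D_iff by auto
  obtain G where G: "finite G" "compatible_set S G" "B = cl (down_set S G)" using assms D_iff by auto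
  have c: "F \<subseteq> carrier S" "G \<subseteq> carrier S" using F G compatible_set_closed by auto
  have "cl (set_mult S A B) = cl (down_set S (set_mult S F G))"
    unfolding F(3) G(3) using order_ideal_down_set[OF c(1)] order_ideal_down_set[OF c(2)]
    by (simp add: cl_set_mult_cl order_ideal_def down_set_set_mult[OF c])
  moreover have "set_mult S F G = (\<lambda>(a, b). a \<cdot> b) ` (F \<times> G)" by (auto simp: set_mult_def)
  then have "finite (set_mult S F G)" using F G by simp
  ultimately show ?thesis using compatible_set_mult F G D_iff by blast
qed

lemma D_sinv: assumes "A \<in> D" shows "\<iota> ` A \<in> D"
proof -
  obtain F where F: "finite F" "compatible_set S F" "A = cl (down_set S F)" using assms D_iff by auto
  have c: "F \<subseteq> carrier S" using F compatible_set_closed by auto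
  have "\<iota> ` A = cl (down_set S (\<iota> ` F))"
    using F cl_sinv down_set_sinv[OF c] order_ideal_down_set[OF c] by (simp add: order_ideal_def)
  then show ?thesis using F compatible_set_sinv D_iff by blast
qed

text \<open>If AA closes to A, each x in A is covered by elements v = gh of A with g and h in A.
  Compatibility turns the inclusions of domains and ranges into v below h and v below g, from which
  v is seen to be idempotent. So A is the closure of its idempotents and lies in
  \<open>E\<close>.\<close>

lemma D_idempotents: "idempotents (completion S) = {A \<in> D. A \<subseteq> E}"
proof (intro subset_antisym subsetI)
  fix A assume "A \<in> idempotents (completion S)"
  then have A: "A \<in> D" "cl (set_mult S A A) = A" by (auto simp: idempotents_def)
  note p = D_props[OF A(1)]
  have "cl (A \<inter> E) = A"
  proof
    show "cl (A \<inter> E) \<subseteq> A" using cl_mono[of "A \<inter> E" A] p by auto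
    show "A \<subseteq> cl (A \<inter> E)"
    proof
      fix x assume "x \<in> A"
      then obtain X where X: "X \<subseteq> set_mult S A A" "X \<in> tight_cov S x" "x \<in> carrier S" using A by (metis cl_iff)
      have "v \<in> A \<inter> E" if v: "v \<in> X" for v
      proof -
        have vA: "v \<in> A" using order_idealD[OF p(1) \<open>x \<in> A\<close> tight_cov_le[OF X(2) v X(3)]] .
        obtain g h where gh: "g \<in> A" "h \<in> A" "v = g \<cdot> h" using X(1) v by (auto simp: set_mult_def)
        have c: "v \<in> carrier S" "g \<in> carrier S" "h \<in> carrier S" using vA gh p by auto
        have "v \<preceq> h"
        proof (rule compatible_dom_eq[OF compatible_setD[OF p(2) vA gh(2)] _ c(1,3)])
          have "\<iota> v \<cdot> v = \<iota> h \<cdot> ((\<iota> g \<cdot> g) \<cdot> h)" using c gh by (simp add: sinv_mult mult_assoc)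
          also have "\<dots> \<preceq> \<iota> h \<cdot> h" using c by (intro le_mult leI_left) auto
          finally show "\<iota> v \<cdot> v \<preceq> \<iota> h \<cdot> h" .
        qed
        have "v \<preceq> g"
        proof (rule compatible_ran_eq[OF compatible_setD[OF p(2) vA gh(1)] _ c(1,2)])
          have "v \<cdot> \<iota> v = (g \<cdot> (h \<cdot> \<iota> h)) \<cdot> \<iota> g" using c gh by (simp add: sinv_mult mult_assoc)
          also have "\<dots> \<preceq> g \<cdot> \<iota> g" using c by (intro le_mult leI_right) auto
          finally show "v \<cdot> \<iota> v \<preceq> g \<cdot> \<iota> g" .
        qed
        \<comment> \<open>From v below h one gets v = gv, so the range idempotent of v lies below g.
          As v is also below g and has that same range, v equals its range idempotent.\<close>
        have "v = v \<cdot> (\<iota> v \<cdot> v)" using c by simp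
        also have "\<dots> = g \<cdot> (h \<cdot> (\<iota> v \<cdot> v))" by (subst (1) gh(3)) (use c in \<open>simp add: mult_assoc\<close>)
        also have "\<dots> = g \<cdot> v" using le_dom[OF \<open>v \<preceq> h\<close> c(3)] by simp
        finally have gv: "g \<cdot> (v \<cdot> \<iota> v) = v \<cdot> \<iota> v" using c by (metis mult_assoc sinv_closed)
        let ?f = "v \<cdot> \<iota> v"
        have "?f \<preceq> g" using leI_right[of ?f g] gv c by simp
        then have "?f \<cdot> g = ?f" using le_ran[of ?f g] c by (simp add: mult_assoc)
        moreover have "?f \<cdot> g = v" using le_ran[OF \<open>v \<preceq> g\<close> c(2)] c by (simp add: mult_assoc)
        ultimately have "v = ?f" by simp
        then have "v \<in> E" using ran_idem[OF c(1)] by metis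
        then show ?thesis using vA by simp
      qed
      then show "x \<in> cl (A \<inter> E)" unfolding cl_iff using X by blast
    qed
  qed
  then have "A \<subseteq> E" using cl_idem[of "A \<inter> E"] by auto
  then show "A \<in> {A \<in> D. A \<subseteq> E}" using A by auto
next
  fix A assume "A \<in> {A \<in> D. A \<subseteq> E}"
  then have A: "A \<in> D" "A \<subseteq> E" by auto
  note p = D_props[OF A(1)]
  have "set_mult S A A \<subseteq> A"
  proof
    fix x assume "x \<in> set_mult S A A"
    then obtain a b where ab: "a \<in> A" "b \<in> A" "x = a \<cdot> b" by (auto simp: set_mult_def)
    then show "x \<in> A" using order_idealD[OF p(1) ab(1)] leI_right A by blast
  qed
  moreover have "A \<subseteq> set_mult S A A"
  proof
    fix a assume a: "a \<in> A"
    then have "a \<cdot> a \<in> set_mult S A A" by (intro set_multI)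
    moreover have "a \<cdot> a = a" using A a by auto
    ultimately show "a \<in> set_mult S A A" by simp
  qed
  ultimately have "set_mult S A A = A" by blast
  then show "A \<in> idempotents (completion S)" using A p unfolding idempotents_def by simp
qed

lemma completion_assoc:
  assumes "A \<in> D" "B \<in> D" "C \<in> D"
  shows "cl (set_mult S (cl (set_mult S A B)) C) = cl (set_mult S A (cl (set_mult S B C)))"
proof -
  have c: "A \<subseteq> carrier S" "B \<subseteq> carrier S" "C \<subseteq> carrier S" using assms D_props(4) by auto
  show ?thesis
    using c by (simp add: cl_set_mult_cl(2)[OF set_mult_closed[OF c(1,2)] c(3)]
        cl_set_mult_cl(3)[OF c(1) set_mult_closed[OF c(2,3)]] set_mult_assoc[OF c])
qed

lemma completion_triple:
  assumes "A \<in> D" "B \<in> D" "A \<subseteq> B" shows "cl (set_mult S B (cl (set_mult S (\<iota> ` A) A))) = A"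
proof -
  have c: "A \<subseteq> carrier S" "B \<subseteq> carrier S" "\<iota> ` A \<subseteq> carrier S" using assms D_props(4) by auto
  show ?thesis using compatible_set_triple[OF D_props(2)[OF assms(2)] D_props(1)[OF assms(1)] assms(3)]
      cl_set_mult_cl(3)[OF c(2) set_mult_closed[OF c(3,1)]] D_props(3)[OF assms(1)] by simp
qed

lemma completion_inverse:
  assumes "A \<in> D" shows "is_inverse (completion S) A (\<iota> ` A)"
proof -
  have *: "cl (set_mult S (cl (set_mult S A (\<iota> ` A))) A) = A" if "A \<in> D" for A
    using completion_assoc[OF that D_sinv[OF that] that] completion_triple[OF that that] by simp
  have "\<iota> ` \<iota> ` A = A" using sinv_image_image D_props(4)[OF assms] by blast
  then show ?thesis using *[OF assms] *[OF D_sinv[OF assms]] D_sinv[OF assms] by (simp add: is_inverse_def)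
qed

lemma completion_inverse_semigroup: "inverse_semigroup_with_zero (completion S)"
proof
  fix a b c assume *: "a \<in> D" "b \<in> D"
  show "a \<cdot>\<^bsub>completion S\<^esub> b \<in> D" using D_mult * by simp
  show "a \<cdot>\<^bsub>completion S\<^esub> b \<cdot>\<^bsub>completion S\<^esub> c = a \<cdot>\<^bsub>completion S\<^esub> (b \<cdot>\<^bsub>completion S\<^esub> c)" if "c \<in> D"
    using completion_assoc * that by simp
next
  fix A assume A: "A \<in> D"
  show "\<exists>!b. is_inverse (completion S) A b"
  proof (rule unique_inverse_if_idempotents_commute[OF _ _ _ A])
    fix e f assume "e \<in> idempotents (completion S)" "f \<in> idempotents (completion S)"
    \<comment> \<open>Idempotents of the completion consist of idempotents of \<open>S\<close>, so
      they commute elementwise before any closure is taken.\<close>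
    then have ef: "e \<subseteq> E" "f \<subseteq> E" using D_idempotents by auto
    have *: "set_mult S e f \<subseteq> set_mult S f e" if "e \<subseteq> E" "f \<subseteq> E" for e f
      using that idem_comm by (auto simp: set_mult_def) blast
    show "e \<cdot>\<^bsub>completion S\<^esub> f = f \<cdot>\<^bsub>completion S\<^esub> e" using *[OF ef] *[OF ef(2,1)] by simp
  qed (use D_mult completion_assoc completion_inverse[OF A] in auto)
  have "szero S \<in> A" using zero_in_cl[of A] D_props(3)[OF A] by simp
  then have "szero S \<cdot> szero S \<in> set_mult S {szero S} A" "szero S \<cdot> szero S \<in> set_mult S A {szero S}"
    using set_multI[of "szero S" "{szero S}" "szero S" A] set_multI[of "szero S" A "szero S" "{szero S}"] by blast+
  then have "set_mult S {szero S} A = {szero S}" "set_mult S A {szero S} = {szero S}"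
    using D_props(4)[OF A] by (auto simp: set_mult_def subset_iff)
  moreover have "cl {szero S} = {szero S}"
  proof
    show "cl {szero S} \<subseteq> {szero S}"
    proof
      fix x assume "x \<in> cl {szero S}"
      then show "x \<in> {szero S}" using cl_meets[of x "{szero S}"] le_zero by (metis singletonD singletonI)
    qed
  qed (use zero_in_cl in auto)
  ultimately show "szero (completion S) \<cdot>\<^bsub>completion S\<^esub> A = szero (completion S)"
    "A \<cdot>\<^bsub>completion S\<^esub> szero (completion S) = szero (completion S)" by auto
next
  have "compatible_set S {szero S}" by (simp add: compatible_set_def)
  moreover have "down_set S {szero S} = down S (szero S)" by (simp add: down_set_def)
  moreover have "szero (completion S) = cl (down S (szero S))" by (simp add: completion_def del: completion_simps)
  ultimately have "finite {szero S} \<and> compatible_set S {szero S} \<and> szero (completion S) = cl (down_set S {szero S})"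
    by (simp del: completion_simps)
  then show "szero (completion S) \<in> D" unfolding D_iff by blast
qed

sublocale D: inverse_semigroup_with_zero "completion S" by (rule completion_inverse_semigroup)

lemma completion_sinv: "A \<in> D \<Longrightarrow> sinv (completion S) A = \<iota> ` A"
  using D.sinvI completion_inverse by blast

text \<open>A right factor made of idempotents keeps a product inside the order ideal B. Conversely,
  by \<open>completion_triple\<close>, a member A inside B equals B times the idempotent A^-1
  A.\<close>

lemma completion_le_iff: assumes "A \<in> D" "B \<in> D" shows "nat_le (completion S) A B \<longleftrightarrow> A \<subseteq> B"
proof
  assume "nat_le (completion S) A B"
  then obtain C where C: "C \<in> idempotents (completion S)" "A = cl (set_mult S B C)" by (auto simp: nat_le_def)
  have "set_mult S B C \<subseteq> B"
  proof
    fix x assume "x \<in> set_mult S B C"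
    then obtain b c where bc: "b \<in> B" "c \<in> C" "x = b \<cdot> c" by (auto simp: set_mult_def)
    then show "x \<in> B" using order_idealD[OF D_props(1)[OF assms(2)] bc(1)] leI_right C D_idempotents by blast
  qed
  then show "A \<subseteq> B" using cl_mono D_props(3)[OF assms(2)] C by blast
next
  assume "A \<subseteq> B"
  then have "A = B \<cdot>\<^bsub>completion S\<^esub> (\<iota> ` A \<cdot>\<^bsub>completion S\<^esub> A)" using completion_triple assms by simp
  moreover have "\<iota> ` A \<cdot>\<^bsub>completion S\<^esub> A \<in> idempotents (completion S)"
    using D.dom_idem[OF assms(1)] completion_sinv[OF assms(1)] by simp
  ultimately show "nat_le (completion S) A B" unfolding nat_le_def by blast
qed

section \<open>Joins and distributivity of the completion\<close>

lemma is_join_completion: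
  assumes "\<B> \<subseteq> D" "cl (\<Union>\<B>) \<in> D"
  shows "is_join (completion S) \<B> (cl (\<Union>\<B>))"
proof -
  have B: "B \<subseteq> cl (\<Union>\<B>)" if "B \<in> \<B>" for B
  proof -
    have "B \<subseteq> \<Union>\<B>" "\<Union>\<B> \<subseteq> carrier S" using that assms D_props(4) by auto
    then show ?thesis using cl_incl by blast
  qed
  have "cl (\<Union>\<B>) \<subseteq> C" if "C \<in> D" "\<And>B. B \<in> \<B> \<Longrightarrow> B \<subseteq> C" for C
    using cl_mono[of "\<Union>\<B>" C] that D_props(3)[OF that(1)] by auto
  then have "nat_le (completion S) (cl (\<Union>\<B>)) C" if "C \<in> D" "\<And>B. B \<in> \<B> \<Longrightarrow> nat_le (completion S) B C" for C
    using that assms completion_le_iff by (meson subsetD)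
  moreover have "nat_le (completion S) B (cl (\<Union>\<B>))" if "B \<in> \<B>" for B
    using B[OF that] assms that completion_le_iff by (meson subsetD)
  ultimately show ?thesis using assms
    unfolding is_join_def least_def Upper_def nat_order_def by auto
qed

lemma is_join_unique:
  assumes "is_join (completion S) \<B> s" "is_join (completion S) \<B> t" shows "s = t"
proof -
  have c: "s \<in> D" "t \<in> D" using assms by (auto simp: is_join_def least_def Upper_def nat_order_def)
  have "nat_le (completion S) s t" "nat_le (completion S) t s"
    using assms by (auto simp: is_join_def least_def nat_order_def)
  then show ?thesis using completion_le_iff c by auto
qed

text \<open>Compatibility of A and B in the completion means that A^-1 B and AB^-1 consist of
  idempotents, that is, their elements are pairwise compatible. Hence the generators of all members
  together form one finite compatible set.\<close>

lemma completion_join_exists: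
  assumes fin: "finite \<B>" and comp: "compatible_set (completion S) \<B>"
  shows "cl (\<Union>\<B>) \<in> D"
proof -
  have BD: "\<B> \<subseteq> D" using comp by (auto simp: compatible_set_def)
  then have "\<forall>B\<in>\<B>. \<exists>F. finite F \<and> B = cl (down_set S F) \<and> F \<subseteq> B" using D_generators by (metis subsetD)
  then obtain F where F: "\<And>B. B \<in> \<B> \<Longrightarrow> finite (F B) \<and> B = cl (down_set S (F B)) \<and> F B \<subseteq> B" by metis
  let ?G = "\<Union>B\<in>\<B>. F B"
  have c: "compatible S f g" if fg: "f \<in> A" "g \<in> B" "A \<in> \<B>" "B \<in> \<B>" for f g A B
  proof -
    have AB: "A \<in> D" "B \<in> D" using fg BD by auto
    have c: "A \<subseteq> carrier S" "B \<subseteq> carrier S" "\<iota> ` A \<subseteq> carrier S" "\<iota> ` B \<subseteq> carrier S" using AB D_props(4) by auto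
    have "compatible (completion S) A B" using comp fg by (auto simp: compatible_set_def)
    then have "cl (set_mult S (\<iota> ` A) B) \<subseteq> E" "cl (set_mult S A (\<iota> ` B)) \<subseteq> E"
      unfolding compatible_def completion_sinv[OF AB(1)] completion_sinv[OF AB(2)] D_idempotents
      completion_simps by blast+
    then have "set_mult S (\<iota> ` A) B \<subseteq> E" "set_mult S A (\<iota> ` B) \<subseteq> E"
      using cl_incl[OF set_mult_closed[OF c(3,2)]] cl_incl[OF set_mult_closed[OF c(1,4)]] by blast+
    moreover have "\<iota> f \<cdot> g \<in> set_mult S (\<iota> ` A) B" "f \<cdot> \<iota> g \<in> set_mult S A (\<iota> ` B)" using fg by (auto intro: set_multI)
    ultimately show ?thesis unfolding compatible_def by blast
  qed
  have Gc: "?G \<subseteq> carrier S" using F BD D_props(4) by blast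
  have "compatible S f g" if fg: "f \<in> ?G" "g \<in> ?G" for f g
  proof -
    obtain A B where "A \<in> \<B>" "f \<in> F A" "B \<in> \<B>" "g \<in> F B" using fg by blast
    then show ?thesis using c[of f A g B] F by blast
  qed
  then have "compatible_set S ?G" unfolding compatible_set_def using Gc by blast
  moreover have "finite ?G" using fin F by auto
  moreover have "cl (\<Union>\<B>) = cl (down_set S ?G)"
  proof
    show "cl (\<Union>\<B>) \<subseteq> cl (down_set S ?G)"
    proof (rule cl_least, rule Union_least)
      fix B assume B: "B \<in> \<B>"
      then have "down_set S (F B) \<subseteq> down_set S ?G" by (auto simp: down_set_def)
      then show "B \<subseteq> cl (down_set S ?G)" using F[OF B] cl_mono by blast
    qed
    have "down_set S ?G \<subseteq> \<Union>\<B>"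
    proof
      fix y assume "y \<in> down_set S ?G"
      then obtain B f where "B \<in> \<B>" "f \<in> F B" "y \<preceq> f" unfolding down_set_iff[OF Gc] by blast
      then show "y \<in> \<Union>\<B>" using order_idealD[OF D_props(1), of B f y] F BD by blast
    qed
    then show "cl (down_set S ?G) \<subseteq> cl (\<Union>\<B>)" by (rule cl_mono)
  qed
  ultimately show ?thesis using D_iff by blast
qed

text \<open>Set products distribute over unions, joins are closures of unions, and the closure
  absorbs closures taken inside.\<close>

lemma completion_distributive: "distributive_inverse_semigroup (completion S)"
proof
  fix \<B> assume B: "finite \<B>" "compatible_set (completion S) \<B>"
  have BD: "\<B> \<subseteq> D" using B by (auto simp: compatible_set_def)
  have j: "is_join (completion S) \<B> (cl (\<Union>\<B>))" using is_join_completion[OF BD completion_join_exists[OF B]] .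
  show "\<exists>s. is_join (completion S) \<B> s" using j by blast
  fix s A assume s: "is_join (completion S) \<B> s" and A: "A \<in> D"
  have s: "s = cl (\<Union>\<B>)" using is_join_unique[OF s j] .
  have sD: "s \<in> D" using s completion_join_exists[OF B] by simp
  have c: "A \<subseteq> carrier S" "\<Union>\<B> \<subseteq> carrier S" using A BD D_props(4) by auto
  have cB: "B \<subseteq> carrier S" if "B \<in> \<B>" for B using that c by blast
  have "A \<cdot>\<^bsub>completion S\<^esub> s = cl (set_mult S A (\<Union>\<B>))" using cl_set_mult_cl(3)[OF c] s by simp
  also have "set_mult S A (\<Union>\<B>) = (\<Union>B\<in>\<B>. set_mult S A B)" by (auto simp: set_mult_def)
  also have "cl \<dots> = cl (\<Union>B\<in>\<B>. cl (set_mult S A B))"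
    using cl_Union_cl[of \<B> "\<lambda>B. set_mult S A B"] set_mult_closed c cB by simp
  finally have e1: "A \<cdot>\<^bsub>completion S\<^esub> s = cl (\<Union>((\<lambda>B. A \<cdot>\<^bsub>completion S\<^esub> B) ` \<B>))" by simp
  have "s \<cdot>\<^bsub>completion S\<^esub> A = cl (set_mult S (\<Union>\<B>) A)" using cl_set_mult_cl(2)[OF c(2,1)] s by simp
  also have "set_mult S (\<Union>\<B>) A = (\<Union>B\<in>\<B>. set_mult S B A)" by (auto simp: set_mult_def)
  also have "cl \<dots> = cl (\<Union>B\<in>\<B>. cl (set_mult S B A))"
    using cl_Union_cl[of \<B> "\<lambda>B. set_mult S B A"] set_mult_closed c cB by simp
  finally have e2: "s \<cdot>\<^bsub>completion S\<^esub> A = cl (\<Union>((\<lambda>B. B \<cdot>\<^bsub>completion S\<^esub> A) ` \<B>))" by simp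
  show "is_join (completion S) ((\<lambda>B. A \<cdot>\<^bsub>completion S\<^esub> B) ` \<B>) (A \<cdot>\<^bsub>completion S\<^esub> s)"
    unfolding e1
  proof (rule is_join_completion)
    show "(\<lambda>B. A \<cdot>\<^bsub>completion S\<^esub> B) ` \<B> \<subseteq> D" using A BD D_mult by auto
    show "cl (\<Union>((\<lambda>B. A \<cdot>\<^bsub>completion S\<^esub> B) ` \<B>)) \<in> D" unfolding e1[symmetric] using D_mult[OF A sD] by simp
  qed
  show "is_join (completion S) ((\<lambda>B. B \<cdot>\<^bsub>completion S\<^esub> A) ` \<B>) (s \<cdot>\<^bsub>completion S\<^esub> A)"
    unfolding e2
  proof (rule is_join_completion)
    show "(\<lambda>B. B \<cdot>\<^bsub>completion S\<^esub> A) ` \<B> \<subseteq> D" using A BD D_mult by auto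
    show "cl (\<Union>((\<lambda>B. B \<cdot>\<^bsub>completion S\<^esub> A) ` \<B>)) \<in> D" unfolding e2[symmetric] using D_mult[OF sD A] by simp
  qed
qed

end

section \<open>Boolean algebras of idempotents\<close>

lemma idempotent_order_simps [simp]:
  "carrier (idempotent_order T) = idempotents T" "eq (idempotent_order T) = (=)" "le (idempotent_order T) = nat_le T"
  by (simp_all add: idempotent_order_def)

context separated_inverse_semigroup
begin

abbreviation DE where "DE \<equiv> idempotents (completion S)"

text \<open>Idempotents are always compatible, so generators inside \<open>E\<close> are subject to
  finiteness alone.\<close>

lemma DE_iff: "A \<in> DE \<longleftrightarrow> (\<exists>F. finite F \<and> F \<subseteq> E \<and> A = cl (down_set S F))"
proof
  assume "A \<in> DE"
  then have A: "A \<in> D" "A \<subseteq> E" unfolding D_idempotents by blast+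
  obtain F where "finite F" "compatible_set S F" "A = cl (down_set S F)" "F \<subseteq> A" using D_generators[OF A(1)] .
  then show "\<exists>F. finite F \<and> F \<subseteq> E \<and> A = cl (down_set S F)" using A by blast
next
  assume "\<exists>F. finite F \<and> F \<subseteq> E \<and> A = cl (down_set S F)"
  then obtain F where F: "finite F" "F \<subseteq> E" "A = cl (down_set S F)" by auto
  have Fc: "F \<subseteq> carrier S" using F by auto
  then have "compatible_set S F" using F(2) idem_compatible unfolding compatible_set_def by blast
  then have "A \<in> D" using D_iff F by blast
  moreover have "down_set S F \<subseteq> E" using down_set_iff[OF Fc] le_idem F(2) by blast
  then have "A \<subseteq> E" using cl_idem F(3) by simp
  ultimately show "A \<in> DE" unfolding D_idempotents by blast
qed

lemma DE_D: "A \<in> DE \<Longrightarrow> A \<in> D" and DE_E: "A \<in> DE \<Longrightarrow> A \<subseteq> E"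
  unfolding D_idempotents by blast+

lemma DE_join: assumes "A \<in> DE" "B \<in> DE" shows "cl (A \<union> B) \<in> DE"
proof -
  obtain F where F: "finite F" "F \<subseteq> E" "A = cl (down_set S F)" using assms DE_iff by auto
  obtain G where G: "finite G" "G \<subseteq> E" "B = cl (down_set S G)" using assms DE_iff by auto
  have "cl (A \<union> B) = cl (down_set S (F \<union> G))"
  proof
    have "A \<subseteq> cl (down_set S (F \<union> G))" "B \<subseteq> cl (down_set S (F \<union> G))"
      unfolding F(3) G(3) by (intro cl_mono; auto simp: down_set_def)+
    then show "cl (A \<union> B) \<subseteq> cl (down_set S (F \<union> G))" by (intro cl_least) auto
    have "F \<subseteq> carrier S" "G \<subseteq> carrier S" using F G by auto
    then have "down_set S F \<subseteq> A" "down_set S G \<subseteq> B"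
      unfolding F(3) G(3) using down_set_in_cl by blast+
    then show "cl (down_set S (F \<union> G)) \<subseteq> cl (A \<union> B)" by (intro cl_mono) (auto simp: down_set_def)
  qed
  then show ?thesis using F G DE_iff by (metis finite_UnI Un_least)
qed

text \<open>The intersection is the closed product, since x = xx for x in both ideals. Its finite
  generation comes from this description.\<close>

lemma DE_meet: assumes "A \<in> DE" "B \<in> DE" shows "A \<inter> B \<in> DE"
proof -
  have p: "order_ideal A" "order_ideal B" "A \<subseteq> E" "B \<subseteq> E" "cl A = A" "cl B = B"
    using assms DE_D DE_E D_props by auto
  have "cl (set_mult S A B) = A \<inter> B"
  proof
    have "set_mult S A B \<subseteq> A \<inter> B"
    proof
      fix x assume "x \<in> set_mult S A B"
      then obtain a b where ab: "a \<in> A" "b \<in> B" "x = a \<cdot> b" by (auto simp: set_mult_def)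
      then have "a \<in> E" "b \<in> E" using p by auto
      then have "x \<preceq> a" "x \<preceq> b" using ab leI_right leI_left by auto
      then show "x \<in> A \<inter> B" using order_idealD[OF p(1) ab(1)] order_idealD[OF p(2) ab(2)] by simp
    qed
    then show "cl (set_mult S A B) \<subseteq> A \<inter> B" using cl_mono p(5,6) by (metis Int_subset_iff)
    show "A \<inter> B \<subseteq> cl (set_mult S A B)"
    proof
      fix x assume x: "x \<in> A \<inter> B"
      then have "x \<cdot> x \<in> set_mult S A B" by (intro set_multI) auto
      moreover have "x \<in> E" using x p by auto
      ultimately have "x \<in> set_mult S A B" by simp
      moreover have "set_mult S A B \<subseteq> carrier S" using p by (intro set_mult_closed) auto
      ultimately show "x \<in> cl (set_mult S A B)" using cl_incl by blast
    qed
  qed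
  then show ?thesis using D.idem_mult[OF assms] by simp
qed

lemma zero_DE: "{szero S} \<in> DE"
  using D.zero_idem by simp

lemma zero_in_D: "A \<in> D \<Longrightarrow> szero S \<in> A"
  using zero_in_cl[of A] D_props(3)[of A] by simp

text \<open>Induction on the elements to be removed: to remove one more f, each remaining piece c is
  replaced by a complement of \<open>meet c f\<close> in c.\<close>

lemma relative_complement_single:
  assumes K: complemented and e: "e \<in> E" and F: "finite F" "F \<subseteq> E"
  shows "\<exists>C. finite C \<and> C \<subseteq> E \<and> (\<forall>c\<in>C. c \<preceq> e \<and> (\<forall>f\<in>F. orth c f)) \<and> e \<in> cl (down_set S (F \<union> C))"
  using F
proof (induction rule: finite_induct)
  case empty
  have "e \<in> cl (down_set S {e})"
    using e generators_in_cl[of "{e}"] by auto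
  then show ?case using e by (intro exI[of _ "{e}"]) auto
next
  case (insert f F)
  have fE: "f \<in> E" "F \<subseteq> E" using insert.prems by auto
  obtain C where C0: "finite C" "C \<subseteq> E" "\<forall>c\<in>C. c \<preceq> e \<and> (\<forall>f\<in>F. orth c f)" "e \<in> cl (down_set S (F \<union> C))"
    using insert.IH[OF fE(2)] by blast
  then have C: "finite C" "C \<subseteq> E" "\<And>c. c \<in> C \<Longrightarrow> c \<preceq> e" "\<And>c f. c \<in> C \<Longrightarrow> f \<in> F \<Longrightarrow> orth c f"
    "e \<in> cl (down_set S (F \<union> C))" by blast+
  have "has_complement c (meet c f)" if "c \<in> C" for c
    using K meet_le1[of f c] fE C(2) that unfolding complemented_def by auto
  then obtain B where B: "\<And>c. c \<in> C \<Longrightarrow> finite (B c)" "\<And>c. c \<in> C \<Longrightarrow> B c \<subseteq> down S c"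
    "\<And>c b. c \<in> C \<Longrightarrow> b \<in> B c \<Longrightarrow> orth b (meet c f)" "\<And>c. c \<in> C \<Longrightarrow> arrow S c (insert (meet c f) (B c))"
    unfolding has_complement_def by metis
  let ?C = "\<Union>c\<in>C. B c"
  have Bc: "b \<preceq> c" "b \<in> E" "b \<preceq> e" if "c \<in> C" "b \<in> B c" for b c
  proof -
    show 1: "b \<preceq> c" using B(2)[OF that(1)] that(2) by (auto simp: down_def)
    then show "b \<in> E" using le_idem C(2) that(1) by blast
    show "b \<preceq> e" using le_trans[OF 1 C(3)[OF that(1)]] e by simp
  qed
  \<comment> \<open>Whatever lies below b and f lies below c and f, hence below
    \<open>meet c f\<close>, and b is disjoint from that.\<close>
  have orthf: "orth b f" if "c \<in> C" "b \<in> B c" for b c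
    unfolding orth_def
  proof (intro allI impI)
    fix z assume z: "z \<preceq> b" "z \<preceq> f"
    have "z \<preceq> c" using le_trans[OF z(1) Bc(1)[OF that]] C(2) that by auto
    then have "z \<preceq> meet c f" using le_meet z(2) C(2) that fE by auto
    then show "z = szero S" using orthD[OF B(3)[OF that] z(1)] by blast
  qed
  have orthF: "orth b f" if "c \<in> C" "b \<in> B c" "f \<in> F" for b c f
    unfolding orth_def
  proof (intro allI impI)
    fix z assume z: "z \<preceq> b" "z \<preceq> f"
    have "z \<preceq> c" using le_trans[OF z(1) Bc(1)[OF that(1,2)]] C(2) that by auto
    then show "z = szero S" using orthD[OF C(4)[OF that(1,3)]] z(2) by blast
  qed
  have c1: "insert f F \<union> ?C \<subseteq> carrier S" "F \<union> C \<subseteq> carrier S" using fE Bc(2) C(2) by auto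
  note oi = order_ideal_cl[OF order_ideal_down_set[OF c1(1)]]
  have incl: "insert f F \<union> ?C \<subseteq> down_set S (insert f F \<union> ?C)" "down_set S (insert f F \<union> ?C) \<subseteq> cl (down_set S (insert f F \<union> ?C))"
    using down_set_incl[OF c1(1)] down_set_in_cl[OF c1(1)] by auto
  have "c \<in> cl (down_set S (insert f F \<union> ?C))" if c: "c \<in> C" for c
  proof -
    have cE: "c \<in> E" using C(2) c by auto
    have "meet c f \<preceq> f" using cE fE leI_left by (simp add: meet_def)
    then have "meet c f \<in> down_set S (insert f F \<union> ?C)" using down_set_iff[OF c1(1)] by blast
    then have "insert (meet c f) (B c) \<subseteq> down_set S (insert f F \<union> ?C)" using incl c by blast
    moreover have "insert (meet c f) (B c) \<in> tight_cov S c"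
      using B(1,2,4)[OF c] cE fE meet_le1 by (simp add: tight_cov_def down_iff)
    ultimately show ?thesis unfolding cl_iff using cE by blast
  qed
  then have "F \<union> C \<subseteq> cl (down_set S (insert f F \<union> ?C))" using incl by blast
  then have "down_set S (F \<union> C) \<subseteq> cl (down_set S (insert f F \<union> ?C))" using down_set_least[OF oi] by blast
  then have "e \<in> cl (down_set S (insert f F \<union> ?C))" using cl_least C(5) by blast
  moreover have "finite ?C" "?C \<subseteq> E" using C(1) B(1) Bc(2) by auto
  ultimately show ?case using Bc(3) orthf orthF by (intro exI[of _ ?C]) auto
qed

text \<open>A non-zero x in both closures has a non-zero w below some member of C. This w is still
  in the other closure, so a second descent gives a non-zero common lower bound of some c and
  b.\<close>

lemma cl_inter_zero:
  assumes "\<And>b c. b \<in> F \<Longrightarrow> c \<in> C \<Longrightarrow> orth c b" "F \<subseteq> carrier S" "C \<subseteq> carrier S"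
  shows "cl (down_set S F) \<inter> cl (down_set S C) \<subseteq> {szero S}"
proof
  fix x assume x: "x \<in> cl (down_set S F) \<inter> cl (down_set S C)"
  show "x \<in> {szero S}"
  proof (rule ccontr)
    assume "x \<notin> {szero S}"
    then obtain a w where w: "a \<in> down_set S C" "w \<preceq> x" "w \<preceq> a" "w \<noteq> szero S" using cl_meets[of x "down_set S C"] x by auto
    have "w \<in> cl (down_set S F)"
      using order_idealD[OF order_ideal_cl[OF order_ideal_down_set[OF assms(2)]] _ w(2)] x by blast
    then obtain b v where v: "b \<in> down_set S F" "v \<preceq> w" "v \<preceq> b" "v \<noteq> szero S" using cl_meets[OF _ w(4)] by metis
    obtain f c where fc: "f \<in> F" "b \<preceq> f" "c \<in> C" "a \<preceq> c" using v w down_set_iff assms by metis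
    have "v \<preceq> f" using le_trans[OF v(3) fc(2)] fc assms by blast
    moreover have "v \<preceq> c" using le_trans[OF le_trans[OF v(2) w(3)] fc(4)] fc assms le_closed by blast
    ultimately show False using v(4) orthD assms(1) fc by blast
  qed
qed

text \<open>For each generator g of A all generators of B are removed from g at once; the remaining
  pieces, over all g, generate the complement.\<close>

lemma DE_relative_complement:
  assumes K: complemented and A: "A \<in> DE" and B: "B \<in> DE" and sub: "B \<subseteq> A"
  shows "\<exists>C\<in>DE. B \<inter> C = {szero S} \<and> cl (B \<union> C) = A"
proof -
  obtain G where G: "finite G" "G \<subseteq> E" "A = cl (down_set S G)" using A DE_iff by auto
  obtain F where F: "finite F" "F \<subseteq> E" "B = cl (down_set S F)" using B DE_iff by auto
  have c: "F \<subseteq> carrier S" "G \<subseteq> carrier S" using F G by auto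
  have pA: "order_ideal A" "cl A = A" "A \<subseteq> carrier S" using D_props DE_D A by auto
  have *: "\<forall>g\<in>G. \<exists>C. finite C \<and> C \<subseteq> E \<and> (\<forall>c\<in>C. c \<preceq> g \<and> (\<forall>f\<in>F. orth c f)) \<and> g \<in> cl (down_set S (F \<union> C))"
    using relative_complement_single[OF K _ F(1,2)] G by blast
  obtain C where "\<forall>g\<in>G. finite (C g) \<and> C g \<subseteq> E \<and> (\<forall>c\<in>C g. c \<preceq> g \<and> (\<forall>f\<in>F. orth c f)) \<and> g \<in> cl (down_set S (F \<union> C g))"
    using bchoice[OF *] by blast
  then have C: "\<And>g. g \<in> G \<Longrightarrow> finite (C g)" "\<And>g. g \<in> G \<Longrightarrow> C g \<subseteq> E" "\<And>g c. g \<in> G \<Longrightarrow> c \<in> C g \<Longrightarrow> c \<preceq> g"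
     "\<And>g c f. g \<in> G \<Longrightarrow> c \<in> C g \<Longrightarrow> f \<in> F \<Longrightarrow> orth c f" "\<And>g. g \<in> G \<Longrightarrow> g \<in> cl (down_set S (F \<union> C g))" by blast+
  let ?H = "\<Union>g\<in>G. C g"
  let ?C = "cl (down_set S ?H)"
  have H0: "finite ?H" "?H \<subseteq> E" using G(1) C(1,2) by blast+
  then have H: "finite ?H" "?H \<subseteq> E" "?H \<subseteq> carrier S" using idem_closed by blast+
  have CE: "?C \<in> DE" using H DE_iff by blast
  have GA: "G \<subseteq> A" using generators_in_cl[OF c(2)] G(3) by simp
  have "?H \<subseteq> A" using C(3) order_idealD[OF pA(1)] GA by blast
  then have "down_set S ?H \<subseteq> A" by (rule down_set_least[OF pA(1)])
  then have CA: "?C \<subseteq> A" using cl_mono pA by metis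
  have "B \<inter> ?C \<subseteq> {szero S}" unfolding F(3) using C(4) c H by (intro cl_inter_zero) auto
  moreover have "szero S \<in> B \<inter> ?C" using zero_in_D DE_D B CE by blast
  moreover have "cl (B \<union> ?C) = A"
  proof
    show "cl (B \<union> ?C) \<subseteq> A" using cl_mono[of "B \<union> ?C" A] sub CA pA(2) by auto
    have BC: "B \<union> ?C \<subseteq> cl (B \<union> ?C)" using D_props(4)[OF DE_D[OF B]] cl_subset by (intro cl_incl) auto
    have "G \<subseteq> cl (B \<union> ?C)"
    proof
      fix g assume g: "g \<in> G"
      have "down_set S (F \<union> C g) \<subseteq> down_set S F \<union> down_set S ?H" using g by (auto simp: down_set_def)
      also have "\<dots> \<subseteq> B \<union> ?C"
        unfolding F(3) by (intro Un_mono down_set_in_cl c(1) H(3))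
      finally show "g \<in> cl (B \<union> ?C)" using C(5)[OF g] cl_mono by blast
    qed
    moreover have "order_ideal (B \<union> ?C)" using D_props(1)[OF DE_D[OF B]] D_props(1)[OF DE_D[OF CE]] unfolding order_ideal_def by blast
    ultimately have "down_set S G \<subseteq> cl (B \<union> ?C)" using down_set_least order_ideal_cl by blast
    then show "A \<subseteq> cl (B \<union> ?C)" unfolding G(3) by (rule cl_least)
  qed
  ultimately show ?thesis using CE by blast
qed

text \<open>A relative complement of the ideal of f in that of e is finitely generated, and its
  generators supply the finite set for \<open>has_complement e f\<close>. The case of arbitrary x
  then follows by translation.\<close>

lemma complemented_if_DE_relative_complement:
  assumes H: "\<And>A B. A \<in> DE \<Longrightarrow> B \<in> DE \<Longrightarrow> B \<subseteq> A \<Longrightarrow> \<exists>C\<in>DE. B \<inter> C = {szero S} \<and> cl (B \<union> C) = A"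
  shows complemented
  unfolding complemented_def
proof (intro ballI allI impI)
  fix x y assume "x \<in> carrier S" "y \<preceq> x"
  moreover have "has_complement e f" if e: "e \<in> E" and f: "f \<preceq> e" for e f
  proof -
    have fE: "f \<in> E" using le_idem f e by blast
    have ef: "e \<in> carrier S" "f \<in> carrier S" "{e} \<subseteq> carrier S" "{f} \<subseteq> carrier S" using e fE by auto
    let ?A = "cl (down_set S {e})" and ?B = "cl (down_set S {f})"
    have AB: "?A \<in> DE" "?B \<in> DE" using e fE unfolding DE_iff by blast+
    have "down_set S {f} \<subseteq> down_set S {e}"
      using order_ideal_down_set[OF ef(3)] f down_set_iff[OF ef(3)] by (intro down_set_least) auto
    then have "?B \<subseteq> ?A" by (rule cl_mono)
    then obtain C where C: "C \<in> DE" "?B \<inter> C = {szero S}" "cl (?B \<union> C) = ?A" using H[OF AB] by blast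
    then obtain G where G: "finite G" "G \<subseteq> E" "C = cl (down_set S G)" using DE_iff by auto
    have Gc: "G \<subseteq> carrier S" using G by auto
    note oB = D_props(1)[OF DE_D[OF AB(2)]] and oC = D_props(1)[OF DE_D[OF C(1)]]
    have fB: "f \<in> ?B" and eA: "e \<in> ?A" and GC: "G \<subseteq> C"
      using generators_in_cl[OF ef(3)] generators_in_cl[OF ef(4)] generators_in_cl[OF Gc] G(3) by auto
    \<comment> \<open>Multiplication by e puts the generators below e, as
      \<open>has_complement\<close> requires, and keeps them below the original ones, hence disjoint
      from f.\<close>
    let ?G = "(\<lambda>g. e \<cdot> g) ` G"
    have le: "e \<cdot> g \<preceq> e" "e \<cdot> g \<preceq> g" "e \<cdot> g \<in> carrier S" if "g \<in> G" for g using that G(2) e leI_right leI_left by auto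
    have "orth (e \<cdot> g) f" if g: "g \<in> G" for g
      unfolding orth_def
    proof (intro allI impI)
      fix z assume z: "z \<preceq> e \<cdot> g" "z \<preceq> f"
      have "z \<preceq> g" using le_trans[OF z(1) le(2)[OF g]] Gc g by blast
      then have "z \<in> ?B \<inter> C" using order_idealD[OF oB fB z(2)] order_idealD[OF oC, of g z] GC g by blast
      then show "z = szero S" using C(2) by simp
    qed
    moreover have c2: "insert f ?G \<subseteq> carrier S" using ef le by auto
    have "arrow S e (insert f ?G)"
      unfolding arrow_iff[OF ef(1) c2]
    proof (intro allI impI)
      fix z assume z: "z \<preceq> e" "z \<noteq> szero S"
      \<comment> \<open>Two descents are needed: z is in the closure of the union of two ideals, so
        some w below z is in one of them, and each of these is itself the closure of what lies below
        its generators.\<close>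
      have zA: "z \<in> cl (?B \<union> C)" using order_idealD[OF D_props(1)[OF DE_D[OF AB(1)]] eA z(1)] C(3) by simp
      obtain a w where w: "a \<in> ?B \<union> C" "w \<preceq> z" "w \<preceq> a" "w \<noteq> szero S" using cl_meets[OF zA z(2)] .
      have zc: "z \<in> carrier S" using z ef le_closed by blast
      consider "w \<in> ?B" | "w \<in> C" using w(1) order_idealD[OF oB _ w(3)] order_idealD[OF oC _ w(3)] by blast
      then show "\<exists>b\<in>insert f ?G. \<exists>w. w \<preceq> z \<and> w \<preceq> b \<and> w \<noteq> szero S"
      proof cases
        case 1
        obtain b v where v: "b \<in> down_set S {f}" "v \<preceq> w" "v \<preceq> b" "v \<noteq> szero S" using cl_meets[OF 1 w(4)] .
        have "v \<preceq> f" using v down_set_iff[OF ef(4)] le_trans ef by blast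
        moreover have "v \<preceq> z" using le_trans[OF v(2) w(2) zc] .
        ultimately show ?thesis using v by blast
      next
        case 2
        obtain b v where v: "b \<in> down_set S G" "v \<preceq> w" "v \<preceq> b" "v \<noteq> szero S" using cl_meets[OF 2[unfolded G(3)] w(4)] .
        obtain g where g: "g \<in> G" "b \<preceq> g" using v(1) down_set_iff[OF Gc] by blast
        have vg: "v \<preceq> g" using le_trans[OF v(3) g(2)] g Gc by blast
        have vz: "v \<preceq> z" using le_trans[OF v(2) w(2) zc] .
        have ve: "v \<preceq> e" using le_trans[OF vz z(1)] ef by blast
        have "v \<preceq> meet e g" using le_meet[OF ve vg] ef g Gc by blast
        moreover have "meet e g = e \<cdot> g" using g G(2) by (auto simp: meet_def)
        ultimately show ?thesis using v vz g by auto
      qed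
    qed
    ultimately show ?thesis unfolding has_complement_def
      using G(1) le ef by (intro exI[of _ ?G]) (auto simp: down_iff)
  qed
  ultimately show "has_complement x y" using idem_complement_imp_complement by blast
qed

section \<open>The lattice of idempotents of the completion\<close>

lemma DE_le: "A \<in> DE \<Longrightarrow> B \<in> DE \<Longrightarrow> nat_le (completion S) A B \<longleftrightarrow> A \<subseteq> B"
  using completion_le_iff DE_D by blast

lemma DE_cl_union:
  assumes "A \<in> DE" "B \<in> DE" shows "A \<subseteq> cl (A \<union> B)" "B \<subseteq> cl (A \<union> B)" "\<And>C. C \<in> DE \<Longrightarrow> A \<subseteq> C \<Longrightarrow> B \<subseteq> C \<Longrightarrow> cl (A \<union> B) \<subseteq> C"
proof -
  have "A \<union> B \<subseteq> cl (A \<union> B)" using assms DE_D D_props(4) by (intro cl_incl) auto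
  then show "A \<subseteq> cl (A \<union> B)" "B \<subseteq> cl (A \<union> B)" by auto
  show "cl (A \<union> B) \<subseteq> C" if "C \<in> DE" "A \<subseteq> C" "B \<subseteq> C" for C
    using cl_mono[of "A \<union> B" C] that D_props(3)[OF DE_D[OF that(1)]] by auto
qed

lemma DE_least:
  assumes "A \<in> DE" "B \<in> DE"
  shows "least (idempotent_order (completion S)) (cl (A \<union> B)) (Upper (idempotent_order (completion S)) {A, B})"
proof -
  have "nat_le (completion S) A (cl (A \<union> B))" "nat_le (completion S) B (cl (A \<union> B))"
    using DE_cl_union(1,2)[OF assms] DE_le[OF _ DE_join[OF assms]] assms by blast+
  moreover have "nat_le (completion S) (cl (A \<union> B)) C"
    if "C \<in> DE" "nat_le (completion S) A C" "nat_le (completion S) B C" for C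
    using DE_cl_union(3)[OF assms that(1)] DE_le[OF _ that(1)] DE_join[OF assms] assms that(2,3) by blast
  ultimately show ?thesis
    using DE_join[OF assms] assms unfolding least_def Upper_def idempotent_order_simps by blast
qed

lemma DE_greatest:
  assumes "A \<in> DE" "B \<in> DE"
  shows "greatest (idempotent_order (completion S)) (A \<inter> B) (Lower (idempotent_order (completion S)) {A, B})"
proof -
  have "nat_le (completion S) (A \<inter> B) A" "nat_le (completion S) (A \<inter> B) B"
    using DE_le[OF DE_meet[OF assms]] assms by blast+
  moreover have "nat_le (completion S) C (A \<inter> B)"
    if "C \<in> DE" "nat_le (completion S) C A" "nat_le (completion S) C B" for C
    using DE_le[OF that(1)] DE_meet[OF assms] assms that(2,3) by (metis Int_greatest)
  ultimately show ?thesis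
    using DE_meet[OF assms] assms unfolding greatest_def Lower_def idempotent_order_simps by blast
qed

lemma DE_lattice: "lattice (idempotent_order (completion S))"
proof
  let ?L = "idempotent_order (completion S)"
  show "\<exists>s. least ?L s (Upper ?L {x, y})" if "x \<in> carrier ?L" "y \<in> carrier ?L" for x y
    using that DE_least by auto
  show "\<exists>s. greatest ?L s (Lower ?L {x, y})" if "x \<in> carrier ?L" "y \<in> carrier ?L" for x y
    using that DE_greatest by auto
qed (auto simp: DE_le)

interpretation L: lattice "idempotent_order (completion S)" by (rule DE_lattice)

lemma DE_lattice_ops:
  assumes "A \<in> DE" "B \<in> DE"
  shows "join (idempotent_order (completion S)) A B = cl (A \<union> B)"
    "Lattice.meet (idempotent_order (completion S)) A B = A \<inter> B"
proof -
  show "join (idempotent_order (completion S)) A B = cl (A \<union> B)"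
    by (rule L.joinI) (use L.least_unique[OF _ DE_least[OF assms]] assms in auto)
  show "Lattice.meet (idempotent_order (completion S)) A B = A \<inter> B"
    by (rule L.meetI) (use L.greatest_unique[OF _ DE_greatest[OF assms]] assms in auto)
qed

lemma DE_bottom_least: "least (idempotent_order (completion S)) {szero S} (carrier (idempotent_order (completion S)))"
  using zero_DE zero_in_D DE_D by (auto simp: least_def DE_le)

lemma DE_bottom: "bottom (idempotent_order (completion S)) = {szero S}"
  unfolding bottom_def
  by (rule some_equality, rule DE_bottom_least, rule L.least_unique[OF _ DE_bottom_least])

lemma DE_boolean_iff: "generalized_boolean_algebra (idempotent_order (completion S)) \<longleftrightarrow> complemented"
proof
  assume "generalized_boolean_algebra (idempotent_order (completion S))"
  then interpret G: generalized_boolean_algebra "idempotent_order (completion S)" .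
  show complemented
  proof (rule complemented_if_DE_relative_complement)
    fix A B assume AB: "A \<in> DE" "B \<in> DE" "B \<subseteq> A"
    then obtain C where "C \<in> DE" "Lattice.meet (idempotent_order (completion S)) B C = {szero S}" "join (idempotent_order (completion S)) B C = A"
      using G.relative_complement[of B A] DE_bottom DE_le by auto
    then show "\<exists>C\<in>DE. B \<inter> C = {szero S} \<and> cl (B \<union> C) = A" using DE_lattice_ops AB by auto
  qed
next
  assume K: complemented
  let ?L = "idempotent_order (completion S)"
  show "generalized_boolean_algebra ?L"
  proof
    show "\<exists>x. least ?L x (carrier ?L)" using DE_bottom_least by blast
    fix x y z assume xy: "x \<in> carrier ?L" "y \<in> carrier ?L"
    then have xy': "x \<in> DE" "y \<in> DE" by auto
    show "Lattice.meet ?L x (join ?L y z) = join ?L (Lattice.meet ?L x y) (Lattice.meet ?L x z)" if "z \<in> carrier ?L"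
    proof -
      have z: "z \<in> DE" using that by simp
      \<comment> \<open>Distributivity: a cover of v in x by elements of y and z lies inside x,
        because x is downward closed; so it is already contained in the union of the two
        intersections.\<close>
      have "x \<inter> cl (y \<union> z) = cl (x \<inter> y \<union> x \<inter> z)"
      proof
        show "x \<inter> cl (y \<union> z) \<subseteq> cl (x \<inter> y \<union> x \<inter> z)"
        proof
          fix v assume v: "v \<in> x \<inter> cl (y \<union> z)"
          then obtain X where X: "X \<subseteq> y \<union> z" "X \<in> tight_cov S v" "v \<in> carrier S" by (auto simp: cl_iff)
          have "X \<subseteq> x" using v order_idealD[OF D_props(1)[OF DE_D[OF xy'(1)]]] tight_cov_le[OF X(2) _ X(3)] by blast
          then have "X \<subseteq> x \<inter> y \<union> x \<inter> z" using X by blast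
          then show "v \<in> cl (x \<inter> y \<union> x \<inter> z)" using X cl_iff by blast
        qed
        show "cl (x \<inter> y \<union> x \<inter> z) \<subseteq> x \<inter> cl (y \<union> z)"
          using cl_mono[of "x \<inter> y \<union> x \<inter> z" x] cl_mono[of "x \<inter> y \<union> x \<inter> z" "y \<union> z"] D_props(3)[OF DE_D[OF xy'(1)]] by blast
      qed
      then show ?thesis using DE_lattice_ops xy' z DE_join DE_meet by simp
    qed
    show "\<exists>z\<in>carrier ?L. Lattice.meet ?L x z = bottom ?L \<and> join ?L x z = y" if le: "le ?L x y"
    proof -
      obtain C where C: "C \<in> DE" "x \<inter> C = {szero S}" "cl (x \<union> C) = y"
        using DE_relative_complement[OF K xy'(2,1)] le DE_le[OF xy'] by auto
      then show ?thesis using DE_lattice_ops[OF xy'(1) C(1)] DE_bottom by auto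
    qed
  qed
qed

lemma weakly_boolean_completion_iff: "weakly_boolean (completion S) \<longleftrightarrow> complemented"
  using completion_distributive DE_boolean_iff
  by (auto simp: weakly_boolean_def weakly_boolean_axioms_def)

end

section \<open>The quotient by the tight congruence\<close>

context inverse_semigroup_with_zero
begin

abbreviation Q where "Q \<equiv> tight_quotient S"
abbreviation cls ("\<pi>") where "\<pi> a \<equiv> tight_rel S `` {a}"

lemma tight_rel_iff: "(a, b) \<in> tight_rel S \<longleftrightarrow> a \<in> carrier S \<and> b \<in> carrier S \<and> (\<exists>X. X \<in> tight_cov S a \<and> X \<in> tight_cov S b)"
  by (auto simp: tight_rel_def)

text \<open>The covers X and Y both lie below b, so the meets of their members exist. The family of
  these meets refines X as a cover of a and Y as a cover of c.\<close>

lemma tight_rel_trans: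
  assumes "(a, b) \<in> tight_rel S" "(b, c) \<in> tight_rel S" shows "(a, c) \<in> tight_rel S"
proof -
  obtain X Y where *: "X \<in> tight_cov S a" "X \<in> tight_cov S b" "Y \<in> tight_cov S b" "Y \<in> tight_cov S c"
    "a \<in> carrier S" "b \<in> carrier S" "c \<in> carrier S" using assms unfolding tight_rel_iff by blast
  have X: "x \<preceq> b" if "x \<in> X" for x using tight_cov_le[OF *(2) that *(6)] .
  have Y: "y \<preceq> b" if "y \<in> Y" for y using tight_cov_le[OF *(3) that *(6)] .
  have "(\<Union>x\<in>X. meet x ` Y) \<in> tight_cov S a"
    using tight_cov_restrict[OF *(3)] X * by (intro tight_cov_trans) auto
  moreover have "(\<Union>y\<in>Y. meet y ` X) \<in> tight_cov S c"
    using tight_cov_restrict[OF *(2)] Y * by (intro tight_cov_trans) auto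
  moreover have "meet x y = meet y x" if "x \<in> X" "y \<in> Y" for x y
    using meet_commute[OF X[OF that(1)] Y[OF that(2)] *(6)] .
  then have "(\<Union>x\<in>X. meet x ` Y) = (\<Union>y\<in>Y. meet y ` X)" by (auto simp: image_iff) (metis)+
  ultimately show ?thesis using * unfolding tight_rel_iff by metis
qed

lemma equiv_tight_rel: "equiv (carrier S) (tight_rel S)"
proof (rule equivI)
  show "tight_rel S \<subseteq> carrier S \<times> carrier S" by (auto simp: tight_rel_def)
  show "refl_on (carrier S) (tight_rel S)" using tight_cov_refl by (auto simp: refl_on_def tight_rel_iff)
  show "sym (tight_rel S)" by (auto simp: sym_def tight_rel_iff)
  show "trans (tight_rel S)" using tight_rel_trans unfolding trans_def by blast
qed

lemma cls_eq_iff: "a \<in> carrier S \<Longrightarrow> b \<in> carrier S \<Longrightarrow> \<pi> a = \<pi> b \<longleftrightarrow> (\<exists>X. X \<in> tight_cov S a \<and> X \<in> tight_cov S b)"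
  using eq_equiv_class_iff[OF equiv_tight_rel] tight_rel_iff by metis

lemma cls_closed [simp]: "a \<in> carrier S \<Longrightarrow> \<pi> a \<in> carrier Q"
  by (simp add: tight_quotient_def quotientI)

lemma cls_cases: assumes "q \<in> carrier Q" obtains a where "a \<in> carrier S" "q = \<pi> a"
  using assms by (auto simp: tight_quotient_def elim: quotientE)

lemma zero_quotient: "szero Q = \<pi> (szero S)"
  by (simp add: tight_quotient_def)

text \<open>If X covers a and a', and Y covers b and b', then the products XY cover both ab and
  a'b'; hence all products of representatives are congruent.\<close>

lemma mult_quotient:
  assumes "a \<in> carrier S" "b \<in> carrier S" shows "\<pi> a \<cdot>\<^bsub>Q\<^esub> \<pi> b = \<pi> (a \<cdot> b)"
proof -
  have m: "(a \<cdot> b, a' \<cdot> b') \<in> tight_rel S" if ab: "(a, a') \<in> tight_rel S" "(b, b') \<in> tight_rel S" for a' b'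
  proof -
    obtain X Y where *: "X \<in> tight_cov S a" "X \<in> tight_cov S a'" "Y \<in> tight_cov S b" "Y \<in> tight_cov S b'"
    "a' \<in> carrier S" "b' \<in> carrier S" using ab unfolding tight_rel_iff by blast
    have "set_mult S X Y \<in> tight_cov S (a \<cdot> b)" "set_mult S X Y \<in> tight_cov S (a' \<cdot> b')"
      using tight_cov_mult * assms by auto
    then show ?thesis using assms * unfolding tight_rel_iff by blast
  qed
  have refl: "a \<in> \<pi> a" "b \<in> \<pi> b" using assms tight_cov_refl by (auto simp: tight_rel_iff)
  have "tight_rel S `` set_mult S (\<pi> a) (\<pi> b) = \<pi> (a \<cdot> b)"
  proof
    show "tight_rel S `` set_mult S (\<pi> a) (\<pi> b) \<subseteq> \<pi> (a \<cdot> b)"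
    proof
      fix x assume "x \<in> tight_rel S `` set_mult S (\<pi> a) (\<pi> b)"
      then obtain a' b' where "(a, a') \<in> tight_rel S" "(b, b') \<in> tight_rel S" "(a' \<cdot> b', x) \<in> tight_rel S"
        by (auto simp: set_mult_def)
      then show "x \<in> \<pi> (a \<cdot> b)" using m tight_rel_trans by blast
    qed
    have "a \<cdot> b \<in> set_mult S (\<pi> a) (\<pi> b)" using refl by (rule set_multI)
    then show "\<pi> (a \<cdot> b) \<subseteq> tight_rel S `` set_mult S (\<pi> a) (\<pi> b)" by blast
  qed
  then show ?thesis by (simp add: tight_quotient_def)
qed

text \<open>Lallement's lemma: if \<open>b\<close> is the inverse of \<open>u \<cdot> u\<close>, then \<open>u \<cdot> b \<cdot> u\<close> is an idempotent congruent to \<open>u\<close>.\<close>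

lemma idempotent_quotient:
  assumes "q \<in> idempotents Q" obtains e where "e \<in> E" "q = \<pi> e"
proof -
  have q: "q \<in> carrier Q" "q \<cdot>\<^bsub>Q\<^esub> q = q" using assms by (auto simp: idempotents_def)
  obtain u where u: "u \<in> carrier S" "q = \<pi> u" using cls_cases[OF q(1)] .
  have uu: "\<pi> (u \<cdot> u) = \<pi> u" using q u mult_quotient by simp
  define b where "b = \<iota> (u \<cdot> u)"
  have b: "b \<in> carrier S" "b \<cdot> (u \<cdot> (u \<cdot> b)) = b" "u \<cdot> (u \<cdot> (b \<cdot> (u \<cdot> u))) = u \<cdot> u"
    using mult_sinv_mult(1)[of "u \<cdot> u"] mult_sinv_mult(2)[of "u \<cdot> u"] u
    by (simp_all add: b_def mult_assoc del: mult_sinv_mult)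
  let ?e = "u \<cdot> (b \<cdot> u)"
  have ec: "?e \<in> carrier S" using u b by simp
  have "?e \<cdot> ?e = u \<cdot> ((b \<cdot> (u \<cdot> (u \<cdot> b))) \<cdot> u)" using u b(1) by (simp add: mult_assoc)
  also have "\<dots> = ?e" using b by simp
  finally have "?e \<in> E" by (rule idemI[OF ec])
  have "\<pi> ?e = \<pi> u \<cdot>\<^bsub>Q\<^esub> (\<pi> b \<cdot>\<^bsub>Q\<^esub> \<pi> u)" using u b by (simp add: mult_quotient)
  also have "\<dots> = \<pi> (u \<cdot> u) \<cdot>\<^bsub>Q\<^esub> (\<pi> b \<cdot>\<^bsub>Q\<^esub> \<pi> (u \<cdot> u))" by (simp only: uu)
  also have "\<dots> = \<pi> (u \<cdot> (u \<cdot> (b \<cdot> (u \<cdot> u))))" using u b(1) by (simp add: mult_quotient mult_assoc)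
  also have "\<dots> = q" using b(3) uu u by simp
  finally show ?thesis using that \<open>?e \<in> E\<close> by metis
qed

lemma cls_idem: "e \<in> E \<Longrightarrow> \<pi> e \<in> idempotents Q"
  unfolding idempotents_def[of Q] using mult_quotient[of e e] by simp

text \<open>Inverses are inherited from \<open>S\<close>. Their uniqueness reduces to commuting
  idempotents, each of which is the class of an idempotent of \<open>S\<close>.\<close>

lemma quotient_inverse_semigroup: "inverse_semigroup_with_zero Q"
proof
  fix a b c assume ab: "a \<in> carrier Q" "b \<in> carrier Q"
  obtain a' b' where *: "a' \<in> carrier S" "a = \<pi> a'" "b' \<in> carrier S" "b = \<pi> b'" using ab cls_cases by metis
  show "a \<cdot>\<^bsub>Q\<^esub> b \<in> carrier Q" using * by (simp add: mult_quotient)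
  assume "c \<in> carrier Q"
  then obtain c' where "c' \<in> carrier S" "c = \<pi> c'" using cls_cases by metis
  then show "a \<cdot>\<^bsub>Q\<^esub> b \<cdot>\<^bsub>Q\<^esub> c = a \<cdot>\<^bsub>Q\<^esub> (b \<cdot>\<^bsub>Q\<^esub> c)" using * by (simp add: mult_quotient mult_assoc)
next
  show "szero Q \<in> carrier Q" by (simp add: zero_quotient)
  fix a assume a: "a \<in> carrier Q"
  obtain a' where *: "a' \<in> carrier S" "a = \<pi> a'" using cls_cases[OF a] .
  show "szero Q \<cdot>\<^bsub>Q\<^esub> a = szero Q" "a \<cdot>\<^bsub>Q\<^esub> szero Q = szero Q" using * by (simp_all add: zero_quotient mult_quotient)
  show "\<exists>!b. is_inverse Q a b"
  proof (rule unique_inverse_if_idempotents_commute[OF _ _ _ a])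
    show "e \<cdot>\<^bsub>Q\<^esub> f = f \<cdot>\<^bsub>Q\<^esub> e" if ef: "e \<in> idempotents Q" "f \<in> idempotents Q" for e f
    proof -
      obtain e' where e': "e' \<in> E" "e = \<pi> e'" using idempotent_quotient[OF ef(1)] .
      obtain f' where f': "f' \<in> E" "f = \<pi> f'" using idempotent_quotient[OF ef(2)] .
      show ?thesis using e' f' idem_comm[of e' f'] by (simp add: mult_quotient)
    qed
    show "\<exists>b. is_inverse Q a b"
      using * by (intro exI[of _ "\<pi> (\<iota> a')"]) (simp add: is_inverse_def mult_quotient mult_assoc)
    fix a b c assume ab: "a \<in> carrier Q" "b \<in> carrier Q"
    obtain a' b' where *: "a' \<in> carrier S" "a = \<pi> a'" "b' \<in> carrier S" "b = \<pi> b'" using ab cls_cases by metis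
    show "a \<cdot>\<^bsub>Q\<^esub> b \<in> carrier Q" using * by (simp add: mult_quotient)
    assume "c \<in> carrier Q"
    then obtain c' where "c' \<in> carrier S" "c = \<pi> c'" using cls_cases by metis
    then show "a \<cdot>\<^bsub>Q\<^esub> b \<cdot>\<^bsub>Q\<^esub> c = a \<cdot>\<^bsub>Q\<^esub> (b \<cdot>\<^bsub>Q\<^esub> c)" using * by (simp add: mult_quotient mult_assoc)
  qed
qed

text \<open>The idempotent factor that witnesses the order in the quotient lifts to an idempotent of
  \<open>S\<close>.\<close>

lemma cls_le_lift: assumes "nat_le Q q (\<pi> b)" "b \<in> carrier S" obtains c where "c \<preceq> b" "c \<in> carrier S" "q = \<pi> c"
proof -
  obtain p where p: "p \<in> idempotents Q" "q = \<pi> b \<cdot>\<^bsub>Q\<^esub> p" using assms by (auto simp: nat_le_def)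
  obtain e where e: "e \<in> E" "p = \<pi> e" using idempotent_quotient[OF p(1)] .
  then have "q = \<pi> (b \<cdot> e)" "b \<cdot> e \<preceq> b" "b \<cdot> e \<in> carrier S" using p assms leI_right by (auto simp: mult_quotient)
  then show ?thesis using that by blast
qed

lemma cls_mono: assumes "a \<preceq> b" "b \<in> carrier S" shows "nat_le Q (\<pi> a) (\<pi> b)"
proof -
  obtain e where e: "e \<in> E" "a = b \<cdot> e" using assms by (auto simp: nat_le_def)
  then have "\<pi> a = \<pi> b \<cdot>\<^bsub>Q\<^esub> \<pi> e" using assms by (simp add: mult_quotient)
  then show ?thesis using cls_idem[OF e(1)] unfolding nat_le_def by blast
qed

text \<open>An inequality between classes need not hold between the given representatives; it holds
  for the members of some tight cover of the smaller one.\<close>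

lemma cls_le_tight_cov:
  assumes "nat_le Q (\<pi> a) (\<pi> b)" "a \<in> carrier S" "b \<in> carrier S"
  obtains X where "X \<in> tight_cov S a" "\<And>x. x \<in> X \<Longrightarrow> x \<preceq> b"
proof -
  obtain c where c: "c \<preceq> b" "c \<in> carrier S" "\<pi> a = \<pi> c" using cls_le_lift[OF assms(1,3)] .
  then obtain X where X: "X \<in> tight_cov S a" "X \<in> tight_cov S c" using cls_eq_iff assms by blast
  have "x \<preceq> b" if "x \<in> X" for x using le_trans[OF tight_cov_le[OF X(2) that c(2)] c(1) assms(3)] .
  then show ?thesis using X that by blast
qed

text \<open>A cover of zero contains nothing but zero, so it cannot cover a non-zero
  element.\<close>

lemma cls_eq_zero_iff: "a \<in> carrier S \<Longrightarrow> \<pi> a = szero Q \<longleftrightarrow> a = szero S"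
proof
  assume a: "a \<in> carrier S" "\<pi> a = szero Q"
  then obtain X where X: "X \<in> tight_cov S a" "X \<in> tight_cov S (szero S)" using cls_eq_iff zero_quotient by auto
  show "a = szero S"
  proof (rule ccontr)
    assume "a \<noteq> szero S"
    then obtain b w where "b \<in> X" "w \<preceq> b" "w \<noteq> szero S" using tight_cov_meets[OF X(1) le_refl[OF a(1)] _ a(1)] by metis
    moreover have "b = szero S" using tight_cov_le[OF X(2) calculation(1)] le_zero by auto
    ultimately show False using le_zero by auto
  qed
qed (simp add: zero_quotient)

lemma cls_le_meets:
  assumes "nat_le Q (\<pi> z) (\<pi> a)" "z \<in> carrier S" "a \<in> carrier S" "z \<noteq> szero S"
  obtains w where "w \<preceq> z" "w \<preceq> a" "w \<noteq> szero S"
proof -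
  obtain X where X: "X \<in> tight_cov S z" "\<And>x. x \<in> X \<Longrightarrow> x \<preceq> a"
    by (rule cls_le_tight_cov[OF assms(1-3)]) blast
  obtain x w where w: "x \<in> X" "w \<preceq> z" "w \<preceq> x" "w \<noteq> szero S" using tight_cov_meets[OF X(1) le_refl[OF assms(2)] assms(4,2)] .
  have "w \<preceq> a" using le_trans[OF w(3) X(2)[OF w(1)] assms(3)] .
  then show ?thesis using w that by blast
qed

interpretation Q: inverse_semigroup_with_zero Q by (rule quotient_inverse_semigroup)

lemma cls_common_lower_iff:
  assumes "a \<in> carrier S" "b \<in> carrier S"
  shows "(\<exists>w. w \<preceq> a \<and> w \<preceq> b \<and> w \<noteq> szero S) \<longleftrightarrow> (\<exists>q. nat_le Q q (\<pi> a) \<and> nat_le Q q (\<pi> b) \<and> q \<noteq> szero Q)"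
proof
  assume "\<exists>w. w \<preceq> a \<and> w \<preceq> b \<and> w \<noteq> szero S"
  then obtain w where w: "w \<preceq> a" "w \<preceq> b" "w \<noteq> szero S" by blast
  have "w \<in> carrier S" using w assms le_closed by blast
  then have "\<pi> w \<noteq> szero Q" using w(3) cls_eq_zero_iff by simp
  then show "\<exists>q. nat_le Q q (\<pi> a) \<and> nat_le Q q (\<pi> b) \<and> q \<noteq> szero Q"
    using cls_mono[OF w(1) assms(1)] cls_mono[OF w(2) assms(2)] by (intro exI[of _ "\<pi> w"]) simp
next
  assume "\<exists>q. nat_le Q q (\<pi> a) \<and> nat_le Q q (\<pi> b) \<and> q \<noteq> szero Q"
  then obtain q where q: "nat_le Q q (\<pi> a)" "nat_le Q q (\<pi> b)" "q \<noteq> szero Q" by blast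
  \<comment> \<open>The lower bound q lifts to z below a, but z need not lie below b; a further step
    down through \<open>cls_le_meets\<close> achieves both.\<close>
  obtain z where z: "z \<preceq> a" "z \<in> carrier S" "q = \<pi> z" using cls_le_lift[OF q(1) assms(1)] .
  have "z \<noteq> szero S" using q z zero_quotient by auto
  then obtain w where w: "w \<preceq> z" "w \<preceq> b" "w \<noteq> szero S" using cls_le_meets[OF _ z(2) assms(2)] q z by metis
  then show "\<exists>w. w \<preceq> a \<and> w \<preceq> b \<and> w \<noteq> szero S" using le_trans[OF w(1) z(1) assms(1)] by blast
qed

lemma cls_orth_iff: "a \<in> carrier S \<Longrightarrow> b \<in> carrier S \<Longrightarrow> Q.orth (\<pi> a) (\<pi> b) \<longleftrightarrow> orth a b"
  using cls_common_lower_iff[of a b] unfolding orth_def Q.orth_def by metis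

text \<open>Both sides speak only of non-zero common lower bounds, and the elements below the class
  of a are the classes of elements below a.\<close>

lemma cls_arrow_iff:
  assumes a: "a \<in> carrier S" and B: "B \<subseteq> carrier S"
  shows "arrow Q (\<pi> a) (\<pi> ` B) \<longleftrightarrow> arrow S a B"
proof -
  have c: "\<pi> a \<in> carrier Q" "\<pi> ` B \<subseteq> carrier Q" using a B by auto
  show ?thesis
  proof
    assume H: "arrow Q (\<pi> a) (\<pi> ` B)"
    show "arrow S a B" unfolding arrow_iff[OF a B]
    proof (intro allI impI)
      fix z assume z: "z \<preceq> a" "z \<noteq> szero S"
      have zc: "z \<in> carrier S" using z a le_closed by blast
      have "nat_le Q (\<pi> z) (\<pi> a)" "\<pi> z \<noteq> szero Q" using cls_mono z a cls_eq_zero_iff zc by auto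
      then obtain b q where b: "b \<in> B" "nat_le Q q (\<pi> z)" "nat_le Q q (\<pi> b)" "q \<noteq> szero Q"
        using H unfolding Q.arrow_iff[OF c] by blast
      then show "\<exists>b\<in>B. \<exists>w. w \<preceq> z \<and> w \<preceq> b \<and> w \<noteq> szero S" using cls_common_lower_iff[of z b] zc B by blast
    qed
  next
    assume H: "arrow S a B"
    show "arrow Q (\<pi> a) (\<pi> ` B)" unfolding Q.arrow_iff[OF c]
    proof (intro allI impI)
      fix q assume q: "nat_le Q q (\<pi> a)" "q \<noteq> szero Q"
      obtain z where z: "z \<preceq> a" "z \<in> carrier S" "q = \<pi> z" using cls_le_lift[OF q(1) a] .
      then have "z \<noteq> szero S" using q zero_quotient by auto
      then obtain b w where "b \<in> B" "w \<preceq> z" "w \<preceq> b" "w \<noteq> szero S" using H z unfolding arrow_iff[OF a B] by blast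
      then show "\<exists>b\<in>\<pi> ` B. \<exists>w. nat_le Q w q \<and> nat_le Q w b \<and> w \<noteq> szero Q"
        using cls_common_lower_iff[of z b] z B by blast
    qed
  qed
qed

text \<open>A common cover Z of the classes of a and b lifts to elements \<open>c z\<close> below a.
  These need not lie below b, but each has a tight cover \<open>X z\<close> of elements below b. The
  union of these covers is a common cover of a and b in \<open>S\<close>, so their classes
  agree.\<close>

lemma quotient_separated: "separated_inverse_semigroup Q"
proof (unfold_locales)
  fix p q assume pq: "p \<in> carrier Q" "q \<in> carrier Q" "tight_cov Q p \<inter> tight_cov Q q \<noteq> {}"
  obtain a where a: "a \<in> carrier S" "p = \<pi> a" using cls_cases[OF pq(1)] .
  obtain b where b: "b \<in> carrier S" "q = \<pi> b" using cls_cases[OF pq(2)] .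
  obtain Z where Z: "Z \<in> tight_cov Q (\<pi> a)" "Z \<in> tight_cov Q (\<pi> b)" using pq a b by auto
  have "\<forall>z\<in>Z. \<exists>c. c \<preceq> a \<and> c \<in> carrier S \<and> z = \<pi> c"
    using cls_le_lift[OF Q.tight_cov_le[OF Z(1) _ cls_closed[OF a(1)]] a(1)] by blast
  then obtain c where c: "\<And>z. z \<in> Z \<Longrightarrow> c z \<preceq> a" "\<And>z. z \<in> Z \<Longrightarrow> c z \<in> carrier S" "\<And>z. z \<in> Z \<Longrightarrow> z = \<pi> (c z)" by metis
  have "\<forall>z\<in>Z. \<exists>X. X \<in> tight_cov S (c z) \<and> (\<forall>x\<in>X. x \<preceq> b)"
  proof
    fix z assume z: "z \<in> Z"
    have "nat_le Q (\<pi> (c z)) (\<pi> b)" using Q.tight_cov_le[OF Z(2) z cls_closed[OF b(1)]] c(3)[OF z] by simp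
    then obtain X where "X \<in> tight_cov S (c z)" "\<And>x. x \<in> X \<Longrightarrow> x \<preceq> b" using cls_le_tight_cov[OF _ c(2)[OF z] b(1)] by metis
    then show "\<exists>X. X \<in> tight_cov S (c z) \<and> (\<forall>x\<in>X. x \<preceq> b)" by blast
  qed
  then obtain X where X: "\<And>z. z \<in> Z \<Longrightarrow> X z \<in> tight_cov S (c z)" "\<And>z x. z \<in> Z \<Longrightarrow> x \<in> X z \<Longrightarrow> x \<preceq> b" by metis
  let ?Y = "\<Union>z\<in>Z. X z"
  have cZ: "\<pi> ` c ` Z = Z" using c(3) by force
  \<comment> \<open>Stated for any d whose class is covered by Z, so that it serves a and b alike:
    by \<open>cls_arrow_iff\<close> the lifted elements meet everything non-zero below d even when
    they are not themselves below d.\<close>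
  have meets: "\<exists>x\<in>?Y. \<exists>w. w \<preceq> v \<and> w \<preceq> x \<and> w \<noteq> szero S"
    if d: "d \<in> carrier S" "Z \<in> tight_cov Q (\<pi> d)" and v: "v \<preceq> d" "v \<noteq> szero S" for d v
  proof -
    have cc: "c ` Z \<subseteq> carrier S" using c(2) by auto
    have "arrow S d (c ` Z)" using d(2) cls_arrow_iff[OF d(1) cc] cZ by (simp add: tight_cov_def)
    then obtain z w where w: "z \<in> Z" "w \<preceq> v" "w \<preceq> c z" "w \<noteq> szero S" using v unfolding arrow_iff[OF d(1) cc] by blast
    obtain x u where u: "x \<in> X z" "u \<preceq> w" "u \<preceq> x" "u \<noteq> szero S"
      using tight_cov_meets[OF X(1)[OF w(1)] w(3,4) c(2)[OF w(1)]] .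
    have "u \<preceq> v" using le_trans[OF u(2) w(2)] le_closed[OF v(1) d(1)] by blast
    then show ?thesis using u w by blast
  qed
  have fin: "finite ?Y" using Q.tight_cov_finite[OF Z(1)] tight_cov_finite[OF X(1)] by blast
  have "?Y \<in> tight_cov S a"
  proof (rule tight_covI[OF a(1) fin])
    fix x assume "x \<in> ?Y"
    then obtain z where "z \<in> Z" "x \<in> X z" by blast
    then show "x \<preceq> a" using le_trans[OF tight_cov_le[OF X(1)] c(1) a(1)] c(2) by blast
  qed (rule meets[OF a(1) Z(1)])
  moreover have "?Y \<in> tight_cov S b"
    by (rule tight_covI[OF b(1) fin]) (use X(2) in blast, rule meets[OF b(1) Z(2)])
  ultimately show "p = q" using a b cls_eq_iff by blast
qed

lemma quotient_complemented_iff: "Q.complemented \<longleftrightarrow> complemented"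
proof
  assume K: "Q.complemented"
  show complemented unfolding complemented_def
  proof (intro ballI allI impI)
    fix x y assume x: "x \<in> carrier S" and y: "y \<preceq> x"
    have yc: "y \<in> carrier S" using y x le_closed by blast
    obtain C where C: "finite C" "C \<subseteq> down Q (\<pi> x)" "\<forall>c\<in>C. Q.orth c (\<pi> y)" "arrow Q (\<pi> x) (insert (\<pi> y) C)"
      using K x cls_mono[OF y x] unfolding Q.complemented_def Q.has_complement_def by (meson cls_closed)
    have "\<forall>c\<in>C. \<exists>d. d \<preceq> x \<and> d \<in> carrier S \<and> c = \<pi> d"
      using C(2) cls_le_lift[OF _ x] unfolding down_def by blast
    then obtain d where d: "\<And>c. c \<in> C \<Longrightarrow> d c \<preceq> x" "\<And>c. c \<in> C \<Longrightarrow> d c \<in> carrier S" "\<And>c. c \<in> C \<Longrightarrow> c = \<pi> (d c)" by metis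
    have "\<pi> ` insert y (d ` C) = insert (\<pi> y) C" using d(3) by force
    then have "arrow S x (insert y (d ` C))" using C(4) cls_arrow_iff[OF x, of "insert y (d ` C)"] d(2) yc by auto
    moreover have "orth (d c) y" if "c \<in> C" for c
      using C(3) d(3)[OF that] cls_orth_iff[OF d(2)[OF that] yc] that by auto
    ultimately show "has_complement x y"
      unfolding has_complement_def using C(1) d(1) x by (intro exI[of _ "d ` C"]) (auto simp: down_iff)
  qed
next
  assume K: complemented
  show Q.complemented unfolding Q.complemented_def
  proof (intro ballI allI impI)
    fix p q assume p: "p \<in> carrier Q" and q: "nat_le Q q p"
    obtain x where x: "x \<in> carrier S" "p = \<pi> x" using cls_cases[OF p] .
    obtain y where y: "y \<preceq> x" "y \<in> carrier S" "q = \<pi> y" using cls_le_lift[OF _ x(1)] q x by metis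
    obtain C where C: "finite C" "C \<subseteq> down S x" "\<forall>c\<in>C. orth c y" "arrow S x (insert y C)"
      using K x y unfolding complemented_def has_complement_def by metis
    have Cc: "c \<in> carrier S" "c \<preceq> x" if "c \<in> C" for c using C(2) that by (auto simp: down_def)
    have "arrow Q p (insert q (\<pi> ` C))" using C(4) cls_arrow_iff[OF x(1), of "insert y C"] Cc y x by auto
    moreover have "Q.orth (\<pi> c) q" if "c \<in> C" for c using C(3) that cls_orth_iff Cc y by auto
    moreover have "\<pi> c \<in> down Q p" if "c \<in> C" for c
      using cls_mono Cc[OF that] x p Q.down_iff by auto
    ultimately show "Q.has_complement p q"
      unfolding Q.has_complement_def using C(1) by (intro exI[of _ "\<pi> ` C"]) auto
  qed
qed

lemma weakly_boolean_tight_completion_iff: "weakly_boolean (tight_completion S) \<longleftrightarrow> complemented"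
  using separated_inverse_semigroup.weakly_boolean_completion_iff[OF quotient_separated] quotient_complemented_iff
  by (simp add: tight_completion_eq)

end

theorem theorem5p15:
  fixes S :: "('a, 'b) zsemigroup_scheme"
  assumes "inverse_semigroup_with_zero S"
  shows "(closedin (universal_topology S) (carrier (ultrafilter_groupoid S))
            \<longleftrightarrow> (\<forall>A. tight_filter S A \<longrightarrow> sultrafilter S A))
       \<and> ((\<forall>A. tight_filter S A \<longrightarrow> sultrafilter S A)
            \<longleftrightarrow> (\<forall>A. tight_filter S A \<and> contains_idempotent S A
                    \<longrightarrow> sultrafilter S A \<and> contains_idempotent S A))
       \<and> ((\<forall>A. tight_filter S A \<and> contains_idempotent S A
              \<longrightarrow> sultrafilter S A \<and> contains_idempotent S A)
            \<longleftrightarrow> closedin (subtopology (universal_topology S) (identities (universal_groupoid S)))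
                    (identities (ultrafilter_groupoid S)))
       \<and> (closedin (subtopology (universal_topology S) (identities (universal_groupoid S)))
                    (identities (ultrafilter_groupoid S))
            \<longleftrightarrow> (\<forall>x\<in>carrier S. \<forall>X. finite X \<and> X \<subseteq> down S x
                    \<longrightarrow> compactin (ultrafilter_topology S) (V_basic S x X)))
       \<and> ((\<forall>x\<in>carrier S. \<forall>X. finite X \<and> X \<subseteq> down S x
              \<longrightarrow> compactin (ultrafilter_topology S) (V_basic S x X))
            \<longleftrightarrow> weakly_boolean (tight_completion S))"
proof -
  interpret inverse_semigroup_with_zero S by (rule assms)
  show ?thesis
    unfolding closed_ultrafilters_iff closed_idempotent_ultrafilters_iff tight_ultra_iff idem_tight_ultra_iff
      compact_V_iff weakly_boolean_tight_completion_iff by blast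
qed

end
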